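(* Let $n\in\mathbb{N}$, $p\ge1$, $\alpha>0$ with $2<\alpha p<2p+1$. Then O'Hara's energy $E^{\alpha,p}$ is continuously Fréchet-differentiable on $W^{1+\frac{\alpha p-1}{2p},2p}_{\mathrm{ir}}(\mathbb{R}/\mathbb{Z},\mathbb{R}^n)$.
   Context: $E^{\alpha,p}(\gamma)=\iint_{(\mathbb{R}/\mathbb{Z})^2}\Big(\frac1{|\gamma(x)-\gamma(y)|^\alpha}-\frac1{d_\gamma(x,y)^\alpha}\Big)^p|\gamma'(x)||\gamma'(y)|\,dx\,dy$, where $d_\gamma(x,y)$ is the length of the shortest arc of the closed curve $\gamma:\mathbb{R}/\mathbb{Z}\to\mathbb{R}^n$ connecting $\gamma(x)$ and $\gamma(y)$. With $s=\frac{\alpha p-1}{2p}\in(0,1)$ and $\rho=2p$, $W^{1+s,\rho}(\mathbb{R}/\mathbb{Z},\mathbb{R}^n)$ is the Sobolev–Slobodeckiĭ space of 1-periodic $f\in W^{1,\rho}_{\mathrm{loc}}(\mathbb{R},\mathbb{R}^n)$ with $[f']_{s,\rho}:=\Big(\int_0^1\int_{-1/2}^{1/2}\frac{|f'(u+w)-f'(u)|^\rho}{|w|^{1+s\rho}}\,dw\,du\Big)^{1/\rho}<\infty$, normed by $(\|f\|_{L^\rho}^\rho+\|f'\|_{L^\rho}^\rho+[f']_{s,\rho}^\rho)^{1/\rho}$. It embeds into $C^1$. The subscript $\mathrm{ir}$ denotes the (open) subset of curves that are injective on $\mathbb{R}/\mathbb{Z}$ and regular ($\gamma'(x)\ne0$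 for all $x$). *)

theory Defs
  imports "HOL-Analysis.Analysis"
begin

section \<open>Sobolev--Slobodeckij spaces of 1-periodic curves\<close>

text \<open>Weak derivatives are tested against \<open>C\<^sub>c\<^sup>1\<close> functions (as in Brezis' textbook). The
  local integrability requirements keep the Bochner integrals below away from their default value.\<close>

definition test_fun :: "(real \<Rightarrow> real) \<Rightarrow> (real \<Rightarrow> real) \<Rightarrow> bool" where
  "test_fun \<phi> \<phi>' \<longleftrightarrow>
     (\<forall>x. (\<phi> has_real_derivative \<phi>' x) (at x)) \<and> continuous_on UNIV \<phi>' \<and>
     (\<exists>r. \<forall>x. r < \<bar>x\<bar> \<longrightarrow> \<phi> x = 0)"

definition locally_integrable :: "(real \<Rightarrow> 'a::euclidean_space) \<Rightarrow> bool" where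
  "locally_integrable f \<longleftrightarrow> (\<forall>a b. set_integrable lborel {a..b} f)"

definition has_weak_derivative ::
    "(real \<Rightarrow> 'a::euclidean_space) \<Rightarrow> (real \<Rightarrow> 'a) \<Rightarrow> bool" where
  "has_weak_derivative f g \<longleftrightarrow>
     locally_integrable f \<and> locally_integrable g \<and>
     (\<forall>\<phi> \<phi>'. test_fun \<phi> \<phi>' \<longrightarrow>
        (\<integral>x. \<phi>' x *\<^sub>R f x \<partial>lborel) = - (\<integral>x. \<phi> x *\<^sub>R g x \<partial>lborel))"

text \<open>The weak derivative is unique almost everywhere, and the integrals in which
  \<open>weak_derivative\<close> is used below do not depend on the chosen version.\<close>

definition weak_derivative :: "(real \<Rightarrow> 'a::euclidean_space) \<Rightarrow> real \<Rightarrow> 'a" where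
  "weak_derivative f = (SOME g. has_weak_derivative f g)"

definition Lp_loc :: "real \<Rightarrow> (real \<Rightarrow> 'a::euclidean_space) \<Rightarrow> bool" where
  "Lp_loc \<rho> f \<longleftrightarrow>
     f \<in> borel_measurable borel \<and> (\<forall>a b. set_integrable lborel {a..b} (\<lambda>x. norm (f x) powr \<rho>))"

text \<open>The \<open>\<rho>\<close>-th powers of the \<open>L\<^sup>\<rho>\<close>-norm over one period and of the Gagliardo seminorm.\<close>

definition Lp_pow :: "real \<Rightarrow> (real \<Rightarrow> 'a::euclidean_space) \<Rightarrow> ennreal" where
  "Lp_pow \<rho> f = (\<integral>\<^sup>+x\<in>{0..1}. ennreal (norm (f x) powr \<rho>) \<partial>lborel)"

definition gagliardo_pow :: "real \<Rightarrow> real \<Rightarrow> (real \<Rightarrow> 'a::euclidean_space) \<Rightarrow> ennreal" where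
  "gagliardo_pow s \<rho> g =
     (\<integral>\<^sup>+u\<in>{0..1}. (\<integral>\<^sup>+w\<in>{-1/2..1/2}.
        ennreal (norm (g (u + w) - g u) powr \<rho> / \<bar>w\<bar> powr (1 + s * \<rho>)) \<partial>lborel) \<partial>lborel)"

text \<open>The space \<open>W\<^bsup>1+s,\<rho>\<^esup>\<close>: each class of functions modulo null sets is represented by its unique
  continuous member (every element of \<open>W\<^sup>1\<^sup>,\<^sup>\<rho>\<close> in one variable has one).\<close>

definition sobolev_slobodeckij :: "real \<Rightarrow> real \<Rightarrow> (real \<Rightarrow> 'a::euclidean_space) set" where
  "sobolev_slobodeckij s \<rho> =
     {f. continuous_on UNIV f \<and> (\<forall>x. f (x + 1) = f x) \<and> Lp_loc \<rho> f \<and>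
         (\<exists>g. has_weak_derivative f g \<and> Lp_loc \<rho> g \<and> gagliardo_pow s \<rho> g < \<infinity>)}"

definition sobolev_slobodeckij_norm ::
    "real \<Rightarrow> real \<Rightarrow> (real \<Rightarrow> 'a::euclidean_space) \<Rightarrow> real" where
  "sobolev_slobodeckij_norm s \<rho> f =
     enn2real (Lp_pow \<rho> f + Lp_pow \<rho> (weak_derivative f) + gagliardo_pow s \<rho> (weak_derivative f))
       powr (1 / \<rho>)"

definition injective_regular :: "(real \<Rightarrow> 'a::euclidean_space) \<Rightarrow> bool" where
  "injective_regular \<gamma> \<longleftrightarrow>
     inj_on \<gamma> {0..<1} \<and> (\<forall>x. \<exists>v. (\<gamma> has_vector_derivative v) (at x) \<and> v \<noteq> 0)"

definition sobolev_slobodeckij_ir :: "real \<Rightarrow> real \<Rightarrow> (real \<Rightarrow> 'a::euclidean_space) set" where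
  "sobolev_slobodeckij_ir s \<rho> = {\<gamma> \<in> sobolev_slobodeckij s \<rho>. injective_regular \<gamma>}"

section \<open>O'Hara's energies\<close>

definition speed :: "(real \<Rightarrow> 'a::euclidean_space) \<Rightarrow> real \<Rightarrow> real" where
  "speed \<gamma> x = norm (vector_derivative \<gamma> (at x))"

definition arc_length :: "(real \<Rightarrow> 'a::euclidean_space) \<Rightarrow> real \<Rightarrow> real \<Rightarrow> real" where
  "arc_length \<gamma> a b = (LINT t:{a..b}|lborel. speed \<gamma> t)"

text \<open>The two arcs between \<open>\<gamma> x\<close> and \<open>\<gamma> y\<close> are parametrised by \<open>[x, z]\<close> and \<open>[z, x + 1]\<close>, where
  \<open>z \<in> [x, x + 1)\<close> represents the class of \<open>y\<close> modulo 1.\<close>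

definition intrinsic_dist :: "(real \<Rightarrow> 'a::euclidean_space) \<Rightarrow> real \<Rightarrow> real \<Rightarrow> real" where
  "intrinsic_dist \<gamma> x y =
     (let z = x + frac (y - x) in min (arc_length \<gamma> x z) (arc_length \<gamma> z (x + 1)))"

text \<open>Meant for injective regular curves: there the denominators vanish only if \<open>x\<close> and \<open>y\<close> agree
  modulo 1 (a null set), and the base of the power is nonnegative.\<close>

definition ohara_energy :: "real \<Rightarrow> real \<Rightarrow> (real \<Rightarrow> 'a::euclidean_space) \<Rightarrow> ennreal" where
  "ohara_energy \<alpha> p \<gamma> =
     (\<integral>\<^sup>+x\<in>{0..1}. (\<integral>\<^sup>+y\<in>{0..1}.
        ennreal ((1 / norm (\<gamma> x - \<gamma> y) powr \<alpha> - 1 / intrinsic_dist \<gamma> x y powr \<alpha>) powr p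
                 * speed \<gamma> x * speed \<gamma> y) \<partial>lborel) \<partial>lborel)"

section \<open>Continuous Frechet differentiability on a normed function space\<close>

text \<open>The Sobolev--Slobodeckij spaces depend on real parameters and hence cannot be types of class
  \<open>real_normed_vector\<close>. So the normed space is given by a carrier \<open>V\<close> of functions with pointwise
  operations and a norm \<open>N\<close>.\<close>

definition bounded_linear_functional_on ::
    "('x \<Rightarrow> 'a::real_vector) set \<Rightarrow> (('x \<Rightarrow> 'a) \<Rightarrow> real) \<Rightarrow> (('x \<Rightarrow> 'a) \<Rightarrow> real) \<Rightarrow> bool" where
  "bounded_linear_functional_on V N L \<longleftrightarrow>
     (\<forall>f\<in>V. \<forall>g\<in>V. L (\<lambda>x. f x + g x) = L f + L g) \<and>
     (\<forall>c. \<forall>f\<in>V. L (\<lambda>x. c *\<^sub>R f x) = c * L f) \<and>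
     (\<exists>K. \<forall>f\<in>V. \<bar>L f\<bar> \<le> K * N f)"

definition open_in_normed ::
    "('x \<Rightarrow> 'a::real_vector) set \<Rightarrow> (('x \<Rightarrow> 'a) \<Rightarrow> real) \<Rightarrow> ('x \<Rightarrow> 'a) set \<Rightarrow> bool" where
  "open_in_normed V N U \<longleftrightarrow> U \<subseteq> V \<and>
     (\<forall>f\<in>U. \<exists>\<delta>>0. \<forall>g\<in>V. N (\<lambda>x. g x - f x) < \<delta> \<longrightarrow> g \<in> U)"

definition has_frechet_derivative_on ::
    "('x \<Rightarrow> 'a::real_vector) set \<Rightarrow> (('x \<Rightarrow> 'a) \<Rightarrow> real) \<Rightarrow> ('x \<Rightarrow> 'a) set \<Rightarrow>
     (('x \<Rightarrow> 'a) \<Rightarrow> real) \<Rightarrow> (('x \<Rightarrow> 'a) \<Rightarrow> ('x \<Rightarrow> 'a) \<Rightarrow> real) \<Rightarrow> bool" where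
  "has_frechet_derivative_on V N U F D \<longleftrightarrow>
     (\<forall>f\<in>U. bounded_linear_functional_on V N (D f) \<and>
        (\<forall>\<epsilon>>0. \<exists>\<delta>>0. \<forall>h\<in>V. N h < \<delta> \<longrightarrow> (\<lambda>x. f x + h x) \<in> U \<longrightarrow>
           \<bar>F (\<lambda>x. f x + h x) - F f - D f h\<bar> \<le> \<epsilon> * N h))"

text \<open>Continuity of the derivative refers to the operator norm on the dual of \<open>(V, N)\<close>.\<close>

definition continuously_frechet_differentiable_on ::
    "('x \<Rightarrow> 'a::real_vector) set \<Rightarrow> (('x \<Rightarrow> 'a) \<Rightarrow> real) \<Rightarrow> ('x \<Rightarrow> 'a) set \<Rightarrow>
     (('x \<Rightarrow> 'a) \<Rightarrow> real) \<Rightarrow> bool" where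
  "continuously_frechet_differentiable_on V N U F \<longleftrightarrow>
     open_in_normed V N U \<and>
     (\<exists>D. has_frechet_derivative_on V N U F D \<and>
        (\<forall>f\<in>U. \<forall>\<epsilon>>0. \<exists>\<delta>>0. \<forall>g\<in>U. N (\<lambda>x. g x - f x) < \<delta> \<longrightarrow>
           (\<forall>h\<in>V. \<bar>D g h - D f h\<bar> \<le> \<epsilon> * N h)))"

end

theory Submission
  imports Defs
begin

text \<open>The energy depends on \<open>\<gamma>\<close> only through its velocity \<open>v = \<gamma>'\<close>, which is continuous by a fractional
  Morrey embedding: the difference quotients of \<open>\<gamma>\<close> over dyadic steps converge uniformly at a
  geometric rate governed by the Gagliardo seminorm. For \<open>\<bar>w\<bar> \<le> 1/2\<close> the chord between \<open>\<gamma> x\<close> and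
  \<open>\<gamma> (x + w)\<close> is \<open>w\<close> times the mean of \<open>v\<close> over the parameter segment, the arc is \<open>\<bar>w\<bar>\<close> times the mean
  of the norm of \<open>v\<close>, and \<open>\<gamma>\<close> is injective and regular iff the mean of \<open>v\<close> stays away from zero.
  The energy density is \<open>gap\<^sup>p |v x| |v (x + w)|\<close> divided by the \<open>\<alpha> p\<close>-th power of \<open>\<bar>w\<bar>\<close>, where
  \<open>gap\<close> is bounded by the mean square oscillation \<open>osc v\<close> along the segment, whose \<open>p\<close>-th power is integrable by Jensen's
  inequality. The variation of \<open>gap\<close> in direction \<open>k\<close> is bounded by \<open>osc v / \<theta> + \<theta> osc k\<close> for every small
  \<open>\<theta>\<close>. These bounds give, by dominated convergence, the derivative along lines, and, by sending \<open>\<theta>\<close> to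
  zero, its continuity in the operator norm: for \<open>v\<^sub>j \<rightarrow> v\<close> and directions \<open>k\<^sub>j\<close> in the unit ball the part
  \<open>\<theta> osc k\<^sub>j\<close>, which need not converge, is uniformly small. The mean value theorem then yields Frechet
  differentiability. The minimum over the two arcs is harmless since the arcs have equal length
  only on a null set, away from the diagonal.\<close>

section \<open>Elementary inequalities\<close>

text \<open>The exponents fit because \<open>osc\<close> is quadratic in the velocity: its
  \<open>p\<close>-th power is controlled by increments to the power \<open>2 * p\<close>, which is
  \<open>\<rho>\<close>, and \<open>1 + s * \<rho>\<close> equals \<open>\<alpha> * p\<close>, so
  the Gagliardo weight is exactly that of the energy. The condition \<open>2 < \<alpha> * p\<close>
  says \<open>s * \<rho> > 1\<close>, the range in which velocities are continuous. The obstacle is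
  that the unit ball of directions is not compact, so no single integrable function dominates the
  variations for all of them. The variation of the gap, however, is essentially a product of a
  first-order deviation of \<open>v\<close> and one of \<open>k\<close>; Young's inequality with
  weight \<theta> moves the cost onto the fixed curve. This yields continuity in the operator norm
  and not only for each fixed direction. The longer way round the curve allows no such cancellation.
  It can be the shorter arc only for \<open>\<bar>w\<bar> \<ge> c / (2 * C)\<close>, where the
  weight is bounded; \<open>far_part\<close> records these offsets. All constants depend on a curve
  only through its bounds \<open>c\<close> and \<open>C\<close>, which are shared by a whole ball of
  curves.\<close>

lemma norm_add_first_order:
  fixes a b :: "'a::real_inner"
  assumes "a \<noteq> 0"
  shows "0 \<le> norm (a + b) - norm a - sgn a \<bullet> b"
    and "norm (a + b) - norm a - sgn a \<bullet> b \<le> (norm b)\<^sup>2 / (2 * norm a)"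
proof -
  have pos: "norm a > 0" using assms by simp
  have s: "sgn a \<bullet> y = (a \<bullet> y) / norm a" for y
    by (simp add: sgn_div_norm divide_inverse)
  have "(a \<bullet> (a + b)) \<le> norm a * norm (a + b)" by (rule norm_cauchy_schwarz)
  moreover have "a \<bullet> (a + b) = norm a * norm a + a \<bullet> b"
    by (simp add: inner_add_right dot_square_norm power2_eq_square)
  ultimately have "norm a * norm a + a \<bullet> b \<le> norm a * norm (a + b)" by simp
  then show "0 \<le> norm (a + b) - norm a - sgn a \<bullet> b"
    using pos by (simp add: s field_simps)
  have "0 \<le> (norm (a + b) - norm a)\<^sup>2" by simp
  then have "2 * (norm a * norm (a + b)) \<le> (norm (a + b))\<^sup>2 + (norm a)\<^sup>2"
    by (simp add: power2_eq_square algebra_simps)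
  also have "(norm (a + b))\<^sup>2 = (norm a)\<^sup>2 + 2 * (a \<bullet> b) + (norm b)\<^sup>2"
    by (simp add: power2_norm_eq_inner inner_add_left inner_add_right inner_commute)
  finally have "norm (a + b) \<le> (2 * (norm a)\<^sup>2 + 2 * (a \<bullet> b) + (norm b)\<^sup>2) / (2 * norm a)"
    using pos by (simp add: pos_le_divide_eq algebra_simps)
  also have "\<dots> = norm a + (a \<bullet> b) / norm a + (norm b)\<^sup>2 / (2 * norm a)"
    using pos by (simp add: add_divide_distrib power2_eq_square)
  finally show "norm (a + b) - norm a - sgn a \<bullet> b \<le> (norm b)\<^sup>2 / (2 * norm a)"
    by (simp add: s)
qed

text \<open>Only \<open>b\<close> has to stay away from zero: over the common denominator
  \<open>norm b\<close> the difference splits into \<open>a - b\<close> and a multiple of the unit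
  vector \<open>sgn a\<close> by the difference of the lengths. The 2 counts these two
  terms.\<close>

lemma norm_sgn_diff_le:
  fixes a b :: "'a::real_inner"
  assumes "0 < c" "c \<le> norm b"
  shows "norm (sgn a - sgn b) \<le> 2 * norm (a - b) / c"
proof (cases "a = 0")
  case True
  have "norm (sgn a - sgn b) \<le> 2" using True norm_sgn[of b] by (simp split: if_splits)
  also have "2 \<le> 2 * norm (a - b) / c" using True assms by (simp add: field_simps)
  finally show ?thesis .
next
  case False
  have nb: "norm b > 0" using assms by linarith
  have "sgn a - sgn b = (1 / norm b) *\<^sub>R ((a - b) + (norm b - norm a) *\<^sub>R sgn a)"
    using False nb by (simp add: sgn_div_norm algebra_simps divide_inverse)
  then have "norm (sgn a - sgn b) = (1 / norm b) * norm ((a - b) + (norm b - norm a) *\<^sub>R sgn a)"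
    by simp
  also have "\<dots> \<le> (1 / norm b) * (norm (a - b) + norm (a - b))"
  proof (intro mult_left_mono order.trans[OF norm_triangle_ineq] add_left_mono)
    show "norm ((norm b - norm a) *\<^sub>R sgn a) \<le> norm (a - b)"
      using False norm_triangle_ineq3[of b a] by (simp add: norm_sgn norm_minus_commute)
  qed simp
  also have "\<dots> \<le> 2 * norm (a - b) / c"
    using assms nb by (simp add: field_simps mult_right_mono)
  finally show ?thesis .
qed

lemma abs_sgn_inner_le:
  fixes a y :: "'a::real_inner"
  assumes "norm y \<le> K"
  shows "\<bar>sgn a \<bullet> y\<bar> \<le> K"
proof -
  have "\<bar>sgn a \<bullet> y\<bar> \<le> norm (sgn a) * norm y" by (rule Cauchy_Schwarz_ineq2)
  also have "\<dots> \<le> 1 * K" using assms by (intro mult_mono) (auto simp: norm_sgn)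
  finally show ?thesis by simp
qed

text \<open>Law of cosines for the unit vectors \<open>sgn a\<close> and \<open>e\<close>. With
  \<open>e\<close> the direction of the chord it turns a deficit of length into a squared deviation
  of tangents.\<close>

lemma norm_minus_inner_unit:
  fixes a e :: "'a::real_inner"
  assumes "norm e = 1"
  shows "norm a - a \<bullet> e = norm a / 2 * (norm (sgn a - e))\<^sup>2"
proof (cases "a = 0")
  case False
  have "(norm (sgn a - e))\<^sup>2 = 2 - 2 * (sgn a \<bullet> e)"
  proof -
    have "(norm (sgn a - e))\<^sup>2 = (norm (sgn a))\<^sup>2 - 2 * (sgn a \<bullet> e) + (norm e)\<^sup>2"
      by (simp add: power2_norm_eq_inner inner_diff_left inner_diff_right inner_commute)
    then show ?thesis using assms False by (simp add: norm_sgn)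
  qed
  moreover have "sgn a \<bullet> e = (a \<bullet> e) / norm a" by (simp add: sgn_div_norm divide_inverse)
  ultimately show ?thesis using False by (simp add: field_simps)
qed simp

lemma norm_mult_minus_inner_le:
  fixes a b :: "'a::real_inner"
  shows "norm a * norm b - a \<bullet> b \<le> (norm (a - b))\<^sup>2 / 2"
proof -
  have "(norm (a - b))\<^sup>2 = (norm a)\<^sup>2 - 2 * (a \<bullet> b) + (norm b)\<^sup>2"
    by (simp add: power2_norm_eq_inner inner_diff_left inner_diff_right inner_commute)
  moreover have "0 \<le> (norm a - norm b)\<^sup>2" by simp
  ultimately show ?thesis by (simp add: power2_eq_square algebra_simps)
qed

lemma powr_minus_diff_le:
  fixes x y c q :: real
  assumes "0 < c" "c \<le> x" "c \<le> y" "0 \<le> q"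
  shows "\<bar>x powr (-q) - y powr (-q)\<bar> \<le> q * c powr (-q - 1) * \<bar>x - y\<bar>"
proof -
  have "norm (x powr (-q) - y powr (-q)) \<le> (q * c powr (-q - 1)) * norm (x - y)"
  proof (rule field_differentiable_bound[of "{c..}" "\<lambda>x. x powr (-q)" "\<lambda>x. (-q) * x powr (-q - 1)"])
    show "((\<lambda>x. x powr - q) has_field_derivative - q * z powr (- q - 1)) (at z within {c..})"
      if "z \<in> {c..}" for z
      using that assms by (intro has_field_derivative_at_within[OF has_real_derivative_powr]) auto
    show "norm (- q * z powr (- q - 1)) \<le> q * c powr (- q - 1)" if "z \<in> {c..}" for z
      using that assms by (auto simp: abs_mult intro!: mult_left_mono powr_mono2')
  qed (use assms in auto)
  then show ?thesis by simp
qed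

text \<open>The left end may be 0, where only continuity of the power is at hand; the mean value
  theorem asks for differentiability in the open interval alone.\<close>

lemma powr_mean_value:
  fixes x y p :: real
  assumes "0 \<le> x" "x < y" "1 \<le> p"
  obtains z where "x < z" "z < y" "y powr p - x powr p = (y - x) * (p * z powr (p - 1))"
proof -
  have "\<exists>l z. x < z \<and> z < y \<and> ((\<lambda>z. z powr p) has_real_derivative l) (at z) \<and>
      y powr p - x powr p = (y - x) * l"
  proof (rule MVT[OF assms(2)])
    show "continuous_on {x..y} (\<lambda>z. z powr p)"
      using assms by (intro continuous_on_powr' continuous_intros) auto
    show "(\<lambda>z. z powr p) differentiable at z" if "x < z" "z < y" for z
      using that assms(1) has_real_derivative_powr[of z p] by (auto simp: real_differentiable_def)
  qed
  then obtain l z where z: "x < z" "z < y" "((\<lambda>z. z powr p) has_real_derivative l) (at z)"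
      "y powr p - x powr p = (y - x) * l"
    by auto
  moreover have "((\<lambda>z. z powr p) has_real_derivative p * z powr (p - 1)) (at z)"
    using z assms(1) by (intro has_real_derivative_powr) auto
  ultimately show ?thesis using DERIV_unique that by blast
qed

lemma powr_diff_le:
  fixes a b M p :: real
  assumes "0 \<le> a" "0 \<le> b" "a \<le> M" "b \<le> M" "1 \<le> p"
  shows "\<bar>a powr p - b powr p\<bar> \<le> p * M powr (p - 1) * \<bar>a - b\<bar>"
proof -
  have *: "y powr p - x powr p \<le> p * M powr (p - 1) * (y - x)"
    if xy: "0 \<le> x" "x < y" "y \<le> M" for x y
  proof -
    obtain z where z: "x < z" "z < y" "y powr p - x powr p = (y - x) * (p * z powr (p - 1))"
      using powr_mean_value[OF xy(1,2) assms(5)] by blast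
    have "z powr (p - 1) \<le> M powr (p - 1)" using z xy assms by (intro powr_mono2) auto
    then have "(y - x) * (p * z powr (p - 1)) \<le> (y - x) * (p * M powr (p - 1))"
      using assms xy by (intro mult_left_mono) auto
    then show ?thesis using z by (simp add: mult_ac)
  qed
  have mono: "x powr p \<le> y powr p" if "0 \<le> x" "x \<le> y" for x y
    using that assms by (intro powr_mono2) auto
  show ?thesis
  proof (cases a b rule: linorder_cases)
    case less
    then show ?thesis using *[of a b] mono[of a b] assms by simp
  next
    case greater
    then show ?thesis using *[of b a] mono[of b a] assms by simp
  qed simp
qed

text \<open>Young's inequality with a free weight: the place where \<theta> enters.\<close>

lemma two_mult_le_weighted_squares:
  fixes a b \<theta> :: real
  assumes "0 < \<theta>"
  shows "a * b \<le> (a\<^sup>2 / \<theta> + \<theta> * b\<^sup>2) / 2"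
proof -
  have "0 \<le> (a - \<theta> * b)\<^sup>2 / \<theta>" using assms by simp
  then show ?thesis using assms by (simp add: power2_eq_square field_simps)
qed

lemma continuous_on_sgn_nonzero:
  fixes V :: "'b::topological_space \<Rightarrow> 'a::real_normed_vector"
  assumes "continuous_on S V" "\<And>x. x \<in> S \<Longrightarrow> V x \<noteq> 0"
  shows "continuous_on S (\<lambda>x. sgn (V x))"
  unfolding sgn_div_norm using assms by (intro continuous_intros) auto

lemma integral_bounded_linear_continuous:
  fixes f :: "real \<Rightarrow> 'a::euclidean_space" and h :: "'a \<Rightarrow> 'b::euclidean_space"
  assumes "continuous_on {a..b} f" "bounded_linear h"
  shows "integral {a..b} (\<lambda>t. h (f t)) = h (integral {a..b} f)"
  using integral_linear[OF integrable_continuous_real[OF assms(1)] assms(2)] by (simp add: o_def)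

section \<open>Velocities along one chord\<close>

context
  fixes V :: "real \<Rightarrow> 'a::euclidean_space" and V0 m :: 'a and c l A :: real
  assumes cont: "continuous_on {0..1} V" and c: "0 < c"
    and V_ge: "\<And>t. t \<in> {0..1} \<Longrightarrow> c \<le> norm (V t)" and V0_ge: "c \<le> norm V0"
    and m_ge': "c \<le> norm (integral {0..1} V)"
  defines "m \<equiv> integral {0..1} V" and "l \<equiv> integral {0..1} (\<lambda>t. norm (V t))"
    and "A \<equiv> integral {0..1} (\<lambda>t. (norm (V t - V0))\<^sup>2)"
begin

private lemma m_ge: "c \<le> norm m"
  using m_ge' by (simp add: m_def)

private lemma nz: "t \<in> {0..1} \<Longrightarrow> V t \<noteq> 0"
  using V_ge[of t] c by auto

private lemma cont_sgn: "continuous_on {0..1} (\<lambda>t. sgn (V t))"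
  using cont nz by (intro continuous_on_sgn_nonzero) auto

private lemma ne: "norm (sgn m) = 1"
  using m_ge c by (auto simp: norm_sgn)

private lemma inner_m: "integral {0..1} (\<lambda>t. V t \<bullet> y) = m \<bullet> y"
  unfolding m_def using integral_bounded_linear_continuous[OF cont bounded_linear_inner_left] .

lemma chord_le_arc: "norm m \<le> l"
  unfolding m_def l_def using cont by (intro integral_norm_bound_integral integrable_continuous_real continuous_intros) auto

text \<open>The chord is at least as long as its projection onto the direction of the base velocity
  \<open>V0\<close>. Against that fixed direction the deficit can be taken pointwise, and
  \<open>norm_mult_minus_inner_le\<close> makes it quadratic in \<open>V t - V0\<close>.\<close>

lemma arc_minus_chord_le: "l - norm m \<le> A / (2 * c)"
proof -
  have n0: "norm V0 > 0" using V0_ge c by linarith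
  have "l - norm m \<le> l - m \<bullet> sgn V0"
  proof -
    have "m \<bullet> sgn V0 \<le> norm m * norm (sgn V0)" by (rule norm_cauchy_schwarz)
    also have "\<dots> = norm m" using n0 by (auto simp: norm_sgn)
    finally show ?thesis by simp
  qed
  also have "\<dots> = integral {0..1} (\<lambda>t. norm (V t) - V t \<bullet> sgn V0)"
    unfolding l_def inner_m[symmetric] using cont
    by (subst integral_diff) (auto intro!: integrable_continuous_real continuous_intros)
  also have "\<dots> \<le> integral {0..1} (\<lambda>t. (norm (V t - V0))\<^sup>2 / (2 * c))"
  proof (rule integral_le)
    fix t assume t: "t \<in> {0..1::real}"
    have "norm (V t) - V t \<bullet> sgn V0 = (norm (V t) * norm V0 - V t \<bullet> V0) / norm V0"
      using n0 by (simp add: sgn_div_norm field_simps)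
    also have "\<dots> \<le> ((norm (V t - V0))\<^sup>2 / 2) / norm V0"
      using n0 by (intro divide_right_mono norm_mult_minus_inner_le) auto
    also have "\<dots> \<le> ((norm (V t - V0))\<^sup>2 / 2) / c"
      using V0_ge c n0 by (intro divide_left_mono mult_pos_pos) auto
    also have "\<dots> = (norm (V t - V0))\<^sup>2 / (2 * c)" by simp
    finally show "norm (V t) - V t \<bullet> sgn V0 \<le> (norm (V t - V0))\<^sup>2 / (2 * c)" .
  qed (use cont c in \<open>auto intro!: integrable_continuous_real continuous_intros\<close>)
  also have "\<dots> = A / (2 * c)" unfolding A_def by simp
  finally show ?thesis .
qed

lemma A_nonneg: "0 \<le> A"
  unfolding A_def using cont by (intro integral_nonneg) (auto intro!: integrable_continuous_real continuous_intros)

text \<open>By \<open>norm_minus_inner_unit\<close> with \<open>e = sgn m\<close>, the mean of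
  \<open>norm (V t) - V t \<bullet> e\<close> is both \<open>l - norm m\<close> and at least
  \<open>c / 2\<close> times the left-hand side.\<close>

lemma integral_tangent_deviation_le:
  "integral {0..1} (\<lambda>t. (norm (sgn (V t) - sgn m))\<^sup>2) \<le> A / c\<^sup>2"
proof -
  have "integral {0..1} (\<lambda>t. c / 2 * (norm (sgn (V t) - sgn m))\<^sup>2) \<le>
      integral {0..1} (\<lambda>t. norm (V t) - V t \<bullet> sgn m)"
    using V_ge cont cont_sgn
    by (intro integral_le) (auto intro!: integrable_continuous_real continuous_intros mult_right_mono simp: norm_minus_inner_unit[OF ne])
  also have "\<dots> = l - m \<bullet> sgn m"
    unfolding l_def inner_m[symmetric] using cont
    by (subst integral_diff) (auto intro!: integrable_continuous_real continuous_intros)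
  also have "m \<bullet> sgn m = norm m"
    using m_ge c by (cases "m = 0") (auto simp: sgn_div_norm dot_square_norm power2_eq_square)
  also note arc_minus_chord_le
  finally have "c / 2 * integral {0..1} (\<lambda>t. (norm (sgn (V t) - sgn m))\<^sup>2) \<le> A / (2 * c)"
    by simp
  then show ?thesis using c by (simp add: field_simps power2_eq_square)
qed

text \<open>The mean minimises the mean square deviation: \<open>A\<close> is the variance around
  \<open>m\<close> plus the square of \<open>norm (m - V0)\<close>.\<close>

lemma integral_chord_deviation_le:
  "integral {0..1} (\<lambda>t. (norm (m - V t))\<^sup>2) \<le> A"
proof -
  have "A = integral {0..1} (\<lambda>t. (norm (m - V t))\<^sup>2 + 2 * ((V t - m) \<bullet> (m - V0)) + (norm (m - V0))\<^sup>2)"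
    unfolding A_def
    by (intro integral_cong)
       (simp add: power2_norm_eq_inner inner_diff_left inner_diff_right inner_commute)
  also have "\<dots> = integral {0..1} (\<lambda>t. (norm (m - V t))\<^sup>2) +
      2 * integral {0..1} (\<lambda>t. (V t - m) \<bullet> (m - V0)) + (norm (m - V0))\<^sup>2"
    using cont
    by (subst integral_add integral_mult_right, auto intro!: integrable_continuous_real continuous_intros)+
  also have "integral {0..1} (\<lambda>t. (V t - m) \<bullet> (m - V0)) = 0"
    using cont unfolding inner_diff_left
    by (subst integral_diff) (auto intro!: integrable_continuous_real continuous_intros simp: inner_m)
  finally show ?thesis by simp
qed

text \<open>Pointwise the deviation of the tangent is of first order only. Its linear part is
  proportional to \<open>V t - m\<close>, however, which has mean zero; what remains is a product of
  two first-order deviations and the deficit \<open>a - l\<close>, both of second order. In the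
  constant, \<open>1 / c\<^sup>2\<close> and 1 come from the product and \<open>1 / c\<close> from
  the deficit.\<close>

lemma norm_mean_tangent_deviation_le:
  "norm (integral {0..1} (\<lambda>t. sgn (V t) - sgn m)) \<le> (1 / c\<^sup>2 + 1 + 1 / c) / (2 * c) * A"
proof -
  define e where "e = sgn m"
  define a where "a = norm m"
  have a: "a > 0" "c \<le> a" using m_ge c unfolding a_def by auto
  have me: "m = a *\<^sub>R e" unfolding a_def e_def using a by (simp add: sgn_div_norm a_def)
  have e1: "norm e = 1" using ne by (simp add: e_def)
  define R where "R = integral {0..1} (\<lambda>t. (a - norm (V t)) *\<^sub>R (sgn (V t) - e))"
  have "a *\<^sub>R integral {0..1} (\<lambda>t. sgn (V t) - e) = integral {0..1} (\<lambda>t. a *\<^sub>R (sgn (V t) - e))"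
    by simp
  \<comment> \<open>Three terms: the first integrates to zero, the second is quadratic, the third
    integrates to the difference of chord and arc.\<close>
  also have "\<dots> = integral {0..1} (\<lambda>t. (V t - m) + (a - norm (V t)) *\<^sub>R (sgn (V t) - e)
      + (a - norm (V t)) *\<^sub>R e)"
  proof (rule integral_cong)
    fix t assume "t \<in> {0..1::real}"
    then have "norm (V t) *\<^sub>R sgn (V t) = V t" using nz by (auto simp: sgn_div_norm)
    then show "a *\<^sub>R (sgn (V t) - e) = (V t - m) + (a - norm (V t)) *\<^sub>R (sgn (V t) - e)
      + (a - norm (V t)) *\<^sub>R e" by (simp add: me algebra_simps)
  qed
  also have "\<dots> = integral {0..1} (\<lambda>t. V t - m) + R + integral {0..1} (\<lambda>t. (a - norm (V t)) *\<^sub>R e)"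
    unfolding R_def using cont cont_sgn
    by (subst integral_add, auto intro!: integrable_continuous_real continuous_intros)+
  also have "integral {0..1} (\<lambda>t. V t - m) = 0"
    using cont by (subst integral_diff) (auto intro!: integrable_continuous_real continuous_intros simp: m_def)
  also have "integral {0..1} (\<lambda>t. (a - norm (V t)) *\<^sub>R e) = (a - l) *\<^sub>R e"
  proof -
    have "integral {0..1} (\<lambda>t. (a - norm (V t)) *\<^sub>R e) = integral {0..1} (\<lambda>t. a - norm (V t)) *\<^sub>R e"
      using cont by (intro integral_bounded_linear_continuous bounded_linear_scaleR_left) (auto intro!: continuous_intros)
    also have "integral {0..1} (\<lambda>t. a - norm (V t)) = a - l"
      unfolding l_def using cont by (subst integral_diff) (auto intro!: integrable_continuous_real continuous_intros)
    finally show ?thesis .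
  qed
  finally have eq: "a *\<^sub>R integral {0..1} (\<lambda>t. sgn (V t) - e) = R + (a - l) *\<^sub>R e" by simp
  have "norm R \<le> integral {0..1} (\<lambda>t. ((norm (sgn (V t) - e))\<^sup>2 + (norm (m - V t))\<^sup>2) / 2)"
    unfolding R_def
  proof (rule integral_norm_bound_integral)
    fix t assume "t \<in> {0..1::real}"
    have "\<bar>a - norm (V t)\<bar> \<le> norm (m - V t)" unfolding a_def by (rule norm_triangle_ineq3)
    then have "\<bar>a - norm (V t)\<bar> * norm (sgn (V t) - e) \<le> norm (m - V t) * norm (sgn (V t) - e)"
      by (intro mult_right_mono) auto
    also have "\<dots> \<le> ((norm (sgn (V t) - e))\<^sup>2 + (norm (m - V t))\<^sup>2) / 2"
      using two_mult_le_weighted_squares[of 1 "norm (m - V t)" "norm (sgn (V t) - e)"] by simp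
    finally show "norm ((a - norm (V t)) *\<^sub>R (sgn (V t) - e)) \<le>
      ((norm (sgn (V t) - e))\<^sup>2 + (norm (m - V t))\<^sup>2) / 2" by simp
  qed (use cont cont_sgn in \<open>auto intro!: integrable_continuous_real continuous_intros\<close>)
  also have "\<dots> = (integral {0..1} (\<lambda>t. (norm (sgn (V t) - e))\<^sup>2) + integral {0..1} (\<lambda>t. (norm (m - V t))\<^sup>2)) / 2"
    using cont cont_sgn
    by (subst integral_divide, subst integral_add) (auto intro!: integrable_continuous_real continuous_intros)
  also have "\<dots> \<le> (A / c\<^sup>2 + A) / 2"
    using integral_tangent_deviation_le integral_chord_deviation_le unfolding e_def
    by (intro divide_right_mono add_mono) auto
  finally have R: "norm R \<le> (A / c\<^sup>2 + A) / 2" .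
  have al: "norm ((a - l) *\<^sub>R e) \<le> A / (2 * c)"
    using arc_minus_chord_le chord_le_arc e1 unfolding a_def by simp
  have "a * norm (integral {0..1} (\<lambda>t. sgn (V t) - e)) = norm (R + (a - l) *\<^sub>R e)"
    using a by (simp flip: eq)
  also have "\<dots> \<le> (A / c\<^sup>2 + A) / 2 + A / (2 * c)"
    using R al norm_triangle_ineq[of R "(a - l) *\<^sub>R e"] by linarith
  finally have *: "a * norm (integral {0..1} (\<lambda>t. sgn (V t) - e)) \<le> (A / c\<^sup>2 + A) / 2 + A / (2 * c)" .
  have "c * norm (integral {0..1} (\<lambda>t. sgn (V t) - e)) \<le> a * norm (integral {0..1} (\<lambda>t. sgn (V t) - e))"
    using a by (intro mult_right_mono) auto
  also note *
  finally show ?thesis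
    using c unfolding e_def by (simp add: field_simps power2_eq_square)
qed

text \<open>The integrand of the difference is split at the base point: against the oscillation of \<open>k\<close>
  one first-order factor \<open>sgn (V t) - sgn m\<close> suffices, while the mean of that factor is of
  second order.\<close>

lemma arc_minus_chord_variation_le:
  fixes k :: "real \<Rightarrow> 'a" and k0 :: 'a
  assumes k: "continuous_on {0..1} k" and k0: "norm k0 \<le> K" and th: "0 < \<theta>"
  shows "\<bar>integral {0..1} (\<lambda>t. sgn (V t) \<bullet> k t) - sgn m \<bullet> integral {0..1} k\<bar> \<le>
    (1 / (2 * \<theta> * c\<^sup>2) + K * ((1 / c\<^sup>2 + 1 + 1 / c) / (2 * c))) * A +
    \<theta> / 2 * integral {0..1} (\<lambda>t. (norm (k t - k0))\<^sup>2)"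
proof -
  define e where "e = sgn m"
  have i1: "sgn m \<bullet> integral {0..1} k = integral {0..1} (\<lambda>t. e \<bullet> k t)"
    using integral_bounded_linear_continuous[OF k bounded_linear_inner_right[of e]] by (simp add: e_def)
  have "integral {0..1} (\<lambda>t. sgn (V t) \<bullet> k t) - integral {0..1} (\<lambda>t. e \<bullet> k t)
    = integral {0..1} (\<lambda>t. (sgn (V t) - e) \<bullet> k t)"
    using k cont_sgn unfolding inner_diff_left
    by (subst integral_diff) (auto intro!: integrable_continuous_real continuous_intros)
  also have "\<dots> = integral {0..1} (\<lambda>t. (sgn (V t) - e) \<bullet> (k t - k0) + (sgn (V t) - e) \<bullet> k0)"
    by (intro integral_cong) (simp add: inner_diff_right)
  also have "\<dots> = integral {0..1} (\<lambda>t. (sgn (V t) - e) \<bullet> (k t - k0)) + integral {0..1} (\<lambda>t. (sgn (V t) - e) \<bullet> k0)"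
    using k cont_sgn by (subst integral_add) (auto intro!: integrable_continuous_real continuous_intros)
  also have "integral {0..1} (\<lambda>t. (sgn (V t) - e) \<bullet> k0) = integral {0..1} (\<lambda>t. sgn (V t) - e) \<bullet> k0"
    using cont_sgn by (intro integral_bounded_linear_continuous bounded_linear_inner_left) (auto intro!: continuous_intros)
  finally have eq: "integral {0..1} (\<lambda>t. sgn (V t) \<bullet> k t) - sgn m \<bullet> integral {0..1} k =
     integral {0..1} (\<lambda>t. (sgn (V t) - e) \<bullet> (k t - k0)) + integral {0..1} (\<lambda>t. sgn (V t) - e) \<bullet> k0"
    using i1 by simp
  have "norm (integral {0..1} (\<lambda>t. (sgn (V t) - e) \<bullet> (k t - k0))) \<le>
    integral {0..1} (\<lambda>t. ((norm (sgn (V t) - e))\<^sup>2 / \<theta> + \<theta> * (norm (k t - k0))\<^sup>2) / 2)"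
  proof (rule integral_norm_bound_integral)
    fix t
    have "norm ((sgn (V t) - e) \<bullet> (k t - k0)) \<le> norm (sgn (V t) - e) * norm (k t - k0)"
      using Cauchy_Schwarz_ineq2 by auto
    also have "\<dots> \<le> ((norm (sgn (V t) - e))\<^sup>2 / \<theta> + \<theta> * (norm (k t - k0))\<^sup>2) / 2"
      by (rule two_mult_le_weighted_squares[OF th])
    finally show "norm ((sgn (V t) - e) \<bullet> (k t - k0)) \<le> \<dots>" .
  qed (use k cont_sgn th in \<open>auto intro!: integrable_continuous_real continuous_intros\<close>)
  also have "\<dots> = (integral {0..1} (\<lambda>t. (norm (sgn (V t) - e))\<^sup>2) / \<theta> +
      \<theta> * integral {0..1} (\<lambda>t. (norm (k t - k0))\<^sup>2)) / 2"
    using k cont_sgn th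
    by (subst integral_divide, subst integral_add) (auto intro!: integrable_continuous_real continuous_intros)
  also have "\<dots> \<le> ((A / c\<^sup>2) / \<theta> + \<theta> * integral {0..1} (\<lambda>t. (norm (k t - k0))\<^sup>2)) / 2"
    using integral_tangent_deviation_le th unfolding e_def
    by (intro divide_right_mono add_right_mono) auto
  finally have 1: "\<bar>integral {0..1} (\<lambda>t. (sgn (V t) - e) \<bullet> (k t - k0))\<bar> \<le>
    ((A / c\<^sup>2) / \<theta> + \<theta> * integral {0..1} (\<lambda>t. (norm (k t - k0))\<^sup>2)) / 2" by simp
  have "\<bar>integral {0..1} (\<lambda>t. sgn (V t) - e) \<bullet> k0\<bar> \<le> norm (integral {0..1} (\<lambda>t. sgn (V t) - e)) * norm k0"
    by (rule Cauchy_Schwarz_ineq2)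
  also have "\<dots> \<le> ((1 / c\<^sup>2 + 1 + 1 / c) / (2 * c) * A) * K"
    using norm_mean_tangent_deviation_le k0 A_nonneg c unfolding e_def
    by (intro mult_mono) auto
  finally have 2: "\<bar>integral {0..1} (\<lambda>t. sgn (V t) - e) \<bullet> k0\<bar> \<le> ((1 / c\<^sup>2 + 1 + 1 / c) / (2 * c) * A) * K" .
  show ?thesis unfolding eq
    using 1 2 by (simp add: algebra_simps add_divide_distrib)
qed

end

section \<open>Chords and arcs of a closed curve in terms of its velocity\<close>

lemma continuous_imp_antiderivative:
  fixes f :: "real \<Rightarrow> 'a::euclidean_space"
  assumes "continuous_on UNIV f"
  obtains F where "\<And>x. (F has_vector_derivative f x) (at x)"
proof -
  define F where "F x = (if 0 \<le> x then integral {0..x} f else - integral {x..0} f)" for x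
  have int: "f integrable_on {a..b}" for a b
    using assms by (intro integrable_continuous_real continuous_on_subset[OF assms]) auto
  have "(F has_vector_derivative f x) (at x)" for x
  proof -
    \<comment> \<open>A window around both 0 and \<open>x\<close>: inside it \<open>F\<close> is, up
      to a constant, an integral from one fixed left end, which removes the case distinction on
      signs.\<close>
    define A where "A = -\<bar>x\<bar> - 1"
    define B where "B = \<bar>x\<bar> + 1"
    have F: "F y = integral {A..y} f - integral {A..0} f" if "y \<in> {A..B}" for y
    proof (cases "0 \<le> y")
      case True
      then have "integral {A..0} f + integral {0..y} f = integral {A..y} f"
        by (intro Henstock_Kurzweil_Integration.integral_combine int) (auto simp: A_def)
      then show ?thesis using True by (simp add: F_def algebra_simps)
    next
      case False
      then have "integral {A..y} f + integral {y..0} f = integral {A..0} f"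
        using that by (intro Henstock_Kurzweil_Integration.integral_combine int) (auto simp: A_def)
      then show ?thesis using False by (simp add: F_def algebra_simps)
    qed
    have "((\<lambda>y. integral {A..y} f - integral {A..0} f) has_vector_derivative f x - 0) (at x within {A..B})"
      using assms by (intro has_vector_derivative_diff integral_has_vector_derivative has_vector_derivative_const)
        (auto intro: continuous_on_subset simp: A_def B_def)
    then have "(F has_vector_derivative f x - 0) (at x within {A..B})"
      by (rule has_vector_derivative_transform[rotated 2]) (use F in \<open>auto simp: A_def B_def\<close>)
    moreover have "at x within {A..B} = at x"
      by (rule at_within_Icc_at) (auto simp: A_def B_def)
    ultimately show ?thesis by simp
  qed
  then show ?thesis by (rule that)
qed

text \<open>Averaging over \<open>{0..1}\<close> instead of integrating from \<open>x\<close> to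
  \<open>x + w\<close> treats negative \<open>w\<close> and \<open>w = 0\<close> without oriented
  integrals.\<close>

lemma integral_segment_eq:
  fixes f :: "real \<Rightarrow> 'a::euclidean_space"
  assumes "\<And>x. (F has_vector_derivative f x) (at x)"
  shows "w *\<^sub>R integral {0..1} (\<lambda>t. f (x + t * w)) = F (x + w) - F x"
proof -
  have "((\<lambda>t. w *\<^sub>R f (x + t * w)) has_integral F (x + 1 * w) - F (x + 0 * w)) {0..1}"
  proof (rule fundamental_theorem_of_calculus)
    fix t :: real
    have "((\<lambda>t. x + t * w) has_vector_derivative w) (at t within {0..1})"
      unfolding has_real_derivative_iff_has_vector_derivative[symmetric]
      by (auto intro!: derivative_eq_intros)
    from vector_diff_chain_within[OF this has_vector_derivative_at_within[OF assms]]
    show "((\<lambda>t. F (x + t * w)) has_vector_derivative w *\<^sub>R f (x + t * w)) (at t within {0..1})"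
      by (simp add: o_def)
  qed simp
  from integral_unique[OF this] show ?thesis by simp
qed

lemma antiderivative_period_increment:
  fixes f :: "real \<Rightarrow> 'a::euclidean_space"
  assumes F: "\<And>x. (F has_vector_derivative f x) (at x)" and per: "\<And>x. f (x + 1) = f x"
  shows "F (x + 1) - F x = integral {0..1} f"
proof -
  have "((\<lambda>x. F (x + 1) - F x) has_vector_derivative f (x + 1) - f x) (at x)" for x
  proof (intro has_vector_derivative_diff F)
    have "((\<lambda>x. x + 1) has_vector_derivative 1) (at x)"
      unfolding has_real_derivative_iff_has_vector_derivative[symmetric]
      by (auto intro!: derivative_eq_intros)
    from vector_diff_chain_at[OF this F]
    show "((\<lambda>x. F (x + 1)) has_vector_derivative f (x + 1)) (at x)"
      by (simp add: o_def)
  qed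
  then have "((\<lambda>x. F (x + 1) - F x) has_derivative (\<lambda>h. 0)) (at x within UNIV)" for x
    by (simp add: has_vector_derivative_def per)
  then obtain k where "\<And>x. F (x + 1) - F x = k"
    using has_derivative_zero_constant[of UNIV "\<lambda>x. F (x + 1) - F x"] by auto
  then have "F (x + 1) - F x = F (0 + 1) - F 0" by metis
  also have "\<dots> = 1 *\<^sub>R integral {0..1} (\<lambda>t. f (0 + t * 1))"
    by (rule integral_segment_eq[OF F, symmetric])
  finally show ?thesis by simp
qed

definition chord :: "(real \<Rightarrow> 'a::euclidean_space) \<Rightarrow> real \<Rightarrow> real \<Rightarrow> 'a" where
  "chord v x w = integral {0..1} (\<lambda>t. v (x + t * w))"

definition arc_mean :: "(real \<Rightarrow> 'a::euclidean_space) \<Rightarrow> real \<Rightarrow> real \<Rightarrow> real" where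
  "arc_mean v x w = integral {0..1} (\<lambda>t. norm (v (x + t * w)))"

text \<open>First variation of \<open>arc_mean\<close> in direction \<open>k\<close>: at a nonzero
  vector the derivative of the norm is the inner product with the unit vector.\<close>

definition arc_mean_var ::
    "(real \<Rightarrow> 'a::euclidean_space) \<Rightarrow> (real \<Rightarrow> 'a) \<Rightarrow> real \<Rightarrow> real \<Rightarrow> real" where
  "arc_mean_var v k x w = integral {0..1} (\<lambda>t. sgn (v (x + t * w)) \<bullet> k (x + t * w))"

definition osc :: "(real \<Rightarrow> 'a::euclidean_space) \<Rightarrow> real \<Rightarrow> real \<Rightarrow> real" where
  "osc v x w = integral {0..1} (\<lambda>t. (norm (v (x + t * w) - v x))\<^sup>2)"

text \<open>\<open>\<bar>w\<bar> * arc_mean v x w\<close> and \<open>\<bar>w\<bar> * coarc_mean v x w\<close> are the lengths of the two arcs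
  between the parameters \<open>x\<close> and \<open>x + w\<close>.\<close>

definition coarc_mean :: "(real \<Rightarrow> 'a::euclidean_space) \<Rightarrow> real \<Rightarrow> real \<Rightarrow> real" where
  "coarc_mean v x w = arc_mean v 0 1 / \<bar>w\<bar> - arc_mean v x w"

definition coarc_mean_var ::
    "(real \<Rightarrow> 'a::euclidean_space) \<Rightarrow> (real \<Rightarrow> 'a) \<Rightarrow> real \<Rightarrow> real \<Rightarrow> real" where
  "coarc_mean_var v k x w = arc_mean_var v k 0 1 / \<bar>w\<bar> - arc_mean_var v k x w"

definition velocity :: "(real \<Rightarrow> 'a::euclidean_space) \<Rightarrow> bool" where
  "velocity v \<longleftrightarrow> continuous_on UNIV v \<and> (\<forall>x. v (x + 1) = v x) \<and> integral {0..1} v = 0"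

text \<open>At \<open>w = 0\<close> the chord is \<open>v x\<close> itself, so the one lower bound
  expresses regularity as well as injectivity in a quantitative form that survives small
  perturbations.\<close>

definition nondegenerate :: "real \<Rightarrow> real \<Rightarrow> (real \<Rightarrow> 'a::euclidean_space) \<Rightarrow> bool" where
  "nondegenerate c C v \<longleftrightarrow> velocity v \<and> (\<forall>x. norm (v x) \<le> C) \<and>
     (\<forall>x w. \<bar>w\<bar> \<le> 1/2 \<longrightarrow> c \<le> norm (chord v x w))"

lemma velocityD:
  assumes "velocity v"
  shows "continuous_on S v" "v (x + 1) = v x" "integral {0..1} v = 0"
  using assms continuous_on_subset[of UNIV v S] by (auto simp: velocity_def)

lemma velocity_continuous_segment: "velocity v \<Longrightarrow> continuous_on S (\<lambda>t. v (x + t * w))"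
  by (rule continuous_on_compose2[OF velocityD(1)[of v UNIV]]) (auto intro!: continuous_intros)

lemma velocity_add_scaled:
  assumes "velocity v" "velocity k"
  shows "velocity (\<lambda>x. v x + t *\<^sub>R k x)"
  unfolding velocity_def
proof (intro conjI allI)
  show "integral {0..1} (\<lambda>x. v x + t *\<^sub>R k x) = 0"
    using velocityD[OF assms(1)] velocityD[OF assms(2)]
    by (subst integral_add) (auto intro!: integrable_continuous_real continuous_intros)
qed (use velocityD[OF assms(1)] velocityD[OF assms(2)] in \<open>auto intro!: continuous_intros\<close>)

lemma chord_add_scaled:
  assumes "velocity v" "velocity k"
  shows "chord (\<lambda>x. v x + t *\<^sub>R k x) x w = chord v x w + t *\<^sub>R chord k x w"
  unfolding chord_def using velocity_continuous_segment[OF assms(1)] velocity_continuous_segment[OF assms(2)]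
  by (subst integral_add) (auto intro!: integrable_continuous_real continuous_intros)

lemma norm_chord_le:
  assumes "velocity k" "\<And>x. norm (k x) \<le> K"
  shows "norm (chord k x w) \<le> K"
proof -
  have "norm (chord k x w) \<le> integral {0..1::real} (\<lambda>t. K)"
    unfolding chord_def using assms velocity_continuous_segment[OF assms(1)]
    by (intro integral_norm_bound_integral) (auto intro!: integrable_continuous_real)
  then show ?thesis by simp
qed

lemma osc_nonneg: "velocity v \<Longrightarrow> 0 \<le> osc v x w"
  unfolding osc_def using velocity_continuous_segment[of v "{0..1}" x w]
  by (intro integral_nonneg) (auto intro!: integrable_continuous_real continuous_intros)

lemma osc_add_scaled_le:
  assumes "velocity v" "velocity k"
  shows "osc (\<lambda>x. v x + t *\<^sub>R k x) x w \<le> 2 * osc v x w + 2 * t\<^sup>2 * osc k x w"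
proof -
  have "osc (\<lambda>x. v x + t *\<^sub>R k x) x w \<le> integral {0..1} (\<lambda>s. 2 * (norm (v (x + s * w) - v x))\<^sup>2 +
      2 * t\<^sup>2 * (norm (k (x + s * w) - k x))\<^sup>2)"
    unfolding osc_def
  proof (rule integral_le)
    fix s
    define a where "a = v (x + s * w) - v x"
    define b where "b = t *\<^sub>R (k (x + s * w) - k x)"
    have "(norm (a + b))\<^sup>2 \<le> (norm a + norm b)\<^sup>2" by (intro power_mono norm_triangle_ineq) auto
    also have "\<dots> \<le> 2 * (norm a)\<^sup>2 + 2 * (norm b)\<^sup>2"
      using sum_squares_bound[of "norm a" "norm b"] by (simp add: power2_sum)
    finally show "(norm (v (x + s * w) + t *\<^sub>R k (x + s * w) - (v x + t *\<^sub>R k x)))\<^sup>2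
      \<le> 2 * (norm (v (x + s * w) - v x))\<^sup>2 + 2 * t\<^sup>2 * (norm (k (x + s * w) - k x))\<^sup>2"
      by (simp add: a_def b_def power_mult_distrib) (simp add: algebra_simps)
  qed (use velocity_continuous_segment[OF assms(1)] velocity_continuous_segment[OF assms(2)] in
      \<open>auto intro!: integrable_continuous_real continuous_intros\<close>)
  also have "\<dots> = 2 * osc v x w + 2 * t\<^sup>2 * osc k x w"
    unfolding osc_def using velocity_continuous_segment[OF assms(1)] velocity_continuous_segment[OF assms(2)]
    by (subst integral_add) (auto intro!: integrable_continuous_real continuous_intros)
  finally show ?thesis .
qed

context
  fixes c C :: real and v :: "real \<Rightarrow> 'a::euclidean_space"
  assumes nondeg: "nondegenerate c C v" and c: "0 < c"
begin

lemma nondegenerate_velocity: "velocity v"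
  using nondeg by (simp add: nondegenerate_def)

lemmas cont_segment = velocity_continuous_segment[OF nondegenerate_velocity]

lemma norm_velocity_le: "norm (v x) \<le> C"
  using nondeg by (simp add: nondegenerate_def)

lemma norm_chord_ge: "\<bar>w\<bar> \<le> 1/2 \<Longrightarrow> c \<le> norm (chord v x w)"
  using nondeg by (simp add: nondegenerate_def)

lemma norm_velocity_ge: "c \<le> norm (v x)"
  using norm_chord_ge[of 0 x] by (simp add: chord_def)

lemma velocity_nonzero: "v x \<noteq> 0"
  using norm_velocity_ge[of x] c by auto

lemma cont_sgn_segment: "continuous_on S (\<lambda>t. sgn (v (x + t * w)))"
  by (intro continuous_on_sgn_nonzero cont_segment velocity_nonzero)

lemma C_ge: "c \<le> C"
  using norm_velocity_ge[of 0] norm_velocity_le[of 0] by linarith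

lemma arc_mean_bounds: "c \<le> arc_mean v x w" "arc_mean v x w \<le> C"
proof -
  have "integral {0..1::real} (\<lambda>t. c) \<le> arc_mean v x w" "arc_mean v x w \<le> integral {0..1::real} (\<lambda>t. C)"
    unfolding arc_mean_def using norm_velocity_le norm_velocity_ge cont_segment
    by (intro integral_le; auto intro!: integrable_continuous_real continuous_intros)+
  then show "c \<le> arc_mean v x w" "arc_mean v x w \<le> C" by auto
qed

lemma norm_chord_le_arc_mean: "norm (chord v x w) \<le> arc_mean v x w"
  unfolding chord_def arc_mean_def using cont_segment
  by (intro integral_norm_bound_integral) (auto intro!: integrable_continuous_real continuous_intros)

lemma abs_arc_mean_var_le:
  assumes "velocity k" "\<And>x. norm (k x) \<le> K"
  shows "\<bar>arc_mean_var v k x w\<bar> \<le> K"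
proof -
  have "norm (arc_mean_var v k x w) \<le> integral {0..1::real} (\<lambda>t. K)"
    unfolding arc_mean_var_def
  proof (intro integral_norm_bound_integral)
    fix t
    show "norm (sgn (v (x + t * w)) \<bullet> k (x + t * w)) \<le> K"
      using abs_sgn_inner_le[OF assms(2)] by simp
    show "(\<lambda>t. sgn (v (x + t * w)) \<bullet> k (x + t * w)) integrable_on {0..1}"
      by (intro integrable_continuous_real continuous_on_inner cont_sgn_segment
          velocity_continuous_segment assms)
  qed auto
  then show ?thesis by simp
qed

text \<open>Primitives replace means by increments: \<open>V\<close> is a closed curve with velocity
  \<open>v\<close> and \<open>S\<close> its arc length, strictly increasing because the speed is at
  least \<open>c\<close>.\<close>

lemma arc_length_antiderivatives:
  obtains V S where "\<And>x. (V has_vector_derivative v x) (at x)" "\<And>x w. w *\<^sub>R chord v x w = V (x + w) - V x"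
    "\<And>x w. w * arc_mean v x w = S (x + w) - S x" "\<And>x. V (x + 1) = V x" "\<And>x. S (x + 1) = S x + arc_mean v 0 1"
    "strict_mono S"
proof -
  obtain V where V: "\<And>x. (V has_vector_derivative v x) (at x)"
    using continuous_imp_antiderivative[of v] velocityD[OF nondegenerate_velocity] by blast
  obtain S where S: "\<And>x. (S has_vector_derivative norm (v x)) (at x)"
    using continuous_imp_antiderivative[of "\<lambda>x. norm (v x)"] velocityD(1)[OF nondegenerate_velocity]
    by (metis continuous_on_norm)
  have Sw: "w * arc_mean v x w = S (x + w) - S x" for x w
    unfolding arc_mean_def using integral_segment_eq[OF S, of w x] by simp
  have "strict_mono S"
  proof (rule strict_monoI)
    fix x y :: real assume "x < y"
    then have "0 < (y - x) * arc_mean v x (y - x)"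
      using arc_mean_bounds(1)[of x "y - x"] c by (intro mult_pos_pos) auto
    then show "S x < S y" using Sw[of "y - x" x] by simp
  qed
  moreover have "V (x + 1) = V x" for x
    using antiderivative_period_increment[OF V] velocityD[OF nondegenerate_velocity] by simp
  moreover have "S (x + 1) = S x + arc_mean v 0 1" for x
    using antiderivative_period_increment[OF S, of x] velocityD[OF nondegenerate_velocity]
    by (simp add: arc_mean_def)
  ultimately show ?thesis
    using V Sw integral_segment_eq[OF V] by (intro that[of V S]) (auto simp: chord_def)
qed

text \<open>The complementary arc joins the same two points. It runs from \<open>x + w\<close> to
  \<open>x + 1\<close> for \<open>w \<ge> 0\<close> and from \<open>x\<close> to
  \<open>x + w + 1\<close> for \<open>w < 0\<close>, and no chord is longer than an arc between its
  ends.\<close>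

lemma norm_chord_le_coarc_mean:
  assumes "\<bar>w\<bar> \<le> 1/2" "w \<noteq> 0"
  shows "norm (chord v x w) \<le> coarc_mean v x w"
proof -
  obtain V S where V: "\<And>x w. w *\<^sub>R chord v x w = V (x + w) - V x"
    and S: "\<And>x w. w * arc_mean v x w = S (x + w) - S x" and V1: "\<And>x. V (x + 1) = V x"
    and S1: "\<And>x. S (x + 1) = S x + arc_mean v 0 1"
    by (rule arc_length_antiderivatives) blast
  have le: "norm (V y - V x) \<le> S y - S x" if "x \<le> y" for x y
  proof -
    have "norm (V y - V x) = (y - x) * norm (chord v x (y - x))"
      using V[of "y - x" x] that by (metis abs_of_nonneg add.commute diff_add_cancel diff_ge_0_iff_ge norm_scaleR)
    also have "\<dots> \<le> (y - x) * arc_mean v x (y - x)"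
      using that norm_chord_le_arc_mean by (intro mult_left_mono) auto
    finally show ?thesis using S[of "y - x" x] by simp
  qed
  have "\<bar>w\<bar> * norm (chord v x w) = norm (V (x + w) - V x)"
    by (simp flip: V)
  also have "\<dots> \<le> arc_mean v 0 1 - \<bar>w\<bar> * arc_mean v x w"
  proof (cases "0 \<le> w")
    case True
    have "norm (V (x + w) - V x) = norm (V (x + 1) - V (x + w))" by (simp add: V1 norm_minus_commute)
    also have "\<dots> \<le> S (x + 1) - S (x + w)" using assms by (intro le) auto
    also have "\<dots> = arc_mean v 0 1 - w * arc_mean v x w" by (simp add: S S1)
    finally show ?thesis using True by simp
  next
    case False
    have "norm (V (x + w) - V x) = norm (V (x + w + 1) - V x)" by (simp add: V1)
    also have "\<dots> \<le> S (x + w + 1) - S x" using assms False by (intro le) auto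
    also have "\<dots> = arc_mean v 0 1 - (- w) * arc_mean v x w" using S[of w x] by (simp add: S1)
    finally show ?thesis using False by simp
  qed
  finally have "norm (chord v x w) \<le> (arc_mean v 0 1 - \<bar>w\<bar> * arc_mean v x w) / \<bar>w\<bar>"
    using assms by (simp add: pos_le_divide_eq mult.commute)
  also have "\<dots> = coarc_mean v x w" using assms by (simp add: coarc_mean_def diff_divide_distrib)
  finally show ?thesis .
qed

lemma coarc_mean_ge: "\<bar>w\<bar> \<le> 1/2 \<Longrightarrow> w \<noteq> 0 \<Longrightarrow> c \<le> coarc_mean v x w"
  using norm_chord_le_coarc_mean[of w x] norm_chord_ge[of w x] by linarith

text \<open>The whole curve has length at least \<open>c\<close>, so the complementary mean is at
  least \<open>c / \<bar>w\<bar> - C\<close>, and this exceeds \<open>C\<close> as soon as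
  \<open>c / \<bar>w\<bar> > 2 * C\<close>. Hence the threshold \<open>c / (2 * C)\<close> used from
  here on.\<close>

lemma arc_mean_less_coarc_mean:
  assumes "w \<noteq> 0" "\<bar>w\<bar> < c / (2 * C)"
  shows "arc_mean v x w < coarc_mean v x w"
proof -
  have C: "C > 0" using C_ge c by simp
  have "2 * C < c / \<bar>w\<bar>" using assms c C by (simp add: field_simps)
  also have "\<dots> \<le> arc_mean v 0 1 / \<bar>w\<bar>" using arc_mean_bounds by (intro divide_right_mono) auto
  finally show ?thesis using arc_mean_bounds(2)[of x w] by (simp add: coarc_mean_def)
qed

text \<open>Equal arcs have half the total length, so \<open>S (x + w)\<close> is one of two
  numbers, each taken at most once by a strictly increasing function.\<close>

lemma finite_equal_arcs: "finite {w. w \<noteq> 0 \<and> arc_mean v x w = coarc_mean v x w}"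
proof -
  obtain S where S: "\<And>x w. w * arc_mean v x w = S (x + w) - S x" and inj: "strict_mono S"
    by (rule arc_length_antiderivatives) blast
  define L where "L = arc_mean v 0 1"
  have "(\<lambda>w. S (x + w)) ` {w. w \<noteq> 0 \<and> arc_mean v x w = coarc_mean v x w} \<subseteq> {S x + L / 2, S x - L / 2}"
  proof (rule image_subsetI)
    fix w assume w: "w \<in> {w. w \<noteq> 0 \<and> arc_mean v x w = coarc_mean v x w}"
    then have "\<bar>w\<bar> * arc_mean v x w = L / 2" by (simp add: coarc_mean_def L_def field_simps)
    then show "S (x + w) \<in> {S x + L / 2, S x - L / 2}"
      using w S[of w x] by (cases "0 \<le> w") (auto simp: algebra_simps)
  qed
  then have "finite ((\<lambda>w. S (x + w)) ` {w. w \<noteq> 0 \<and> arc_mean v x w = coarc_mean v x w})"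
    using finite_subset by blast
  then show ?thesis
    by (rule finite_imageD) (use strict_mono_eq[OF inj] in \<open>auto simp: inj_on_def\<close>)
qed

end

text \<open>The base point is a separate argument of \<open>g\<close> because \<open>osc\<close>
  compares the values along the segment with the one at its start.\<close>

lemma continuous_on_segment_integral:
  fixes g :: "real \<Rightarrow> real \<Rightarrow> 'b::euclidean_space"
  assumes "continuous_on UNIV (\<lambda>(x, y). g x y)"
  shows "continuous_on UNIV (\<lambda>z. integral {0..1} (\<lambda>t. g (fst z) (fst z + t * snd z)))"
proof -
  have "continuous_on (UNIV \<times> cbox 0 1) (\<lambda>(z, t). g (fst z) (fst z + t * snd z))"
    unfolding case_prod_beta
    by (rule continuous_on_compose2[OF assms, unfolded case_prod_beta, of _ "\<lambda>y. (fst (fst y), fst (fst y) + snd y * snd (fst y))", simplified])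
       (auto intro!: continuous_intros)
  from integral_continuous_on_param[OF this] show ?thesis by simp
qed

lemma continuous_on_chord: "velocity v \<Longrightarrow> continuous_on UNIV (\<lambda>z. chord v (fst z) (snd z))"
  unfolding chord_def
  by (rule continuous_on_segment_integral[of "\<lambda>x y. v y"])
     (auto intro!: continuous_on_compose2[OF velocityD(1)] continuous_intros simp: case_prod_beta)

lemma continuous_on_arc_mean: "velocity v \<Longrightarrow> continuous_on UNIV (\<lambda>z. arc_mean v (fst z) (snd z))"
  unfolding arc_mean_def
  by (rule continuous_on_segment_integral[of "\<lambda>x y. norm (v y)"])
     (auto intro!: continuous_on_compose2[OF velocityD(1)] continuous_intros simp: case_prod_beta)

lemma continuous_on_osc: "velocity v \<Longrightarrow> continuous_on UNIV (\<lambda>z. osc v (fst z) (snd z))"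
  unfolding osc_def
  by (rule continuous_on_segment_integral[of "\<lambda>x y. (norm (v y - v x))\<^sup>2"])
     (auto intro!: continuous_on_compose2[OF velocityD(1)] continuous_intros simp: case_prod_beta)

lemma continuous_on_arc_mean_var:
  assumes "velocity v" "velocity k" "\<And>x. v x \<noteq> 0"
  shows "continuous_on UNIV (\<lambda>z. arc_mean_var v k (fst z) (snd z))"
proof -
  have "continuous_on UNIV (\<lambda>x. sgn (v x) \<bullet> k x)"
    using assms by (intro continuous_intros continuous_on_sgn_nonzero velocityD) auto
  then have "continuous_on UNIV (\<lambda>(x::real, y). sgn (v y) \<bullet> k y)"
    unfolding case_prod_beta by (rule continuous_on_compose2) (auto intro!: continuous_intros)
  then show ?thesis unfolding arc_mean_var_def
    by (rule continuous_on_segment_integral[of "\<lambda>x y. sgn (v y) \<bullet> k y"])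
qed

section \<open>The energy density and its first variation\<close>

definition near_gap :: "real \<Rightarrow> (real \<Rightarrow> 'a::euclidean_space) \<Rightarrow> real \<Rightarrow> real \<Rightarrow> real" where
  "near_gap \<alpha> v x w = norm (chord v x w) powr (-\<alpha>) - arc_mean v x w powr (-\<alpha>)"

definition far_gap :: "real \<Rightarrow> (real \<Rightarrow> 'a::euclidean_space) \<Rightarrow> real \<Rightarrow> real \<Rightarrow> real" where
  "far_gap \<alpha> v x w = norm (chord v x w) powr (-\<alpha>) - coarc_mean v x w powr (-\<alpha>)"

text \<open>With the factor \<open>\<bar>w\<bar> powr (-\<alpha>)\<close> taken out this is the base
  of the power in the energy. Negative powers decrease, so the shorter arc produces the smaller
  difference and the minimum of the distances becomes a minimum of gaps.\<close>

definition gap :: "real \<Rightarrow> (real \<Rightarrow> 'a::euclidean_space) \<Rightarrow> real \<Rightarrow> real \<Rightarrow> real" where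
  "gap \<alpha> v x w = min (near_gap \<alpha> v x w) (far_gap \<alpha> v x w)"

text \<open>The derivative of \<open>norm (chord v x w) powr (-\<alpha>)\<close> with the sign
  reversed.\<close>

definition chord_powr_var ::
    "real \<Rightarrow> (real \<Rightarrow> 'a::euclidean_space) \<Rightarrow> (real \<Rightarrow> 'a) \<Rightarrow> real \<Rightarrow> real \<Rightarrow> real" where
  "chord_powr_var \<alpha> v k x w =
     \<alpha> * norm (chord v x w) powr (-\<alpha> - 1) * (sgn (chord v x w) \<bullet> chord k x w)"

definition near_gap_var ::
    "real \<Rightarrow> (real \<Rightarrow> 'a::euclidean_space) \<Rightarrow> (real \<Rightarrow> 'a) \<Rightarrow> real \<Rightarrow> real \<Rightarrow> real" where
  "near_gap_var \<alpha> v k x w =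
     \<alpha> * arc_mean v x w powr (-\<alpha> - 1) * arc_mean_var v k x w - chord_powr_var \<alpha> v k x w"

definition far_gap_var ::
    "real \<Rightarrow> (real \<Rightarrow> 'a::euclidean_space) \<Rightarrow> (real \<Rightarrow> 'a) \<Rightarrow> real \<Rightarrow> real \<Rightarrow> real" where
  "far_gap_var \<alpha> v k x w =
     \<alpha> * coarc_mean v x w powr (-\<alpha> - 1) * coarc_mean_var v k x w - chord_powr_var \<alpha> v k x w"

text \<open>When the two arcs tie, the choice of the near branch is arbitrary: for each
  \<open>x\<close> this concerns finitely many offsets.\<close>

definition gap_var ::
    "real \<Rightarrow> (real \<Rightarrow> 'a::euclidean_space) \<Rightarrow> (real \<Rightarrow> 'a) \<Rightarrow> real \<Rightarrow> real \<Rightarrow> real" where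
  "gap_var \<alpha> v k x w =
     (if arc_mean v x w \<le> coarc_mean v x w then near_gap_var \<alpha> v k x w else far_gap_var \<alpha> v k x w)"

definition speeds :: "(real \<Rightarrow> 'a::euclidean_space) \<Rightarrow> real \<Rightarrow> real \<Rightarrow> real" where
  "speeds v x w = norm (v x) * norm (v (x + w))"

definition speeds_var ::
    "(real \<Rightarrow> 'a::euclidean_space) \<Rightarrow> (real \<Rightarrow> 'a) \<Rightarrow> real \<Rightarrow> real \<Rightarrow> real" where
  "speeds_var v k x w = (sgn (v x) \<bullet> k x) * norm (v (x + w)) + norm (v x) * (sgn (v (x + w)) \<bullet> k (x + w))"

text \<open>The derivative of \<open>y powr p\<close> up to the factor \<open>p\<close>; the case distinction is needed since
  \<open>0 powr 0 = 0\<close>.\<close>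

definition dpowr :: "real \<Rightarrow> real \<Rightarrow> real" where
  "dpowr p y = (if p = 1 then 1 else y powr (p - 1))"

definition energy_density :: "real \<Rightarrow> real \<Rightarrow> (real \<Rightarrow> 'a::euclidean_space) \<Rightarrow> real \<Rightarrow> real \<Rightarrow> real" where
  "energy_density \<alpha> p v x w = gap \<alpha> v x w powr p * speeds v x w"

definition energy_density_var ::
    "real \<Rightarrow> real \<Rightarrow> (real \<Rightarrow> 'a::euclidean_space) \<Rightarrow> (real \<Rightarrow> 'a) \<Rightarrow> real \<Rightarrow> real \<Rightarrow> real" where
  "energy_density_var \<alpha> p v k x w =
     p * dpowr p (gap \<alpha> v x w) * gap_var \<alpha> v k x w * speeds v x w +
     gap \<alpha> v x w powr p * speeds_var v k x w"

lemma dpowr_nonneg: "0 \<le> dpowr p y"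
  by (simp add: dpowr_def)

lemma dpowr_mono: "1 \<le> p \<Longrightarrow> 0 \<le> y \<Longrightarrow> y \<le> z \<Longrightarrow> dpowr p y \<le> dpowr p z"
  by (auto simp: dpowr_def intro!: powr_mono2)

lemma dpowr_mult: "0 \<le> y \<Longrightarrow> 0 \<le> z \<Longrightarrow> dpowr p (y * z) = dpowr p y * dpowr p z"
  by (auto simp: dpowr_def powr_mult)

lemma dpowr_mult_self: "0 \<le> y \<Longrightarrow> dpowr p y * y = y powr p"
  by (cases "y = 0") (auto simp: dpowr_def powr_mult_base powr_diff)

text \<open>A form of Young's inequality for the exponents \<open>p\<close> and
  \<open>p / (p - 1)\<close> that stays valid at \<open>p = 1\<close>: replace the smaller of the
  two numbers by the larger one.\<close>

lemma dpowr_mult_le: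
  assumes "1 \<le> p" "0 \<le> y" "0 \<le> z"
  shows "dpowr p y * z \<le> y powr p + z powr p"
proof (cases "y \<le> z")
  case True
  then have "dpowr p y * z \<le> dpowr p z * z" using assms by (intro mult_right_mono dpowr_mono) auto
  also have "dpowr p z * z \<le> y powr p + z powr p" using assms by (simp add: dpowr_mult_self)
  finally show ?thesis .
next
  case False
  then have "dpowr p y * z \<le> dpowr p y * y" using assms dpowr_nonneg by (intro mult_left_mono) auto
  also have "dpowr p y * y \<le> y powr p + z powr p" using assms by (simp add: dpowr_mult_self)
  finally show ?thesis .
qed

lemma has_real_derivative_from_quadratic_bound:
  fixes f :: "real \<Rightarrow> real"
  assumes "\<And>t. \<bar>f t - f 0 - t * d\<bar> \<le> M * t\<^sup>2"
  shows "(f has_real_derivative d) (at 0)"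
  unfolding DERIV_def
proof (rule Lim_transform2[OF tendsto_const])
  show "((\<lambda>h. d - (f (0 + h) - f 0) / h) \<longlongrightarrow> 0) (at 0)"
  proof (rule Lim_null_comparison)
    show "\<forall>\<^sub>F h in at 0. norm (d - (f (0 + h) - f 0) / h) \<le> M * \<bar>h\<bar>"
    proof -
      have "\<forall>\<^sub>F h in at (0::real). h \<noteq> 0" by (simp add: eventually_at_filter)
      then show ?thesis
    proof eventually_elim
      case h: (elim h)
      have "d - (f (0 + h) - f 0) / h = - ((f h - f 0 - h * d) / h)"
        using h by (simp add: field_simps)
      then have "norm (d - (f (0 + h) - f 0) / h) = \<bar>f h - f 0 - h * d\<bar> / \<bar>h\<bar>"
        by (simp add: abs_divide)
      also have "\<dots> \<le> M * h\<^sup>2 / \<bar>h\<bar>" using assms[of h] by (intro divide_right_mono) auto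
      also have "\<dots> = M * \<bar>h\<bar>" using h by (simp add: power2_eq_square field_simps)
      finally show "norm (d - (f (0 + h) - f 0) / h) \<le> M * \<bar>h\<bar>" .
    qed
    qed
    show "((\<lambda>h. M * \<bar>h\<bar>) \<longlongrightarrow> 0) (at 0)" by (auto intro!: tendsto_eq_intros)
  qed
qed

text \<open>The delicate case is \<open>f a = 0\<close> with \<open>p > 1\<close>; it occurs, for
  instance, on straight pieces of the curve. Nonnegativity near \<open>a\<close> lets the difference
  quotient factor into \<open>f y powr (p - 1)\<close>, which tends to 0, and the difference
  quotient of \<open>f\<close>. For \<open>p = 1\<close> nonnegativity identifies the power with
  \<open>f\<close> itself.\<close>

lemma has_real_derivative_powr_nonneg:
  fixes f :: "real \<Rightarrow> real"
  assumes f: "(f has_real_derivative d) (at a)" and nn: "\<forall>\<^sub>F t in nhds a. 0 \<le> f t" and p: "1 \<le> p"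
  shows "((\<lambda>t. f t powr p) has_real_derivative p * dpowr p (f a) * d) (at a)"
proof -
  have fa: "0 \<le> f a" using eventually_nhds_x_imp_x[OF nn] .
  consider "p = 1" | "1 < p" "0 < f a" | "1 < p" "f a = 0" using p fa by linarith
  then show ?thesis
  proof cases
    case 1
    have "(f has_real_derivative d) (at a) \<longleftrightarrow> ((\<lambda>t. f t powr p) has_real_derivative d) (at a)"
      by (rule DERIV_cong_ev) (use nn 1 in \<open>auto elim: eventually_mono\<close>)
    then show ?thesis using f 1 by (simp add: dpowr_def)
  next
    case 2
    have "((\<lambda>t. f t powr p) has_real_derivative p * f a powr (p - 1) * d) (at a)"
      using DERIV_chain2[OF has_real_derivative_powr[OF 2(2), of p] f] .
    then show ?thesis using 2 by (simp add: dpowr_def)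
  next
    case 3
    have nn': "\<forall>\<^sub>F t in at a. 0 \<le> f t" using nn by (simp add: eventually_nhds_conv_at)
    have 1: "((\<lambda>y. (f y - f a) / (y - a)) \<longlongrightarrow> d) (at a)"
      using f by (simp add: has_field_derivative_iff)
    have "(f \<longlongrightarrow> f a) (at a)" using DERIV_isCont[OF f] by (simp add: isCont_def)
    then have "((\<lambda>y. f y powr (p - 1)) \<longlongrightarrow> f a powr (p - 1)) (at a)"
      using 3 nn' by (intro tendsto_powr' tendsto_const) auto
    from tendsto_mult[OF this 1]
    have "((\<lambda>y. f y powr (p - 1) * ((f y - f a) / (y - a))) \<longlongrightarrow> 0) (at a)" using 3 by simp
    then have "((\<lambda>y. (f y powr p - f a powr p) / (y - a)) \<longlongrightarrow> 0) (at a)"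
    proof (rule Lim_transform_eventually)
      show "\<forall>\<^sub>F y in at a. f y powr (p - 1) * ((f y - f a) / (y - a)) = (f y powr p - f a powr p) / (y - a)"
        using nn'
      proof eventually_elim
        case (elim y)
        then show ?case using 3 dpowr_mult_self[of "f y" p] by (simp add: dpowr_def)
      qed
    qed
    then have "((\<lambda>t. f t powr p) has_real_derivative 0) (at a)" by (simp add: has_field_derivative_iff)
    then show ?thesis using 3 by (simp add: dpowr_def)
  qed
qed

lemma has_real_derivative_norm_powr_line:
  fixes a b :: "'a::real_inner"
  assumes "a \<noteq> 0"
  shows "((\<lambda>t. norm (a + t *\<^sub>R b)) has_real_derivative sgn a \<bullet> b) (at 0)"
proof (rule has_real_derivative_from_quadratic_bound)
  fix t
  have "\<bar>norm (a + t *\<^sub>R b) - norm a - sgn a \<bullet> (t *\<^sub>R b)\<bar> \<le> (norm (t *\<^sub>R b))\<^sup>2 / (2 * norm a)"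
    using norm_add_first_order[OF assms, of "t *\<^sub>R b"] by simp
  then show "\<bar>norm (a + t *\<^sub>R b) - norm (a + 0 *\<^sub>R b) - t * (sgn a \<bullet> b)\<bar> \<le> (norm b)\<^sup>2 / (2 * norm a) * t\<^sup>2"
    by (simp add: power_mult_distrib mult_ac)
qed

text \<open>Indicator of the offsets at which the complementary arc may be the shorter one for a
  curve with bounds \<open>c\<close> and \<open>C\<close>.\<close>

definition far_part :: "real \<Rightarrow> real \<Rightarrow> real \<Rightarrow> real" where
  "far_part c C w = (if \<bar>w\<bar> < c / (2 * C) then 0 else 1)"

lemma far_part_nonneg: "0 \<le> far_part c C w"
  by (simp add: far_part_def)

section \<open>Pointwise bounds for the gap, the energy density and their variations\<close>

context
  fixes c C \<alpha> :: real
  assumes c: "0 < c" and \<alpha>: "0 < \<alpha>"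
begin

context
  fixes v :: "real \<Rightarrow> 'a::euclidean_space"
  assumes nondeg: "nondegenerate c C v"
begin

private lemmas vel = nondegenerate_velocity[OF nondeg c]
private lemmas seg = velocity_continuous_segment[OF vel]

lemma powr_minus_le: "c \<le> y \<Longrightarrow> y powr (-\<alpha> - 1) \<le> c powr (-\<alpha> - 1)"
  using c \<alpha> by (intro powr_mono2') auto

lemma arc_mean_minus_chord_le: "\<bar>w\<bar> \<le> 1/2 \<Longrightarrow> arc_mean v x w - norm (chord v x w) \<le> osc v x w / (2 * c)"
  unfolding arc_mean_def chord_def osc_def
  by (rule arc_minus_chord_le[OF seg c norm_velocity_ge[OF nondeg c] norm_velocity_ge[OF nondeg c]])
     (use norm_chord_ge[OF nondeg c] in \<open>simp add: chord_def\<close>)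

lemma near_gap_le:
  assumes w: "\<bar>w\<bar> \<le> 1/2"
  shows "near_gap \<alpha> v x w \<le> \<alpha> * c powr (-\<alpha> - 1) / (2 * c) * osc v x w"
proof -
  have "near_gap \<alpha> v x w \<le> \<alpha> * c powr (-\<alpha> - 1) * \<bar>norm (chord v x w) - arc_mean v x w\<bar>"
    using powr_minus_diff_le[of c "norm (chord v x w)" "arc_mean v x w" \<alpha>] c \<alpha>
      norm_chord_ge[OF nondeg c w, of x] arc_mean_bounds(1)[OF nondeg c, of x w]
    unfolding near_gap_def by linarith
  also have "\<dots> \<le> \<alpha> * c powr (-\<alpha> - 1) * (osc v x w / (2 * c))"
    using arc_mean_minus_chord_le[OF w] norm_chord_le_arc_mean[OF nondeg c, of x w] \<alpha>
    by (intro mult_left_mono) auto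
  finally show ?thesis by simp
qed

text \<open>For the upper bound the near branch suffices, since the minimum never exceeds it; only
  nonnegativity has to look at both arcs.\<close>

lemma gap_bounds:
  assumes w: "\<bar>w\<bar> \<le> 1/2" "w \<noteq> 0"
  shows "0 \<le> gap \<alpha> v x w" "gap \<alpha> v x w \<le> \<alpha> * c powr (-\<alpha> - 1) / (2 * c) * osc v x w"
proof -
  have "0 < norm (chord v x w)" using norm_chord_ge[OF nondeg c w(1), of x] c by linarith
  then show "0 \<le> gap \<alpha> v x w"
    using norm_chord_le_arc_mean[OF nondeg c] norm_chord_le_coarc_mean[OF nondeg c w] \<alpha>
    by (auto simp: gap_def near_gap_def far_gap_def intro!: powr_mono2')
  show "gap \<alpha> v x w \<le> \<alpha> * c powr (-\<alpha> - 1) / (2 * c) * osc v x w"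
    using near_gap_le[OF w(1), of x] by (simp add: gap_def)
qed

lemma near_le_far_iff:
  assumes w: "\<bar>w\<bar> \<le> 1/2" "w \<noteq> 0"
  shows "near_gap \<alpha> v x w \<le> far_gap \<alpha> v x w \<longleftrightarrow> arc_mean v x w \<le> coarc_mean v x w"
proof -
  have "coarc_mean v x w powr (-\<alpha>) \<le> arc_mean v x w powr (-\<alpha>) \<longleftrightarrow> arc_mean v x w \<le> coarc_mean v x w"
  proof
    show "coarc_mean v x w powr (-\<alpha>) \<le> arc_mean v x w powr (-\<alpha>)" if "arc_mean v x w \<le> coarc_mean v x w"
      using that \<alpha> c arc_mean_bounds(1)[OF nondeg c, of x w] by (intro powr_mono2') auto
    show "arc_mean v x w \<le> coarc_mean v x w" if "coarc_mean v x w powr (-\<alpha>) \<le> arc_mean v x w powr (-\<alpha>)"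
    proof (rule ccontr)
      assume "\<not> arc_mean v x w \<le> coarc_mean v x w"
      then have "arc_mean v x w powr (-\<alpha>) < coarc_mean v x w powr (-\<alpha>)"
        using \<alpha> c coarc_mean_ge[OF nondeg c w, of x] by (intro powr_less_mono2_neg) auto
      then show False using that by simp
    qed
  qed
  then show ?thesis by (simp add: near_gap_def far_gap_def)
qed

context
  fixes k :: "real \<Rightarrow> 'a" and K :: real
  assumes k: "velocity k" and K: "\<And>x. norm (k x) \<le> K"
begin

private lemma K0: "0 \<le> K"
  using K[of 0] norm_ge_zero order.trans by blast

text \<open>The two terms of the variation nearly cancel. Adding and subtracting
  \<open>sgn m \<bullet> chord k x w\<close> with the power of the arc leaves the difference of the
  length variations, estimated by \<open>arc_minus_chord_variation_le\<close>, and the difference of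
  two negative powers, which is of the order of arc minus chord. Each is of second order.\<close>

lemma near_gap_var_le:
  assumes w: "\<bar>w\<bar> \<le> 1/2" and th: "0 < \<theta>"
  shows "\<bar>near_gap_var \<alpha> v k x w\<bar> \<le>
    (\<alpha> * c powr (-\<alpha> - 1) * (1 / (2 * c\<^sup>2) + (1 / c\<^sup>2 + 1 + 1 / c) / (2 * c) + 1 / 2) +
      \<alpha> * ((\<alpha> + 1) * c powr (-\<alpha> - 2) / (2 * c))) *
    ((1 / \<theta> + K) * osc v x w + \<theta> * osc k x w)"
proof -
  define A where "A = osc v x w"
  define B where "B = osc k x w"
  define l where "l = arc_mean v x w"
  define m where "m = chord v x w"
  define N where "N = (1 / c\<^sup>2 + 1 + 1 / c) / (2 * c)"
  define q where "q = \<alpha> * c powr (-\<alpha> - 1)"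
  define r where "r = \<alpha> * ((\<alpha> + 1) * c powr (-\<alpha> - 2) / (2 * c))"
  have A: "0 \<le> A" and B: "0 \<le> B" unfolding A_def B_def using osc_nonneg vel k by auto
  have pos: "0 \<le> N" "0 \<le> q" "0 \<le> r" using c \<alpha> by (auto simp: N_def q_def r_def)
  have ck: "\<bar>sgn m \<bullet> chord k x w\<bar> \<le> K" by (rule abs_sgn_inner_le[OF norm_chord_le[OF k K]])
  have "\<bar>arc_mean_var v k x w - sgn m \<bullet> chord k x w\<bar> \<le> (1 / (2 * \<theta> * c\<^sup>2) + K * N) * A + \<theta> / 2 * B"
    unfolding arc_mean_var_def m_def chord_def A_def B_def N_def osc_def
    by (rule arc_minus_chord_variation_le[OF seg c norm_velocity_ge[OF nondeg c] norm_velocity_ge[OF nondeg c]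
          _ velocity_continuous_segment[OF k] K th])
       (use norm_chord_ge[OF nondeg c w] in \<open>simp add: chord_def\<close>)
  then have "\<alpha> * l powr (-\<alpha> - 1) * \<bar>arc_mean_var v k x w - sgn m \<bullet> chord k x w\<bar> \<le>
      q * ((1 / (2 * \<theta> * c\<^sup>2) + K * N) * A + \<theta> / 2 * B)"
    unfolding q_def l_def using \<alpha> powr_minus_le arc_mean_bounds(1)[OF nondeg c]
    by (intro mult_mono) auto
  moreover have "\<bar>\<alpha> * (l powr (-\<alpha> - 1) - norm m powr (-\<alpha> - 1)) * (sgn m \<bullet> chord k x w)\<bar> \<le> r * A * K"
  proof -
    have minus_2: "- 2 - \<alpha> = - \<alpha> - 2" by simp
    have "\<bar>l powr (-\<alpha> - 1) - norm m powr (-\<alpha> - 1)\<bar> \<le> (\<alpha> + 1) * c powr (-\<alpha> - 2) * \<bar>l - norm m\<bar>"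
      using powr_minus_diff_le[of c l "norm m" "\<alpha> + 1"] c \<alpha> arc_mean_bounds(1)[OF nondeg c]
        norm_chord_ge[OF nondeg c w] minus_2 by (simp add: l_def m_def)
    also have "\<dots> \<le> (\<alpha> + 1) * c powr (-\<alpha> - 2) * (A / (2 * c))"
      using arc_mean_minus_chord_le[OF w] norm_chord_le_arc_mean[OF nondeg c, of x w] \<alpha>
      unfolding l_def m_def A_def by (intro mult_left_mono) auto
    finally have "\<alpha> * \<bar>l powr (-\<alpha> - 1) - norm m powr (-\<alpha> - 1)\<bar> \<le>
        \<alpha> * ((\<alpha> + 1) * c powr (-\<alpha> - 2) * (A / (2 * c)))"
      using \<alpha> by (intro mult_left_mono) auto
    then have "\<alpha> * \<bar>l powr (-\<alpha> - 1) - norm m powr (-\<alpha> - 1)\<bar> \<le> r * A"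
      by (simp add: r_def mult_ac)
    from mult_mono[OF this ck] show ?thesis using \<alpha> pos A by (simp add: abs_mult)
  qed
  moreover have "near_gap_var \<alpha> v k x w = \<alpha> * l powr (-\<alpha> - 1) * (arc_mean_var v k x w - sgn m \<bullet> chord k x w)
      + \<alpha> * (l powr (-\<alpha> - 1) - norm m powr (-\<alpha> - 1)) * (sgn m \<bullet> chord k x w)"
    by (simp add: near_gap_var_def chord_powr_var_def l_def m_def algebra_simps)
  moreover have "\<bar>\<alpha> * l powr (-\<alpha> - 1) * (arc_mean_var v k x w - sgn m \<bullet> chord k x w)\<bar> =
      \<alpha> * l powr (-\<alpha> - 1) * \<bar>arc_mean_var v k x w - sgn m \<bullet> chord k x w\<bar>"
    using \<alpha> by (simp add: abs_mult)
  ultimately have "\<bar>near_gap_var \<alpha> v k x w\<bar> \<le> q * ((1 / (2 * \<theta> * c\<^sup>2) + K * N) * A + \<theta> / 2 * B) + r * A * K"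
    using abs_triangle_ineq[of "\<alpha> * l powr (-\<alpha> - 1) * (arc_mean_var v k x w - sgn m \<bullet> chord k x w)"
      "\<alpha> * (l powr (-\<alpha> - 1) - norm m powr (-\<alpha> - 1)) * (sgn m \<bullet> chord k x w)"] by linarith
  also have "\<dots> = q * (1 / (2 * c\<^sup>2)) * (1 / \<theta> * A) + (q * N + r) * (K * A) + q * (1 / 2) * (\<theta> * B)"
    by (simp add: algebra_simps)
  \<comment> \<open>The three coefficients are raised to one common value, so that a single constant
    stands in front of the whole bound.\<close>
  also have "\<dots> \<le> (q * (1 / (2 * c\<^sup>2) + N + 1 / 2) + r) * (1 / \<theta> * A) + (q * (1 / (2 * c\<^sup>2) + N + 1 / 2) + r) * (K * A)
       + (q * (1 / (2 * c\<^sup>2) + N + 1 / 2) + r) * (\<theta> * B)"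
  proof -
    have "0 \<le> q * (1 / (2 * c\<^sup>2))" "0 \<le> q * N" "0 \<le> q * (1 / 2)" using pos c by auto
    then have *: "q * (1 / (2 * c\<^sup>2)) \<le> q * (1 / (2 * c\<^sup>2) + N + 1 / 2) + r"
      "q * N + r \<le> q * (1 / (2 * c\<^sup>2) + N + 1 / 2) + r" "q * (1 / 2) \<le> q * (1 / (2 * c\<^sup>2) + N + 1 / 2) + r"
      using pos by (simp_all add: distrib_left)
    show ?thesis
      using A B K0 th
      by (intro add_mono[OF add_mono[OF mult_right_mono[OF *(1)] mult_right_mono[OF *(2)]] mult_right_mono[OF *(3)]]) auto
  qed
  finally show ?thesis unfolding q_def r_def N_def A_def B_def by (simp add: distrib_left distrib_right)
qed

text \<open>Nothing cancels here; away from the diagonal plain boundedness is enough, as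
  \<open>1 / \<bar>w\<bar>\<close> is at most \<open>2 * C / c\<close>.\<close>

lemma far_gap_var_le:
  assumes w: "\<bar>w\<bar> \<le> 1/2" "c / (2 * C) \<le> \<bar>w\<bar>" "w \<noteq> 0"
  shows "\<bar>far_gap_var \<alpha> v k x w\<bar> \<le> \<alpha> * c powr (-\<alpha> - 1) * (2 * C / c + 2) * K"
proof -
  have C: "0 < C" using C_ge[OF nondeg c] c by simp
  define q where "q = \<alpha> * c powr (-\<alpha> - 1)"
  have q: "0 \<le> q" using c \<alpha> by (auto simp: q_def)
  have var: "\<bar>coarc_mean_var v k x w\<bar> \<le> (2 * C / c + 1) * K"
  proof -
    have "1 / \<bar>w\<bar> \<le> 2 * C / c" using w c C by (simp add: field_simps)
    then have "\<bar>arc_mean_var v k 0 1 / \<bar>w\<bar>\<bar> \<le> K * (2 * C / c)"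
      using abs_arc_mean_var_le[OF nondeg c k K, of 0 1] K0 w(3)
        mult_mono[of "\<bar>arc_mean_var v k 0 1\<bar>" K "1 / \<bar>w\<bar>" "2 * C / c"] by (simp add: abs_divide)
    then have "\<bar>coarc_mean_var v k x w\<bar> \<le> K * (2 * C / c) + K"
      using abs_arc_mean_var_le[OF nondeg c k K, of x w]
        abs_triangle_ineq4[of "arc_mean_var v k 0 1 / \<bar>w\<bar>" "arc_mean_var v k x w"]
      unfolding coarc_mean_var_def by linarith
    then show ?thesis by (simp add: algebra_simps)
  qed
  have ck: "\<bar>sgn (chord v x w) \<bullet> chord k x w\<bar> \<le> K" by (rule abs_sgn_inner_le[OF norm_chord_le[OF k K]])
  have "\<bar>\<alpha> * coarc_mean v x w powr (-\<alpha> - 1) * coarc_mean_var v k x w\<bar> \<le> q * ((2 * C / c + 1) * K)"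
    unfolding abs_mult q_def using \<alpha> powr_minus_le coarc_mean_ge[OF nondeg c w(1,3)] var
    by (intro mult_mono) auto
  moreover have "\<bar>chord_powr_var \<alpha> v k x w\<bar> \<le> q * K"
    unfolding chord_powr_var_def abs_mult q_def using \<alpha> powr_minus_le norm_chord_ge[OF nondeg c w(1)] ck
    by (intro mult_mono) auto
  ultimately have "\<bar>far_gap_var \<alpha> v k x w\<bar> \<le> q * ((2 * C / c + 1) * K) + q * K"
    unfolding far_gap_var_def by linarith
  then show ?thesis by (simp add: q_def algebra_simps)
qed

end
end

text \<open>The constant is chosen before the curve, the direction and \<theta>, which makes it
  usable along sequences of curves. If the complementary arc is the shorter one, then
  \<open>far_part\<close> equals 1 and the summand with \<open>K\<close> alone dominates the bounded
  far variation.\<close>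

lemma gap_var_le:
  obtains D where "0 \<le> D"
    "\<And>(v :: real \<Rightarrow> 'a::euclidean_space) k K \<theta> x w.
      nondegenerate c C v \<Longrightarrow> velocity k \<Longrightarrow> (\<And>x. norm (k x) \<le> K) \<Longrightarrow>
      \<bar>w\<bar> \<le> 1/2 \<Longrightarrow> w \<noteq> 0 \<Longrightarrow> 0 < \<theta> \<Longrightarrow>
      \<bar>near_gap_var \<alpha> v k x w\<bar> \<le> D * ((1 / \<theta> + K) * (osc v x w + far_part c C w) + \<theta> * osc k x w) \<and>
      (far_part c C w \<noteq> 0 \<longrightarrow>
        \<bar>far_gap_var \<alpha> v k x w\<bar> \<le> D * ((1 / \<theta> + K) * (osc v x w + far_part c C w) + \<theta> * osc k x w)) \<and>
      \<bar>gap_var \<alpha> v k x w\<bar> \<le> D * ((1 / \<theta> + K) * (osc v x w + far_part c C w) + \<theta> * osc k x w)"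
proof -
  define D1 where "D1 = \<alpha> * c powr (-\<alpha> - 1) * (1 / (2 * c\<^sup>2) + (1 / c\<^sup>2 + 1 + 1 / c) / (2 * c) + 1 / 2) +
      \<alpha> * ((\<alpha> + 1) * c powr (-\<alpha> - 2) / (2 * c))"
  \<comment> \<open>The absolute value is taken because \<open>C\<close> is known to be positive
    only once a nondegenerate curve with this bound is given.\<close>
  define D2 where "D2 = \<alpha> * c powr (-\<alpha> - 1) * (2 * \<bar>C\<bar> / c + 2)"
  have D12: "0 \<le> D1" "0 \<le> D2" using c \<alpha> by (auto simp: D1_def D2_def)
  show thesis
  proof (rule that)
    show "0 \<le> D1 + D2" using D12 by simp
    fix v k :: "real \<Rightarrow> 'a" and K \<theta> x w :: real
    assume v: "nondegenerate c C v" and k: "velocity k" and K: "\<And>x. norm (k x) \<le> K"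
      and w: "\<bar>w\<bar> \<le> 1/2" "w \<noteq> 0" and th: "0 < \<theta>"
    have K0: "0 \<le> K" using K[of 0] norm_ge_zero order.trans by blast
    have o: "0 \<le> osc v x w" "0 \<le> osc k x w" "0 \<le> far_part c C w"
      using osc_nonneg nondegenerate_velocity[OF v c] k far_part_nonneg by auto
    define R where "R = (1 / \<theta> + K) * (osc v x w + far_part c C w) + \<theta> * osc k x w"
    have R0: "0 \<le> R" unfolding R_def using o K0 th by simp
    have near: "\<bar>near_gap_var \<alpha> v k x w\<bar> \<le> (D1 + D2) * R"
    proof -
      have "\<bar>near_gap_var \<alpha> v k x w\<bar> \<le> D1 * ((1 / \<theta> + K) * osc v x w + \<theta> * osc k x w)"
        unfolding D1_def by (rule near_gap_var_le[OF v k K w(1) th])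
      also have "\<dots> \<le> D1 * R"
        unfolding R_def using D12 o K0 th by (intro mult_left_mono add_right_mono) auto
      also have "\<dots> \<le> (D1 + D2) * R" using D12 R0 by (intro mult_right_mono) auto
      finally show ?thesis .
    qed
    moreover have far: "\<bar>far_gap_var \<alpha> v k x w\<bar> \<le> (D1 + D2) * R" if "far_part c C w \<noteq> 0"
    proof -
      have f: "c / (2 * C) \<le> \<bar>w\<bar>" "far_part c C w = 1" using that by (auto simp: far_part_def split: if_splits)
      have "\<bar>far_gap_var \<alpha> v k x w\<bar> \<le> D2 * K"
        unfolding D2_def using far_gap_var_le[OF v k K w(1) f(1) w(2)] C_ge[OF v c] c by simp
      also have "\<dots> \<le> D2 * R"
      proof (intro mult_left_mono D12)
        have "K * 1 \<le> (1 / \<theta> + K) * (osc v x w + far_part c C w)" using K0 th o f by (intro mult_mono) auto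
        also have "\<dots> \<le> R" using o th by (simp add: R_def)
        finally show "K \<le> R" by simp
      qed
      also have "\<dots> \<le> (D1 + D2) * R" using D12 R0 by (intro mult_right_mono) auto
      finally show ?thesis .
    qed
    moreover have "\<bar>gap_var \<alpha> v k x w\<bar> \<le> (D1 + D2) * R"
    proof (cases "arc_mean v x w \<le> coarc_mean v x w")
      case True
      then show ?thesis using near by (simp add: gap_var_def)
    next
      case False
      then have "far_part c C w \<noteq> 0"
        using arc_mean_less_coarc_mean[OF v c w(2), of x] by (auto simp: far_part_def)
      then show ?thesis using far False by (simp add: gap_var_def)
    qed
    ultimately show "\<bar>near_gap_var \<alpha> v k x w\<bar> \<le> (D1 + D2) * ((1 / \<theta> + K) * (osc v x w + far_part c C w) + \<theta> * osc k x w) \<and>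
      (far_part c C w \<noteq> 0 \<longrightarrow>
        \<bar>far_gap_var \<alpha> v k x w\<bar> \<le> (D1 + D2) * ((1 / \<theta> + K) * (osc v x w + far_part c C w) + \<theta> * osc k x w)) \<and>
      \<bar>gap_var \<alpha> v k x w\<bar> \<le> (D1 + D2) * ((1 / \<theta> + K) * (osc v x w + far_part c C w) + \<theta> * osc k x w)"
      by (simp add: R_def)
  qed
qed

lemma speeds_bounds:
  assumes v: "nondegenerate c C v"
  shows "0 \<le> speeds v x w" "speeds v x w \<le> C\<^sup>2"
  using norm_velocity_le[OF v c] mult_mono[of "norm (v x)" C "norm (v (x + w))" C] C_ge[OF v c] c
  by (auto simp: speeds_def power2_eq_square)

lemma abs_speeds_var_le:
  assumes v: "nondegenerate c C v" and K: "\<And>x. norm (k x) \<le> K"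
  shows "\<bar>speeds_var v k x w\<bar> \<le> 2 * C * K"
proof -
  have *: "\<bar>sgn (v y) \<bullet> k y\<bar> \<le> K" for y by (rule abs_sgn_inner_le[OF K])
  have K0: "0 \<le> K" using K[of 0] norm_ge_zero order.trans by blast
  have "\<bar>(sgn (v x) \<bullet> k x) * norm (v (x + w))\<bar> \<le> K * C" "\<bar>norm (v x) * (sgn (v (x + w)) \<bullet> k (x + w))\<bar> \<le> C * K"
    unfolding abs_mult using * K0 norm_velocity_le[OF v c] C_ge[OF v c] c by (auto intro!: mult_mono)
  then show ?thesis unfolding speeds_var_def
    using abs_triangle_ineq[of "(sgn (v x) \<bullet> k x) * norm (v (x + w))" "norm (v x) * (sgn (v (x + w)) \<bullet> k (x + w))"]
    by (simp add: mult_ac)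
qed

lemma energy_density_bounds:
  assumes v: "nondegenerate c C v" and w: "\<bar>w\<bar> \<le> 1/2" "w \<noteq> 0" and p: "1 \<le> p"
  shows "0 \<le> energy_density \<alpha> p v x w"
    "energy_density \<alpha> p v x w \<le> (\<alpha> * c powr (-\<alpha> - 1) / (2 * c)) powr p * C\<^sup>2 * osc v x w powr p"
proof -
  show "0 \<le> energy_density \<alpha> p v x w" using speeds_bounds[OF v] by (simp add: energy_density_def)
  have "gap \<alpha> v x w powr p \<le> (\<alpha> * c powr (-\<alpha> - 1) / (2 * c) * osc v x w) powr p"
    using gap_bounds[OF v w] p by (intro powr_mono2) auto
  also have "\<dots> = (\<alpha> * c powr (-\<alpha> - 1) / (2 * c)) powr p * osc v x w powr p"
    by (rule powr_mult)
  finally have "energy_density \<alpha> p v x w \<le> (\<alpha> * c powr (-\<alpha> - 1) / (2 * c)) powr p * osc v x w powr p * C\<^sup>2"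
    unfolding energy_density_def using speeds_bounds[OF v] by (intro mult_mono) auto
  then show "energy_density \<alpha> p v x w \<le> (\<alpha> * c powr (-\<alpha> - 1) / (2 * c)) powr p * C\<^sup>2 * osc v x w powr p"
    by (simp add: mult_ac)
qed

text \<open>The gap is at most a multiple of \<open>Y\<close>, the sum of \<open>osc v\<close> and
  \<open>far_part\<close>. Multiplying \<open>dpowr p Y\<close> with the bound of the gap variation,
  the part in \<open>Y\<close> restores \<open>Y powr p\<close> at the price of
  \<open>1 / \<theta>\<close>, while the part in \<open>osc k\<close> keeps its factor \<theta>
  through \<open>dpowr_mult_le\<close>. The restriction \<open>\<theta> \<le> 1\<close> lets all
  lower-order terms be absorbed in \<open>1 / \<theta>\<close>.\<close>

lemma energy_density_var_le:
  fixes K :: real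
  assumes p: "1 \<le> p" and K0: "0 \<le> K"
  obtains D where "0 \<le> D"
    "\<And>(v :: real \<Rightarrow> 'a::euclidean_space) k \<theta> x w.
      nondegenerate c C v \<Longrightarrow> velocity k \<Longrightarrow> (\<And>x. norm (k x) \<le> K) \<Longrightarrow>
      \<bar>w\<bar> \<le> 1/2 \<Longrightarrow> w \<noteq> 0 \<Longrightarrow> 0 < \<theta> \<Longrightarrow> \<theta> \<le> 1 \<Longrightarrow>
      \<bar>energy_density_var \<alpha> p v k x w\<bar> \<le>
        D * (1 / \<theta> * (osc v x w + far_part c C w) powr p + \<theta> * osc k x w powr p)"
proof -
  obtain D where D: "0 \<le> D"
    "\<And>(v :: real \<Rightarrow> 'a::euclidean_space) k K \<theta> x w.
      nondegenerate c C v \<Longrightarrow> velocity k \<Longrightarrow> (\<And>x. norm (k x) \<le> K) \<Longrightarrow>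
      \<bar>w\<bar> \<le> 1/2 \<Longrightarrow> w \<noteq> 0 \<Longrightarrow> 0 < \<theta> \<Longrightarrow>
      \<bar>gap_var \<alpha> v k x w\<bar> \<le> D * ((1 / \<theta> + K) * (osc v x w + far_part c C w) + \<theta> * osc k x w)"
    by (rule gap_var_le) blast
  define G where "G = \<alpha> * c powr (-\<alpha> - 1) / (2 * c)"
  have G: "0 \<le> G" using c \<alpha> by (simp add: G_def)
  define E where "E = p * dpowr p G * D * (2 + K) * C\<^sup>2"
  define F where "F = G powr p * (2 * \<bar>C\<bar> * K)"
  have EF: "0 \<le> E" "0 \<le> F" using p D K0 dpowr_nonneg by (auto simp: E_def F_def)
  show thesis
  proof (rule that)
    show "0 \<le> E + F" using EF by simp
    fix v k :: "real \<Rightarrow> 'a" and \<theta> x w :: real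
    assume v: "nondegenerate c C v" and k: "velocity k" and K: "\<And>x. norm (k x) \<le> K"
      and w: "\<bar>w\<bar> \<le> 1/2" "w \<noteq> 0" and th: "0 < \<theta>" "\<theta> \<le> 1"
    define Y where "Y = osc v x w + far_part c C w"
    define B where "B = osc k x w"
    have o: "0 \<le> osc v x w" "0 \<le> far_part c C w" "0 \<le> B" "0 \<le> Y"
      using osc_nonneg[OF nondegenerate_velocity[OF v c], of x w] osc_nonneg[OF k, of x w] far_part_nonneg[of c C w]
      by (auto simp: B_def Y_def)
    have gap0: "0 \<le> gap \<alpha> v x w" by (rule gap_bounds(1)[OF v w])
    have "gap \<alpha> v x w \<le> G * osc v x w" unfolding G_def by (rule gap_bounds(2)[OF v w])
    also have "\<dots> \<le> G * Y" using G o by (intro mult_left_mono) (auto simp: Y_def)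
    finally have gapY: "gap \<alpha> v x w \<le> G * Y" .
    have th1: "1 \<le> 1 / \<theta>" using th by simp
    have "dpowr p Y * ((1 / \<theta> + K) * Y + \<theta> * B) = (1 / \<theta> + K) * (dpowr p Y * Y) + \<theta> * (dpowr p Y * B)"
      by (simp add: algebra_simps)
    also have "\<dots> \<le> (1 / \<theta> + K) * Y powr p + \<theta> * (Y powr p + B powr p)"
      using o p K0 th dpowr_mult_le[of p Y B] by (intro add_mono mult_left_mono) (auto simp: dpowr_mult_self)
    also have "\<dots> = (1 / \<theta> + K + \<theta>) * Y powr p + \<theta> * B powr p" by (simp add: algebra_simps)
    also have "\<dots> \<le> ((2 + K) * (1 / \<theta>)) * Y powr p + ((2 + K) * \<theta>) * B powr p"
    proof (intro add_mono mult_right_mono)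
      have "K * 1 \<le> K * (1 / \<theta>)" using K0 th1 by (intro mult_left_mono) auto
      then have "1 / \<theta> + K + \<theta> \<le> 2 * (1 / \<theta>) + K * (1 / \<theta>)" using th th1 by linarith
      then show "1 / \<theta> + K + \<theta> \<le> (2 + K) * (1 / \<theta>)" by (simp only: distrib_right)
      show "\<theta> \<le> (2 + K) * \<theta>" using K0 th mult_right_mono[of 1 "2 + K" \<theta>] by simp
    qed auto
    also have "\<dots> = (2 + K) * (1 / \<theta> * Y powr p + \<theta> * B powr p)"
      by (simp add: algebra_simps add_divide_distrib)
    finally have key: "dpowr p Y * ((1 / \<theta> + K) * Y + \<theta> * B) \<le> (2 + K) * (1 / \<theta> * Y powr p + \<theta> * B powr p)" .
    have "dpowr p (gap \<alpha> v x w) * \<bar>gap_var \<alpha> v k x w\<bar> \<le> (dpowr p G * dpowr p Y) * (D * ((1 / \<theta> + K) * Y + \<theta> * B))"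
    proof (intro mult_mono)
      show "dpowr p (gap \<alpha> v x w) \<le> dpowr p G * dpowr p Y"
        using dpowr_mono[OF p gap0 gapY] G o by (simp add: dpowr_mult)
      show "\<bar>gap_var \<alpha> v k x w\<bar> \<le> D * ((1 / \<theta> + K) * Y + \<theta> * B)"
        unfolding Y_def B_def by (rule D(2)[OF v k K w th(1)])
    qed (auto simp: dpowr_nonneg)
    also have "\<dots> = dpowr p G * D * (dpowr p Y * ((1 / \<theta> + K) * Y + \<theta> * B))" by (simp only: mult_ac)
    also have "\<dots> \<le> dpowr p G * D * ((2 + K) * (1 / \<theta> * Y powr p + \<theta> * B powr p))"
      using key D dpowr_nonneg by (intro mult_left_mono) auto
    finally have "dpowr p (gap \<alpha> v x w) * \<bar>gap_var \<alpha> v k x w\<bar> \<le>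
        dpowr p G * D * ((2 + K) * (1 / \<theta> * Y powr p + \<theta> * B powr p))" (is "?l \<le> ?r") .
    moreover from this have "0 \<le> ?r"
      using dpowr_nonneg[of p "gap \<alpha> v x w"] by (meson abs_ge_zero mult_nonneg_nonneg order.trans)
    ultimately have "p * ?l * speeds v x w \<le> p * ?r * C\<^sup>2"
      using speeds_bounds[OF v, of x w] p by (intro mult_mono[OF mult_left_mono]) auto
    then have 1: "\<bar>p * dpowr p (gap \<alpha> v x w) * gap_var \<alpha> v k x w * speeds v x w\<bar> \<le>
        E * (1 / \<theta> * Y powr p + \<theta> * B powr p)"
      using speeds_bounds(1)[OF v, of x w] p dpowr_nonneg[of p "gap \<alpha> v x w"]
      by (simp add: abs_mult E_def mult_ac)
    have "\<bar>gap \<alpha> v x w powr p * speeds_var v k x w\<bar> \<le> (G * Y) powr p * (2 * C * K)"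
      unfolding abs_mult using abs_speeds_var_le[OF v K] gap0 gapY p by (auto intro!: mult_mono powr_mono2)
    also have "\<dots> = F * Y powr p" using G o C_ge[OF v c] c by (simp add: F_def powr_mult mult_ac)
    also have "\<dots> \<le> F * (1 / \<theta> * Y powr p + \<theta> * B powr p)"
    proof (rule mult_left_mono[OF _ EF(2)])
      have "1 * Y powr p \<le> 1 / \<theta> * Y powr p" using th1 by (intro mult_right_mono) auto
      then show "Y powr p \<le> 1 / \<theta> * Y powr p + \<theta> * B powr p" using th by (simp add: add_increasing2)
    qed
    finally have 2: "\<bar>gap \<alpha> v x w powr p * speeds_var v k x w\<bar> \<le> F * (1 / \<theta> * Y powr p + \<theta> * B powr p)" .
    have "\<bar>energy_density_var \<alpha> p v k x w\<bar> \<le> E * (1 / \<theta> * Y powr p + \<theta> * B powr p) + F * (1 / \<theta> * Y powr p + \<theta> * B powr p)"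
      unfolding energy_density_var_def using 1 2
        abs_triangle_ineq[of "p * dpowr p (gap \<alpha> v x w) * gap_var \<alpha> v k x w * speeds v x w"
          "gap \<alpha> v x w powr p * speeds_var v k x w"] by linarith
    then show "\<bar>energy_density_var \<alpha> p v k x w\<bar> \<le>
        (E + F) * (1 / \<theta> * (osc v x w + far_part c C w) powr p + \<theta> * osc k x w powr p)"
      by (simp add: Y_def B_def distrib_right)
  qed
qed

end

section \<open>Derivatives along lines of velocities\<close>

lemma isCont_tendsto_nhds: "isCont f a \<Longrightarrow> (f \<longlongrightarrow> f a) (nhds a)"
  by (simp only: isCont_def tendsto_at_iff_tendsto_nhds)

text \<open>The first-order expansion of the norm has a pointwise remainder of at most
  \<open>K\<^sup>2 / (2 * c) * t\<^sup>2\<close>; integrating it over the segment avoids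
  differentiation under the integral.\<close>

lemma has_real_derivative_arc_mean:
  fixes v k :: "real \<Rightarrow> 'a::euclidean_space"
  assumes v: "nondegenerate c C v" and c: "0 < c" and k: "velocity k" and K: "\<And>x. norm (k x) \<le> K"
  shows "((\<lambda>t. arc_mean (\<lambda>x. v x + t *\<^sub>R k x) x w) has_real_derivative arc_mean_var v k x w) (at 0)"
proof (rule has_real_derivative_from_quadratic_bound)
  fix t
  note seg = velocity_continuous_segment[OF nondegenerate_velocity[OF v c]] velocity_continuous_segment[OF k]
    cont_sgn_segment[OF v c]
  define R where "R = (\<lambda>s. norm (v (x + s * w) + t *\<^sub>R k (x + s * w)) - norm (v (x + s * w))
      - t * (sgn (v (x + s * w)) \<bullet> k (x + s * w)))"
  have "arc_mean (\<lambda>x. v x + t *\<^sub>R k x) x w - arc_mean v x w - t * arc_mean_var v k x w =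
      integral {0..1} (\<lambda>s. norm (v (x + s * w) + t *\<^sub>R k (x + s * w))) - integral {0..1} (\<lambda>s. norm (v (x + s * w)))
      - integral {0..1} (\<lambda>s. t * (sgn (v (x + s * w)) \<bullet> k (x + s * w)))"
    by (simp add: arc_mean_def arc_mean_var_def)
  also have "\<dots> = integral {0..1} R"
  proof -
    have i: "(\<lambda>s. norm (v (x + s * w) + t *\<^sub>R k (x + s * w))) integrable_on {0..1}"
      "(\<lambda>s. norm (v (x + s * w))) integrable_on {0..1}"
      "(\<lambda>s. t * (sgn (v (x + s * w)) \<bullet> k (x + s * w))) integrable_on {0..1}"
      by (intro integrable_continuous_real continuous_on_norm continuous_on_add continuous_on_scaleR
          continuous_on_const seg continuous_on_mult continuous_on_inner)+
    show ?thesis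
      by (simp only: R_def integral_diff[OF integrable_diff[OF i(1,2)] i(3)] integral_diff[OF i(1,2)])
  qed
  finally have eq: "arc_mean (\<lambda>x. v x + t *\<^sub>R k x) x w - arc_mean v x w - t * arc_mean_var v k x w = integral {0..1} R" .
  have "norm (integral {0..1} R) \<le> integral {0..1::real} (\<lambda>s. K\<^sup>2 / (2 * c) * t\<^sup>2)"
    unfolding R_def
  proof (rule integral_norm_bound_integral)
    show "(\<lambda>s. norm (v (x + s * w) + t *\<^sub>R k (x + s * w)) - norm (v (x + s * w))
      - t * (sgn (v (x + s * w)) \<bullet> k (x + s * w))) integrable_on {0..1}"
      by (intro integrable_continuous_real continuous_on_norm continuous_on_add continuous_on_scaleR continuous_on_diff
          continuous_on_const seg continuous_on_mult continuous_on_inner)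
    fix s
    define y where "y = x + s * w"
    have "norm (norm (v y + t *\<^sub>R k y) - norm (v y) - t * (sgn (v y) \<bullet> k y)) \<le> (norm (t *\<^sub>R k y))\<^sup>2 / (2 * norm (v y))"
      using norm_add_first_order[OF velocity_nonzero[OF v c], of y "t *\<^sub>R k y"] by simp
    also have "\<dots> = (norm (k y))\<^sup>2 * t\<^sup>2 / (2 * norm (v y))" by (simp add: power_mult_distrib mult_ac)
    also have "\<dots> \<le> (K\<^sup>2 * t\<^sup>2) / (2 * c)"
      using K[of y] norm_velocity_ge[OF v c, of y] c
      by (intro frac_le mult_right_mono power_mono) auto
    finally show "norm (norm (v (x + s * w) + t *\<^sub>R k (x + s * w)) - norm (v (x + s * w)) -
             t * (sgn (v (x + s * w)) \<bullet> k (x + s * w))) \<le> K\<^sup>2 / (2 * c) * t\<^sup>2" by (simp add: y_def)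
  qed auto
  then show "\<bar>arc_mean (\<lambda>x. v x + t *\<^sub>R k x) x w - arc_mean (\<lambda>x. v x + 0 *\<^sub>R k x) x w -
          t * arc_mean_var v k x w\<bar> \<le> K\<^sup>2 / (2 * c) * t\<^sup>2"
    using eq by simp
qed

context
  fixes c C \<alpha> K :: real and v k :: "real \<Rightarrow> 'a::euclidean_space"
  assumes v: "nondegenerate c C v" and c: "0 < c" and \<alpha>: "0 < \<alpha>"
    and k: "velocity k" and K: "\<And>x. norm (k x) \<le> K"
begin

lemma has_real_derivative_coarc_mean:
  "((\<lambda>t. coarc_mean (\<lambda>x. v x + t *\<^sub>R k x) x w) has_real_derivative coarc_mean_var v k x w) (at 0)"
  unfolding coarc_mean_def coarc_mean_var_def
  by (intro DERIV_diff DERIV_cdivide has_real_derivative_arc_mean[OF v c k K])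

context
  fixes x w :: real
  assumes w: "\<bar>w\<bar> \<le> 1/2" "w \<noteq> 0"
begin

private lemma powr_minus_deriv:
  assumes "(f has_real_derivative d) (at (0::real))" "c \<le> f 0"
  shows "((\<lambda>t. f t powr (-\<alpha>)) has_real_derivative - (\<alpha> * f 0 powr (-\<alpha> - 1) * d)) (at 0)"
proof -
  have "0 < f 0" using assms c by simp
  from DERIV_chain2[OF has_real_derivative_powr[OF this, of "-\<alpha>"] assms(1)] show ?thesis by (simp add: mult_ac)
qed

private lemma chord_powr_deriv:
  "((\<lambda>t. norm (chord (\<lambda>x. v x + t *\<^sub>R k x) x w) powr (-\<alpha>)) has_real_derivative - chord_powr_var \<alpha> v k x w) (at 0)"
proof -
  have nz: "chord v x w \<noteq> 0" using norm_chord_ge[OF v c w(1), of x] c by auto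
  have "((\<lambda>t. norm (chord v x w + t *\<^sub>R chord k x w)) has_real_derivative sgn (chord v x w) \<bullet> chord k x w) (at 0)"
    by (rule has_real_derivative_norm_powr_line[OF nz])
  from powr_minus_deriv[OF this] norm_chord_ge[OF v c w(1), of x] show ?thesis
    by (simp add: chord_powr_var_def chord_add_scaled[OF nondegenerate_velocity[OF v c] k])
qed

lemma has_real_derivative_near_gap:
  "((\<lambda>t. near_gap \<alpha> (\<lambda>x. v x + t *\<^sub>R k x) x w) has_real_derivative near_gap_var \<alpha> v k x w) (at 0)"
proof -
  have "((\<lambda>t. near_gap \<alpha> (\<lambda>x. v x + t *\<^sub>R k x) x w) has_real_derivative
      - chord_powr_var \<alpha> v k x w - - (\<alpha> * arc_mean v x w powr (-\<alpha> - 1) * arc_mean_var v k x w)) (at 0)"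
    unfolding near_gap_def
    using powr_minus_deriv[OF has_real_derivative_arc_mean[OF v c k K, of x w]] arc_mean_bounds(1)[OF v c]
    by (intro DERIV_diff chord_powr_deriv) simp
  then show ?thesis by (simp add: near_gap_var_def)
qed

lemma has_real_derivative_far_gap:
  "((\<lambda>t. far_gap \<alpha> (\<lambda>x. v x + t *\<^sub>R k x) x w) has_real_derivative far_gap_var \<alpha> v k x w) (at 0)"
proof -
  have "((\<lambda>t. far_gap \<alpha> (\<lambda>x. v x + t *\<^sub>R k x) x w) has_real_derivative
      - chord_powr_var \<alpha> v k x w - - (\<alpha> * coarc_mean v x w powr (-\<alpha> - 1) * coarc_mean_var v k x w)) (at 0)"
    unfolding far_gap_def
    using powr_minus_deriv[OF has_real_derivative_coarc_mean[of x w]] coarc_mean_ge[OF v c w]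
    by (intro DERIV_diff chord_powr_deriv) simp
  then show ?thesis by (simp add: far_gap_var_def)
qed

text \<open>Off a tie the strict inequality between the two gaps persists for small \<open>t\<close>
  by continuity, so the minimum coincides locally with one branch.\<close>

lemma has_real_derivative_gap:
  assumes ne: "arc_mean v x w \<noteq> coarc_mean v x w"
  shows "((\<lambda>t. gap \<alpha> (\<lambda>x. v x + t *\<^sub>R k x) x w) has_real_derivative gap_var \<alpha> v k x w) (at 0)"
proof -
  have lim_near: "((\<lambda>t. near_gap \<alpha> (\<lambda>x. v x + t *\<^sub>R k x) x w) \<longlongrightarrow> near_gap \<alpha> v x w) (nhds 0)"
    using isCont_tendsto_nhds[OF DERIV_isCont[OF has_real_derivative_near_gap]] by simp
  have lim_far: "((\<lambda>t. far_gap \<alpha> (\<lambda>x. v x + t *\<^sub>R k x) x w) \<longlongrightarrow> far_gap \<alpha> v x w) (nhds 0)"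
    using isCont_tendsto_nhds[OF DERIV_isCont[OF has_real_derivative_far_gap]] by simp
  have iff: "near_gap \<alpha> v x w \<le> far_gap \<alpha> v x w \<longleftrightarrow> arc_mean v x w \<le> coarc_mean v x w"
    by (rule near_le_far_iff[OF c \<alpha> v w])
  have ne': "near_gap \<alpha> v x w \<noteq> far_gap \<alpha> v x w"
  proof
    assume eq: "near_gap \<alpha> v x w = far_gap \<alpha> v x w"
    then have "arc_mean v x w powr (-\<alpha>) = coarc_mean v x w powr (-\<alpha>)" by (simp add: near_gap_def far_gap_def)
    moreover have "c \<le> arc_mean v x w" "c \<le> coarc_mean v x w"
      using arc_mean_bounds(1)[OF v c] coarc_mean_ge[OF v c w] by auto
    ultimately show False using ne powr_inj[of _ _ "-\<alpha>"] c \<alpha>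
        powr_less_mono2_neg[of "-\<alpha>" "arc_mean v x w" "coarc_mean v x w"]
        powr_less_mono2_neg[of "-\<alpha>" "coarc_mean v x w" "arc_mean v x w"] by linarith
  qed
  show ?thesis
  proof (cases "near_gap \<alpha> v x w < far_gap \<alpha> v x w")
    case True
    then have ev: "\<forall>\<^sub>F t in nhds 0. gap \<alpha> (\<lambda>x. v x + t *\<^sub>R k x) x w = near_gap \<alpha> (\<lambda>x. v x + t *\<^sub>R k x) x w"
      using order_tendstoD(1)[OF tendsto_diff[OF lim_far lim_near], of 0] by (auto simp: gap_def elim: eventually_mono)
    have "gap_var \<alpha> v k x w = near_gap_var \<alpha> v k x w" using True iff by (simp add: gap_var_def)
    then show ?thesis
      using has_real_derivative_near_gap DERIV_cong_ev[OF refl ev refl] by simp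
  next
    case False
    then have less: "far_gap \<alpha> v x w < near_gap \<alpha> v x w" using ne' by simp
    then have ev: "\<forall>\<^sub>F t in nhds 0. gap \<alpha> (\<lambda>x. v x + t *\<^sub>R k x) x w = far_gap \<alpha> (\<lambda>x. v x + t *\<^sub>R k x) x w"
      using order_tendstoD(1)[OF tendsto_diff[OF lim_near lim_far], of 0] by (auto simp: gap_def elim: eventually_mono)
    have "gap_var \<alpha> v k x w = far_gap_var \<alpha> v k x w" using less iff by (simp add: gap_var_def)
    then show ?thesis
      using has_real_derivative_far_gap DERIV_cong_ev[OF refl ev refl] by simp
  qed
qed

text \<open>Nearby curves are nondegenerate with possibly worse bounds \<open>c'\<close> and
  \<open>C'\<close>. This gives the nonnegativity of the gap on a whole neighbourhood that the power
  rule requires.\<close>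

lemma has_real_derivative_energy_density:
  assumes ne: "arc_mean v x w \<noteq> coarc_mean v x w" and p: "1 \<le> p"
    and near: "\<forall>\<^sub>F t in nhds 0. nondegenerate c' C' (\<lambda>x. v x + t *\<^sub>R k x)" and c': "0 < c'"
  shows "((\<lambda>t. energy_density \<alpha> p (\<lambda>x. v x + t *\<^sub>R k x) x w) has_real_derivative
     energy_density_var \<alpha> p v k x w) (at 0)"
proof -
  have "\<forall>\<^sub>F t in nhds 0. 0 \<le> gap \<alpha> (\<lambda>x. v x + t *\<^sub>R k x) x w"
    using near by eventually_elim (rule gap_bounds(1)[OF c' \<alpha> _ w])
  from has_real_derivative_powr_nonneg[OF has_real_derivative_gap[OF ne] this p]
  have "((\<lambda>t. gap \<alpha> (\<lambda>x. v x + t *\<^sub>R k x) x w powr p) has_real_derivative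
      p * dpowr p (gap \<alpha> v x w) * gap_var \<alpha> v k x w) (at 0)" by simp
  moreover have d: "((\<lambda>t. norm (v y + t *\<^sub>R k y)) has_real_derivative sgn (v y) \<bullet> k y) (at 0)" for y
    by (rule has_real_derivative_norm_powr_line[OF velocity_nonzero[OF v c]])
  then have "((\<lambda>t. speeds (\<lambda>x. v x + t *\<^sub>R k x) x w) has_real_derivative speeds_var v k x w) (at 0)"
    using DERIV_mult[OF d d] by (simp add: speeds_def speeds_var_def mult_ac)
  ultimately show ?thesis
    unfolding energy_density_def energy_density_var_def
    by - (drule (1) DERIV_mult, simp add: mult_ac)
qed

end
end

text \<open>Derivatives are computed at 0 only; any other point of the line is reached by taking the
  curve there as the new base.\<close>

lemma has_real_derivative_shift_line:
  fixes F :: "('b \<Rightarrow> 'a::real_vector) \<Rightarrow> real"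
  assumes "((\<lambda>s. F (\<lambda>x. (v x + t *\<^sub>R k x) + s *\<^sub>R k x)) has_real_derivative d) (at 0)"
  shows "((\<lambda>t. F (\<lambda>x. v x + t *\<^sub>R k x)) has_real_derivative d) (at t)"
proof -
  have "((\<lambda>s. F (\<lambda>x. v x + (s + t) *\<^sub>R k x)) has_real_derivative d) (at 0)"
    using assms by (simp add: algebra_simps)
  then show ?thesis using DERIV_shift[of "\<lambda>t. F (\<lambda>x. v x + t *\<^sub>R k x)" d 0 t] by simp
qed

lemma real_difference_le_by_derivative:
  fixes g :: "real \<Rightarrow> real"
  assumes "\<And>s. \<bar>s\<bar> \<le> \<bar>t\<bar> \<Longrightarrow> (g has_real_derivative g' s) (at s)" "\<And>s. \<bar>s\<bar> \<le> \<bar>t\<bar> \<Longrightarrow> \<bar>g' s\<bar> \<le> B"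
  shows "\<bar>g t - g 0\<bar> \<le> \<bar>t\<bar> * B"
proof -
  have "norm (g t - g 0) \<le> B * norm (t - 0)"
    by (rule field_differentiable_bound[of "{-\<bar>t\<bar>..\<bar>t\<bar>}" g g'])
       (use assms in \<open>auto intro: has_field_derivative_at_within\<close>)
  then show ?thesis by (simp add: mult.commute)
qed

text \<open>This majorises the difference quotients in the later dominated convergence. Since the
  gap may fail to be differentiable at ties, the mean value inequality is applied to the two
  branches separately; their minimum inherits the Lipschitz constant, and where
  \<open>far_part\<close> vanishes the near branch is the only one. Here \<theta> is simply
  1.\<close>

lemma energy_density_lipschitz:
  fixes K :: real
  assumes c: "0 < c" and \<alpha>: "0 < \<alpha>" and p: "1 \<le> p" and K0: "0 \<le> K"
  obtains D where "0 \<le> D"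
    "\<And>(v :: real \<Rightarrow> 'a::euclidean_space) k t x w.
      (\<And>s. \<bar>s\<bar> \<le> \<bar>t\<bar> \<Longrightarrow> nondegenerate c C (\<lambda>x. v x + s *\<^sub>R k x)) \<Longrightarrow> velocity k \<Longrightarrow> (\<And>x. norm (k x) \<le> K) \<Longrightarrow>
      \<bar>t\<bar> \<le> 1 \<Longrightarrow> \<bar>w\<bar> \<le> 1/2 \<Longrightarrow> w \<noteq> 0 \<Longrightarrow>
      \<bar>energy_density \<alpha> p (\<lambda>x. v x + t *\<^sub>R k x) x w - energy_density \<alpha> p v x w\<bar> \<le>
        \<bar>t\<bar> * (D * (osc v x w + osc k x w + far_part c C w) powr p)"
proof -
  obtain D where D: "0 \<le> D"
    "\<And>(v :: real \<Rightarrow> 'a::euclidean_space) k K \<theta> x w.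
      nondegenerate c C v \<Longrightarrow> velocity k \<Longrightarrow> (\<And>x. norm (k x) \<le> K) \<Longrightarrow>
      \<bar>w\<bar> \<le> 1/2 \<Longrightarrow> w \<noteq> 0 \<Longrightarrow> 0 < \<theta> \<Longrightarrow>
      \<bar>near_gap_var \<alpha> v k x w\<bar> \<le> D * ((1 / \<theta> + K) * (osc v x w + far_part c C w) + \<theta> * osc k x w) \<and>
      (far_part c C w \<noteq> 0 \<longrightarrow>
        \<bar>far_gap_var \<alpha> v k x w\<bar> \<le> D * ((1 / \<theta> + K) * (osc v x w + far_part c C w) + \<theta> * osc k x w))"
    by (rule gap_var_le[OF c \<alpha>, where C = C]) blast
  \<comment> \<open>The 2 in \<open>G\<close> and the number \<open>3 + 2 * K\<close> in
    \<open>D'\<close> absorb the doubling of \<open>osc\<close> when a multiple of \<open>k\<close>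
    is added to \<open>v\<close>.\<close>
  define G where "G = 2 * (\<alpha> * c powr (-\<alpha> - 1) / (2 * c))"
  have G: "0 \<le> G" using c \<alpha> by (simp add: G_def)
  define D' where "D' = D * (3 + 2 * K)"
  define E where "E = p * G powr (p - 1) * D' * C\<^sup>2 + G powr p * (2 * \<bar>C\<bar> * K)"
  have D'0: "0 \<le> D'" using D K0 by (simp add: D'_def)
  show thesis
  proof (rule that)
    show "0 \<le> E" using p K0 D'0 by (simp add: E_def)
    fix v k :: "real \<Rightarrow> 'a" and t x w :: real
    assume v: "\<And>s. \<bar>s\<bar> \<le> \<bar>t\<bar> \<Longrightarrow> nondegenerate c C (\<lambda>x. v x + s *\<^sub>R k x)" and k: "velocity k"
      and K: "\<And>x. norm (k x) \<le> K" and t: "\<bar>t\<bar> \<le> 1" and w: "\<bar>w\<bar> \<le> 1/2" "w \<noteq> 0"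
    have v0: "nondegenerate c C v" using v[of 0] by simp
    have vel: "velocity v" by (rule nondegenerate_velocity[OF v0 c])
    define Z where "Z = osc v x w + osc k x w + far_part c C w"
    have o: "0 \<le> osc v x w" "0 \<le> osc k x w" "0 \<le> far_part c C w" "0 \<le> Z"
      using osc_nonneg[OF vel, of x w] osc_nonneg[OF k, of x w] far_part_nonneg by (auto simp: Z_def)
    have osc_t: "osc (\<lambda>x. v x + s *\<^sub>R k x) x w \<le> 2 * osc v x w + 2 * osc k x w" if "\<bar>s\<bar> \<le> \<bar>t\<bar>" for s
    proof -
      have "s\<^sup>2 \<le> 1" using that t by (simp add: abs_square_le_1)
      then have "2 * s\<^sup>2 * osc k x w \<le> 2 * 1 * osc k x w" using o by (intro mult_right_mono) auto
      then show ?thesis using osc_add_scaled_le[OF vel k, of s x w] by simp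
    qed
    have bound: "D * ((1 / 1 + K) * (osc (\<lambda>x. v x + s *\<^sub>R k x) x w + far_part c C w) + 1 * osc k x w) \<le> D' * Z"
      if s: "\<bar>s\<bar> \<le> \<bar>t\<bar>" for s
    proof -
      have "(1 / 1 + K) * (osc (\<lambda>x. v x + s *\<^sub>R k x) x w + far_part c C w) + 1 * osc k x w \<le> (1 + K) * (2 * Z) + Z"
      proof (intro add_mono)
        show "(1 / 1 + K) * (osc (\<lambda>x. v x + s *\<^sub>R k x) x w + far_part c C w) \<le> (1 + K) * (2 * Z)"
          unfolding div_by_1
          using osc_t[OF s] o K0 by (intro mult_left_mono) (auto simp: Z_def)
      qed (use o in \<open>auto simp: Z_def\<close>)
      also have "\<dots> = (3 + 2 * K) * Z" by (simp add: algebra_simps)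
      finally show ?thesis unfolding D'_def mult.assoc using D by (intro mult_left_mono) auto
    qed
    have near: "\<bar>near_gap \<alpha> (\<lambda>x. v x + t *\<^sub>R k x) x w - near_gap \<alpha> (\<lambda>x. v x + 0 *\<^sub>R k x) x w\<bar> \<le> \<bar>t\<bar> * (D' * Z)"
    proof (rule real_difference_le_by_derivative)
      fix s assume s: "\<bar>s\<bar> \<le> \<bar>t\<bar>"
      show "((\<lambda>t. near_gap \<alpha> (\<lambda>x. v x + t *\<^sub>R k x) x w) has_real_derivative
          near_gap_var \<alpha> (\<lambda>x. v x + s *\<^sub>R k x) k x w) (at s)"
        by (rule has_real_derivative_shift_line) (rule has_real_derivative_near_gap[OF v[OF s] c \<alpha> k K w])
      show "\<bar>near_gap_var \<alpha> (\<lambda>x. v x + s *\<^sub>R k x) k x w\<bar> \<le> D' * Z"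
        using D(2)[OF v[OF s] k K w zero_less_one, of x] bound[OF s] by linarith
    qed
    have far: "\<bar>far_gap \<alpha> (\<lambda>x. v x + t *\<^sub>R k x) x w - far_gap \<alpha> (\<lambda>x. v x + 0 *\<^sub>R k x) x w\<bar> \<le> \<bar>t\<bar> * (D' * Z)"
      if "far_part c C w \<noteq> 0"
    proof (rule real_difference_le_by_derivative)
      fix s assume s: "\<bar>s\<bar> \<le> \<bar>t\<bar>"
      show "((\<lambda>t. far_gap \<alpha> (\<lambda>x. v x + t *\<^sub>R k x) x w) has_real_derivative
          far_gap_var \<alpha> (\<lambda>x. v x + s *\<^sub>R k x) k x w) (at s)"
        by (rule has_real_derivative_shift_line) (rule has_real_derivative_far_gap[OF v[OF s] c \<alpha> k K w])
      show "\<bar>far_gap_var \<alpha> (\<lambda>x. v x + s *\<^sub>R k x) k x w\<bar> \<le> D' * Z"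
        using D(2)[OF v[OF s] k K w zero_less_one, of x] bound[OF s] that by linarith
    qed
    have gap_diff: "\<bar>gap \<alpha> (\<lambda>x. v x + t *\<^sub>R k x) x w - gap \<alpha> v x w\<bar> \<le> \<bar>t\<bar> * (D' * Z)"
    proof (cases "far_part c C w = 0")
      case True
      then have w': "\<bar>w\<bar> < c / (2 * C)" by (simp add: far_part_def split: if_splits)
      have "gap \<alpha> u x w = near_gap \<alpha> u x w" if "nondegenerate c C u" for u :: "real \<Rightarrow> 'a"
        using near_le_far_iff[OF c \<alpha> that w, of x] arc_mean_less_coarc_mean[OF that c w(2) w', of x]
        by (simp add: gap_def)
      then show ?thesis using near v[of t] v0 by simp
    next
      case False
      then show ?thesis using near far unfolding gap_def by simp
    qed
    have gap_t: "0 \<le> gap \<alpha> (\<lambda>x. v x + t *\<^sub>R k x) x w" "gap \<alpha> (\<lambda>x. v x + t *\<^sub>R k x) x w \<le> G * Z"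
    proof -
      show "0 \<le> gap \<alpha> (\<lambda>x. v x + t *\<^sub>R k x) x w" using gap_bounds(1)[OF c \<alpha> v[of t] w] by simp
      have "gap \<alpha> (\<lambda>x. v x + t *\<^sub>R k x) x w \<le> G / 2 * osc (\<lambda>x. v x + t *\<^sub>R k x) x w"
        using gap_bounds(2)[OF c \<alpha> v[of t] w, of x] by (simp add: G_def mult_ac)
      also have "\<dots> \<le> G / 2 * (2 * Z)" using osc_t[of t] G o by (intro mult_left_mono) (auto simp: Z_def)
      finally show "gap \<alpha> (\<lambda>x. v x + t *\<^sub>R k x) x w \<le> G * Z" by simp
    qed
    have gap_0: "0 \<le> gap \<alpha> v x w" "gap \<alpha> v x w \<le> G * Z"
    proof -
      show "0 \<le> gap \<alpha> v x w" by (rule gap_bounds(1)[OF c \<alpha> v0 w])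
      have "gap \<alpha> v x w \<le> G / 2 * osc v x w"
        using gap_bounds(2)[OF c \<alpha> v0 w, of x] by (simp add: G_def mult_ac)
      also have "\<dots> \<le> G / 2 * (2 * Z)" using G o by (intro mult_left_mono) (auto simp: Z_def)
      finally show "gap \<alpha> v x w \<le> G * Z" by simp
    qed
    have "\<bar>gap \<alpha> (\<lambda>x. v x + t *\<^sub>R k x) x w powr p - gap \<alpha> v x w powr p\<bar> \<le>
        p * (G * Z) powr (p - 1) * \<bar>gap \<alpha> (\<lambda>x. v x + t *\<^sub>R k x) x w - gap \<alpha> v x w\<bar>"
      using gap_t gap_0 p by (intro powr_diff_le) auto
    also have "\<dots> \<le> p * (G * Z) powr (p - 1) * (\<bar>t\<bar> * (D' * Z))"
      using gap_diff p by (intro mult_left_mono) auto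
    also have "\<dots> = \<bar>t\<bar> * (p * G powr (p - 1) * D' * Z powr p)"
    proof -
      have "Z powr (p - 1) * Z = Z powr p" using o by (cases "Z = 0") (auto simp: powr_diff)
      then show ?thesis by (simp add: powr_mult mult_ac)
    qed
    finally have 1: "\<bar>gap \<alpha> (\<lambda>x. v x + t *\<^sub>R k x) x w powr p - gap \<alpha> v x w powr p\<bar> \<le>
        \<bar>t\<bar> * (p * G powr (p - 1) * D' * Z powr p)" .
    have sp: "\<bar>speeds (\<lambda>x. v x + t *\<^sub>R k x) x w - speeds v x w\<bar> \<le> \<bar>t\<bar> * (2 * C * K)"
    proof -
      have "\<bar>speeds (\<lambda>x. v x + t *\<^sub>R k x) x w - speeds (\<lambda>x. v x + 0 *\<^sub>R k x) x w\<bar> \<le> \<bar>t\<bar> * (2 * C * K)"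
      proof (rule real_difference_le_by_derivative)
        fix s assume s: "\<bar>s\<bar> \<le> \<bar>t\<bar>"
        show "((\<lambda>t. speeds (\<lambda>x. v x + t *\<^sub>R k x) x w) has_real_derivative
            speeds_var (\<lambda>x. v x + s *\<^sub>R k x) k x w) (at s)"
        proof (rule has_real_derivative_shift_line)
          have "((\<lambda>r. norm ((v y + s *\<^sub>R k y) + r *\<^sub>R k y)) has_real_derivative sgn (v y + s *\<^sub>R k y) \<bullet> k y) (at 0)" for y
            by (rule has_real_derivative_norm_powr_line) (use velocity_nonzero[OF v[OF s] c] in auto)
          note d = this
          show "((\<lambda>r. speeds (\<lambda>x. v x + s *\<^sub>R k x + r *\<^sub>R k x) x w) has_real_derivative
              speeds_var (\<lambda>x. v x + s *\<^sub>R k x) k x w) (at 0)"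
            using DERIV_mult[OF d[of x] d[of "x + w"]] by (simp add: speeds_def speeds_var_def mult_ac)
        qed
        show "\<bar>speeds_var (\<lambda>x. v x + s *\<^sub>R k x) k x w\<bar> \<le> 2 * C * K"
          by (rule abs_speeds_var_le[OF c \<alpha> v[OF s] K])
      qed
      then show ?thesis by simp
    qed
    have "energy_density \<alpha> p (\<lambda>x. v x + t *\<^sub>R k x) x w - energy_density \<alpha> p v x w =
       (gap \<alpha> (\<lambda>x. v x + t *\<^sub>R k x) x w powr p - gap \<alpha> v x w powr p) * speeds (\<lambda>x. v x + t *\<^sub>R k x) x w +
       gap \<alpha> v x w powr p * (speeds (\<lambda>x. v x + t *\<^sub>R k x) x w - speeds v x w)"
      by (simp add: energy_density_def algebra_simps)
    also have "\<bar>\<dots>\<bar> \<le> \<bar>t\<bar> * (p * G powr (p - 1) * D' * Z powr p) * C\<^sup>2 + (G * Z) powr p * (\<bar>t\<bar> * (2 * C * K))"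
    proof (intro order.trans[OF abs_triangle_ineq] add_mono)
      show "\<bar>(gap \<alpha> (\<lambda>x. v x + t *\<^sub>R k x) x w powr p - gap \<alpha> v x w powr p) * speeds (\<lambda>x. v x + t *\<^sub>R k x) x w\<bar>
        \<le> \<bar>t\<bar> * (p * G powr (p - 1) * D' * Z powr p) * C\<^sup>2"
        unfolding abs_mult using 1 speeds_bounds[OF c \<alpha> v[of t], of x w] p D'0 by (intro mult_mono) auto
      show "\<bar>gap \<alpha> v x w powr p * (speeds (\<lambda>x. v x + t *\<^sub>R k x) x w - speeds v x w)\<bar> \<le>
         (G * Z) powr p * (\<bar>t\<bar> * (2 * C * K))"
        using sp gap_0 p mult_mono[of "gap \<alpha> v x w powr p" "(G * Z) powr p"] by (simp add: abs_mult powr_mono2)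
    qed
    also have "\<dots> = \<bar>t\<bar> * (E * Z powr p)"
      using C_ge[OF v0 c] c by (simp add: E_def powr_mult algebra_simps)
    finally show "\<bar>energy_density \<alpha> p (\<lambda>x. v x + t *\<^sub>R k x) x w - energy_density \<alpha> p v x w\<bar> \<le>
        \<bar>t\<bar> * (E * (osc v x w + osc k x w + far_part c C w) powr p)"
      by (simp add: Z_def)
  qed
qed

section \<open>Continuity of the variation in the curve, for directions that vary with the
  index\<close>

text \<open>Asymptotic equality of real sequences of which the second, hence both, are bounded: unlike
  convergence it tolerates the directions, which vary with the index.\<close>

definition close_seq :: "(nat \<Rightarrow> real) \<Rightarrow> (nat \<Rightarrow> real) \<Rightarrow> bool" where
  "close_seq f g \<longleftrightarrow> (\<lambda>j. f j - g j) \<longlonglongrightarrow> 0 \<and> Bseq g"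

lemma close_seq_lim: "f \<longlonglongrightarrow> l \<Longrightarrow> close_seq f (\<lambda>_. l)"
  unfolding close_seq_def using tendsto_diff[of f l sequentially "\<lambda>_. l" l]
  by (auto intro!: BseqI'[of _ "\<bar>l\<bar>"])

lemma close_seq_bound:
  assumes "\<delta> \<longlonglongrightarrow> 0" "\<And>j. \<bar>f j - g j\<bar> \<le> B * \<delta> j" "\<And>j. \<bar>g j\<bar> \<le> M"
  shows "close_seq f g"
  unfolding close_seq_def
proof
  show "(\<lambda>j. f j - g j) \<longlonglongrightarrow> 0"
    by (rule Lim_null_comparison[of _ "\<lambda>j. B * \<delta> j"]) (use assms in \<open>auto intro!: tendsto_eq_intros\<close>)
  show "Bseq g" using assms(3) by (intro BseqI'[of _ M]) auto
qed

lemma close_seq_add: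
  assumes "close_seq f g" "close_seq f' g'"
  shows "close_seq (\<lambda>j. f j + f' j) (\<lambda>j. g j + g' j)"
proof -
  obtain A B where AB: "\<And>j. \<bar>g j\<bar> \<le> A" "\<And>j. \<bar>g' j\<bar> \<le> B"
    using assms by (auto simp: close_seq_def Bseq_def)
  have "\<bar>g j + g' j\<bar> \<le> A + B" for j
    using AB(1)[of j] AB(2)[of j] by linarith
  moreover have "(\<lambda>j. (f j - g j) + (f' j - g' j)) \<longlonglongrightarrow> 0 + 0"
    using assms unfolding close_seq_def by (intro tendsto_add) auto
  ultimately show ?thesis
    unfolding close_seq_def by (intro conjI BseqI'[of _ "A + B"]) (auto simp: algebra_simps)
qed

lemma close_seq_mult:
  assumes "close_seq f g" "close_seq f' g'"
  shows "close_seq (\<lambda>j. f j * f' j) (\<lambda>j. g j * g' j)"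
proof -
  obtain A where A: "\<And>j. \<bar>g j\<bar> \<le> A" "0 < A" using assms(1) by (auto simp: close_seq_def Bseq_def)
  obtain B where B: "\<And>j. \<bar>g' j\<bar> \<le> B" "0 < B" using assms(2) by (auto simp: close_seq_def Bseq_def)
  have l: "(\<lambda>j. f j - g j) \<longlonglongrightarrow> 0" "(\<lambda>j. f' j - g' j) \<longlonglongrightarrow> 0"
    using assms by (auto simp: close_seq_def)
  have "(\<lambda>j. f j * f' j - g j * g' j) \<longlonglongrightarrow> 0"
  proof (rule Lim_null_comparison)
    show "\<forall>\<^sub>F j in sequentially. norm (f j * f' j - g j * g' j) \<le>
        \<bar>f j - g j\<bar> * \<bar>f' j - g' j\<bar> + B * \<bar>f j - g j\<bar> + A * \<bar>f' j - g' j\<bar>"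
    proof (rule always_eventually, rule allI)
      fix j
      have "f j * f' j - g j * g' j = (f j - g j) * (f' j - g' j) + g' j * (f j - g j) + g j * (f' j - g' j)"
        by (simp add: algebra_simps)
      also have "\<bar>\<dots>\<bar> \<le> \<bar>(f j - g j) * (f' j - g' j)\<bar> + \<bar>g' j * (f j - g j)\<bar> + \<bar>g j * (f' j - g' j)\<bar>"
        by linarith
      also have "\<dots> \<le> \<bar>f j - g j\<bar> * \<bar>f' j - g' j\<bar> + B * \<bar>f j - g j\<bar> + A * \<bar>f' j - g' j\<bar>"
        unfolding abs_mult using A(1) B(1) by (intro add_mono mult_right_mono) auto
      finally show "norm (f j * f' j - g j * g' j) \<le>
        \<bar>f j - g j\<bar> * \<bar>f' j - g' j\<bar> + B * \<bar>f j - g j\<bar> + A * \<bar>f' j - g' j\<bar>" by simp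
    qed
    show "(\<lambda>j. \<bar>f j - g j\<bar> * \<bar>f' j - g' j\<bar> + B * \<bar>f j - g j\<bar> + A * \<bar>f' j - g' j\<bar>) \<longlonglongrightarrow> 0"
    proof -
      have a: "(\<lambda>j. \<bar>f j - g j\<bar>) \<longlonglongrightarrow> 0" "(\<lambda>j. \<bar>f' j - g' j\<bar>) \<longlonglongrightarrow> 0"
        using tendsto_rabs[OF l(1)] tendsto_rabs[OF l(2)] by simp_all
      show ?thesis
        using tendsto_add[OF tendsto_add[OF tendsto_mult[OF a] tendsto_mult_left[OF a(1), of B]]
            tendsto_mult_left[OF a(2), of A]] by simp
    qed
  qed
  moreover have "\<bar>g j * g' j\<bar> \<le> A * B" for j
    unfolding abs_mult using A B by (intro mult_mono) auto
  ultimately show ?thesis unfolding close_seq_def by (intro conjI BseqI'[of _ "A * B"]) auto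
qed

lemma close_seq_const: "close_seq (\<lambda>_. l) (\<lambda>_. l)"
  by (rule close_seq_lim) simp

lemma close_seq_diff: "close_seq f g \<Longrightarrow> close_seq f' g' \<Longrightarrow> close_seq (\<lambda>j. f j - f' j) (\<lambda>j. g j - g' j)"
  using close_seq_add[of f g "\<lambda>j. (-1) * f' j" "\<lambda>j. (-1) * g' j"] close_seq_mult[OF close_seq_const[of "-1"]]
  by simp

lemma close_seq_eventually:
  assumes "close_seq f g" "\<forall>\<^sub>F j in sequentially. f' j = f j"
  shows "close_seq f' g"
proof -
  have "(\<lambda>j. f' j - g j) \<longlonglongrightarrow> 0"
    using assms by (auto simp: close_seq_def elim!: Lim_transform_eventually elim: eventually_mono)
  then show ?thesis using assms by (simp add: close_seq_def)
qed

context
  fixes c C \<alpha> p K :: real and v :: "real \<Rightarrow> 'a::euclidean_space" and u k :: "nat \<Rightarrow> real \<Rightarrow> 'a" and \<delta> :: "nat \<Rightarrow> real"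
  assumes c: "0 < c" and \<alpha>: "0 < \<alpha>" and p: "1 \<le> p"
    and v: "nondegenerate c C v" and u: "\<And>j. nondegenerate c C (u j)"
    and \<delta>: "\<delta> \<longlonglongrightarrow> 0" and uv: "\<And>j x. norm (u j x - v x) \<le> \<delta> j"
    and k: "\<And>j. velocity (k j)" and K: "\<And>j x. norm (k j x) \<le> K"
begin

private lemmas seg_v = velocity_continuous_segment[OF nondegenerate_velocity[OF v c]]
private lemmas seg_u = velocity_continuous_segment[OF nondegenerate_velocity[OF u c]]

lemma tendsto_velocity: "(\<lambda>j. u j x) \<longlonglongrightarrow> v x"
  by (rule Lim_transform2[OF tendsto_const], rule Lim_null_comparison[OF _ \<delta>])
     (use uv in \<open>auto simp: norm_minus_commute\<close>)

lemma tendsto_chord: "(\<lambda>j. chord (u j) x w) \<longlonglongrightarrow> chord v x w"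
proof (rule Lim_transform2[OF tendsto_const], rule Lim_null_comparison[OF _ \<delta>], rule always_eventually, rule allI)
  fix j
  have "chord v x w - chord (u j) x w = integral {0..1} (\<lambda>t. v (x + t * w) - u j (x + t * w))"
    unfolding chord_def by (intro integral_diff[symmetric] integrable_continuous_real seg_v seg_u)
  also have "norm \<dots> \<le> integral {0..1::real} (\<lambda>t. \<delta> j)"
    using uv by (intro integral_norm_bound_integral integrable_continuous_real continuous_on_diff
        continuous_on_const seg_v seg_u) (auto simp: norm_minus_commute)
  finally show "norm (chord v x w - chord (u j) x w) \<le> \<delta> j" by simp
qed

lemma tendsto_arc_mean: "(\<lambda>j. arc_mean (u j) x w) \<longlonglongrightarrow> arc_mean v x w"
proof (rule Lim_transform2[OF tendsto_const], rule Lim_null_comparison[OF _ \<delta>], rule always_eventually, rule allI)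
  fix j
  have "arc_mean v x w - arc_mean (u j) x w = integral {0..1} (\<lambda>t. norm (v (x + t * w)) - norm (u j (x + t * w)))"
    unfolding arc_mean_def
    by (intro integral_diff[symmetric] integrable_continuous_real continuous_on_norm seg_v seg_u)
  moreover have "norm (integral {0..1} (\<lambda>t. norm (v (x + t * w)) - norm (u j (x + t * w)))) \<le> integral {0..1::real} (\<lambda>t. \<delta> j)"
  proof (intro integral_norm_bound_integral integrable_continuous_real continuous_on_diff continuous_on_norm
        continuous_on_const seg_v seg_u)
    fix t
    show "norm (norm (v (x + t * w)) - norm (u j (x + t * w))) \<le> \<delta> j"
      using norm_triangle_ineq3[of "v (x + t * w)" "u j (x + t * w)"] uv[of j "x + t * w"]
      by (simp add: norm_minus_commute)
  qed
  ultimately show "norm (arc_mean v x w - arc_mean (u j) x w) \<le> \<delta> j" by simp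
qed

lemma tendsto_coarc_mean: "(\<lambda>j. coarc_mean (u j) x w) \<longlonglongrightarrow> coarc_mean v x w"
  unfolding coarc_mean_def divide_inverse by (intro tendsto_diff tendsto_mult tendsto_const tendsto_arc_mean)

lemma sgn_inner_diff_le: "\<bar>sgn (u j y) \<bullet> k j y - sgn (v y) \<bullet> k j y\<bar> \<le> 2 * \<delta> j / c * K"
proof -
  have "\<bar>(sgn (u j y) - sgn (v y)) \<bullet> k j y\<bar> \<le> norm (sgn (u j y) - sgn (v y)) * norm (k j y)"
    by (rule Cauchy_Schwarz_ineq2)
  also have "\<dots> \<le> 2 * \<delta> j / c * K"
  proof (intro mult_mono K)
    have "norm (sgn (u j y) - sgn (v y)) \<le> 2 * norm (u j y - v y) / c"
      by (rule norm_sgn_diff_le[OF c norm_velocity_ge[OF v c]])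
    also have "\<dots> \<le> 2 * \<delta> j / c" using uv c by (intro divide_right_mono mult_left_mono) auto
    finally show *: "norm (sgn (u j y) - sgn (v y)) \<le> 2 * \<delta> j / c" .
    show "0 \<le> 2 * \<delta> j / c" using order.trans[OF norm_ge_zero *] .
  qed auto
  finally show ?thesis by (simp add: inner_diff_left)
qed

lemma close_sgn_inner: "close_seq (\<lambda>j. sgn (u j y) \<bullet> k j y) (\<lambda>j. sgn (v y) \<bullet> k j y)"
  by (rule close_seq_bound[OF \<delta>, of _ _ "2 / c * K" K])
     (use sgn_inner_diff_le abs_sgn_inner_le[OF K] in \<open>auto simp: mult_ac\<close>)

lemma close_arc_mean_var: "close_seq (\<lambda>j. arc_mean_var (u j) (k j) x w) (\<lambda>j. arc_mean_var v (k j) x w)"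
proof (rule close_seq_bound[OF \<delta>, of _ _ "2 / c * K" K])
  fix j
  show "\<bar>arc_mean_var v (k j) x w\<bar> \<le> K" by (rule abs_arc_mean_var_le[OF v c k K])
  have "arc_mean_var (u j) (k j) x w - arc_mean_var v (k j) x w =
      integral {0..1} (\<lambda>t. sgn (u j (x + t * w)) \<bullet> k j (x + t * w) - sgn (v (x + t * w)) \<bullet> k j (x + t * w))"
    unfolding arc_mean_var_def
    by (intro integral_diff[symmetric] integrable_continuous_real continuous_on_inner cont_sgn_segment[OF u c]
        cont_sgn_segment[OF v c] velocity_continuous_segment[OF k])
  moreover have "norm (integral {0..1} (\<lambda>t. sgn (u j (x + t * w)) \<bullet> k j (x + t * w) - sgn (v (x + t * w)) \<bullet> k j (x + t * w)))
      \<le> integral {0..1::real} (\<lambda>t. 2 * \<delta> j / c * K)"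
    using sgn_inner_diff_le
    by (intro integral_norm_bound_integral integrable_continuous_real continuous_on_inner cont_sgn_segment[OF u c]
        cont_sgn_segment[OF v c] velocity_continuous_segment[OF k] continuous_on_diff continuous_on_const) auto
  ultimately show "\<bar>arc_mean_var (u j) (k j) x w - arc_mean_var v (k j) x w\<bar> \<le> 2 / c * K * \<delta> j"
    by (simp add: mult_ac)
qed

lemma close_coarc_mean_var: "close_seq (\<lambda>j. coarc_mean_var (u j) (k j) x w) (\<lambda>j. coarc_mean_var v (k j) x w)"
  unfolding coarc_mean_var_def divide_inverse
  by (intro close_seq_diff close_seq_mult close_arc_mean_var close_seq_const)

context
  fixes x w :: real
  assumes w: "\<bar>w\<bar> \<le> 1/2" "w \<noteq> 0"
begin

private lemma chord_nz: "chord v x w \<noteq> 0"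
  using norm_chord_ge[OF v c w(1), of x] c by auto

lemma close_chord_powr_var: "close_seq (\<lambda>j. chord_powr_var \<alpha> (u j) (k j) x w) (\<lambda>j. chord_powr_var \<alpha> v (k j) x w)"
  unfolding chord_powr_var_def
proof (intro close_seq_mult close_seq_const)
  show "close_seq (\<lambda>j. norm (chord (u j) x w) powr (- \<alpha> - 1)) (\<lambda>j. norm (chord v x w) powr (- \<alpha> - 1))"
    using chord_nz by (intro close_seq_lim tendsto_powr tendsto_norm tendsto_chord tendsto_const) auto
  have lim: "(\<lambda>j. norm (sgn (chord (u j) x w) - sgn (chord v x w))) \<longlonglongrightarrow> 0"
    using tendsto_norm[OF tendsto_diff[OF tendsto_sgn[OF tendsto_chord chord_nz] tendsto_const[of "sgn (chord v x w)"]]]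
    by simp
  have ck: "norm (chord (k j) x w) \<le> K" for j by (rule norm_chord_le[OF k K])
  show "close_seq (\<lambda>j. sgn (chord (u j) x w) \<bullet> chord (k j) x w) (\<lambda>j. sgn (chord v x w) \<bullet> chord (k j) x w)"
  proof (rule close_seq_bound[OF lim, of _ _ K K])
    fix j
    have "\<bar>(sgn (chord (u j) x w) - sgn (chord v x w)) \<bullet> chord (k j) x w\<bar> \<le>
        norm (sgn (chord (u j) x w) - sgn (chord v x w)) * norm (chord (k j) x w)"
      by (rule Cauchy_Schwarz_ineq2)
    also have "\<dots> \<le> norm (sgn (chord (u j) x w) - sgn (chord v x w)) * K"
      using ck by (intro mult_left_mono) auto
    finally show "\<bar>sgn (chord (u j) x w) \<bullet> chord (k j) x w - sgn (chord v x w) \<bullet> chord (k j) x w\<bar> \<le>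
        K * norm (sgn (chord (u j) x w) - sgn (chord v x w))"
      by (simp add: inner_diff_left mult.commute)
    show "\<bar>sgn (chord v x w) \<bullet> chord (k j) x w\<bar> \<le> K" by (rule abs_sgn_inner_le[OF ck])
  qed
qed

lemma close_near_gap_var: "close_seq (\<lambda>j. near_gap_var \<alpha> (u j) (k j) x w) (\<lambda>j. near_gap_var \<alpha> v (k j) x w)"
  unfolding near_gap_var_def using arc_mean_bounds(1)[OF v c, of x w] c
  by (intro close_seq_diff close_seq_mult close_chord_powr_var close_seq_const close_arc_mean_var
      close_seq_lim tendsto_powr tendsto_arc_mean tendsto_const) auto

lemma close_far_gap_var: "close_seq (\<lambda>j. far_gap_var \<alpha> (u j) (k j) x w) (\<lambda>j. far_gap_var \<alpha> v (k j) x w)"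
  unfolding far_gap_var_def using coarc_mean_ge[OF v c w, of x] c
  by (intro close_seq_diff close_seq_mult close_chord_powr_var close_seq_const close_coarc_mean_var
      close_seq_lim tendsto_powr tendsto_coarc_mean tendsto_const) auto

text \<open>A strict inequality between the arcs of the limit curve holds eventually along the
  sequence, so both variations use the same branch from some index on.\<close>

lemma close_gap_var:
  assumes ne: "arc_mean v x w \<noteq> coarc_mean v x w"
  shows "close_seq (\<lambda>j. gap_var \<alpha> (u j) (k j) x w) (\<lambda>j. gap_var \<alpha> v (k j) x w)"
proof (cases "arc_mean v x w < coarc_mean v x w")
  case True
  then have "\<forall>\<^sub>F j in sequentially. 0 < coarc_mean (u j) x w - arc_mean (u j) x w"
    by (intro order_tendstoD(1)[OF tendsto_diff[OF tendsto_coarc_mean tendsto_arc_mean]]) simp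
  then have "\<forall>\<^sub>F j in sequentially. gap_var \<alpha> (u j) (k j) x w = near_gap_var \<alpha> (u j) (k j) x w"
    by eventually_elim (simp add: gap_var_def)
  from close_seq_eventually[OF close_near_gap_var this] show ?thesis using True by (simp add: gap_var_def)
next
  case False
  then have less: "coarc_mean v x w < arc_mean v x w" using ne by simp
  then have "\<forall>\<^sub>F j in sequentially. 0 < arc_mean (u j) x w - coarc_mean (u j) x w"
    by (intro order_tendstoD(1)[OF tendsto_diff[OF tendsto_arc_mean tendsto_coarc_mean]]) simp
  then have "\<forall>\<^sub>F j in sequentially. gap_var \<alpha> (u j) (k j) x w = far_gap_var \<alpha> (u j) (k j) x w"
    by eventually_elim (simp add: gap_var_def)
  from close_seq_eventually[OF close_far_gap_var this] show ?thesis using less by (simp add: gap_var_def)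
qed

lemma tendsto_gap: "(\<lambda>j. gap \<alpha> (u j) x w) \<longlonglongrightarrow> gap \<alpha> v x w"
  unfolding gap_def near_gap_def far_gap_def
  using arc_mean_bounds(1)[OF v c, of x w] coarc_mean_ge[OF v c w, of x] chord_nz c
  by (intro tendsto_min tendsto_diff tendsto_powr tendsto_norm tendsto_chord tendsto_arc_mean
      tendsto_coarc_mean tendsto_const) auto

lemma tendsto_energy_density_var:
  assumes ne: "arc_mean v x w \<noteq> coarc_mean v x w"
  shows "(\<lambda>j. energy_density_var \<alpha> p (u j) (k j) x w - energy_density_var \<alpha> p v (k j) x w) \<longlonglongrightarrow> 0"
proof -
  have nn: "\<forall>\<^sub>F j in sequentially. 0 \<le> gap \<alpha> (u j) x w"
    using gap_bounds(1)[OF c \<alpha> u w] by auto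
  have gp: "(\<lambda>j. gap \<alpha> (u j) x w powr p) \<longlonglongrightarrow> gap \<alpha> v x w powr p"
    using p nn by (intro tendsto_powr' tendsto_gap tendsto_const) auto
  \<comment> \<open>For \<open>p = 1\<close> the factor is constantly 1; for \<open>p > 1\<close>
    the exponent \<open>p - 1\<close> is positive and the power is continuous from the right at a
    vanishing gap too.\<close>
  have dp: "(\<lambda>j. dpowr p (gap \<alpha> (u j) x w)) \<longlonglongrightarrow> dpowr p (gap \<alpha> v x w)"
  proof (cases "p = 1")
    case False
    then show ?thesis using p nn unfolding dpowr_def
      by (auto intro!: tendsto_powr' tendsto_gap tendsto_const)
  qed (simp add: dpowr_def)
  have "close_seq (\<lambda>j. energy_density_var \<alpha> p (u j) (k j) x w) (\<lambda>j. energy_density_var \<alpha> p v (k j) x w)"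
    unfolding energy_density_var_def speeds_def speeds_var_def
    by (intro close_seq_add close_seq_mult close_gap_var[OF ne] close_seq_const close_sgn_inner
        close_seq_lim[OF gp] close_seq_lim[OF dp] close_seq_lim[OF tendsto_norm[OF tendsto_velocity]])
  then show ?thesis by (simp add: close_seq_def)
qed

end
end

section \<open>Integrals over the parameter strip\<close>

text \<open>One period of base points and half a period of offsets in both directions, with the
  singular weight built into the measure: the energies become plain integrals to which dominated
  convergence applies as it stands.\<close>

definition strip :: "real \<Rightarrow> (real \<times> real) measure" where
  "strip q = density lborel
     (\<lambda>z. ennreal (indicator {0..1} (fst z) * (indicator {-1/2..1/2} (snd z) * \<bar>snd z\<bar> powr (-q))))"

lemma borel_measurable_fst_snd [measurable]:
  "fst \<in> borel_measurable (borel :: ('a::second_countable_topology \<times> 'b::second_countable_topology) measure)"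
  "snd \<in> borel_measurable (borel :: ('a \<times> 'b) measure)"
  by (auto intro!: borel_measurable_continuous_onI continuous_intros)

lemma space_strip [simp]: "space (strip q) = UNIV"
  by (simp add: strip_def)

lemma sets_strip [measurable_cong]: "sets (strip q) = sets borel"
  by (simp add: strip_def)

lemma nn_integral_lborel_pair:
  fixes f :: "real \<times> real \<Rightarrow> ennreal"
  assumes [measurable]: "f \<in> borel_measurable borel"
  shows "(\<integral>\<^sup>+z. f z \<partial>lborel) = (\<integral>\<^sup>+x. \<integral>\<^sup>+w. f (x, w) \<partial>lborel \<partial>lborel)"
proof -
  have "f \<in> borel_measurable (lborel \<Otimes>\<^sub>M lborel)" by (simp add: lborel_prod)
  from lborel.nn_integral_fst[OF this] show ?thesis by (simp add: lborel_prod)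
qed

lemma nn_integral_strip:
  fixes f :: "real \<times> real \<Rightarrow> ennreal"
  assumes [measurable]: "f \<in> borel_measurable borel"
  shows "(\<integral>\<^sup>+z. f z \<partial>strip q) =
    (\<integral>\<^sup>+x\<in>{0..1}. (\<integral>\<^sup>+w\<in>{-1/2..1/2}. ennreal (\<bar>w\<bar> powr (-q)) * f (x, w) \<partial>lborel) \<partial>lborel)"
proof -
  have "(\<integral>\<^sup>+z. f z \<partial>strip q) = (\<integral>\<^sup>+z. ennreal (indicator {0..1} (fst z) *
      (indicator {-1/2..1/2} (snd z) * \<bar>snd z\<bar> powr (-q))) * f z \<partial>lborel)"
    unfolding strip_def by (rule nn_integral_density) auto
  also have "\<dots> = (\<integral>\<^sup>+x. \<integral>\<^sup>+w. ennreal (indicator {0..1} x *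
      (indicator {-1/2..1/2} w * \<bar>w\<bar> powr (-q))) * f (x, w) \<partial>lborel \<partial>lborel)"
    by (subst nn_integral_lborel_pair) auto
  also have "\<dots> = (\<integral>\<^sup>+x\<in>{0..1}. (\<integral>\<^sup>+w\<in>{-1/2..1/2}. ennreal (\<bar>w\<bar> powr (-q)) * f (x, w) \<partial>lborel) \<partial>lborel)"
    by (intro nn_integral_cong) (auto simp: indicator_def mult_ac intro!: nn_integral_cong)
  finally show ?thesis .
qed

text \<open>Tonelli's theorem: null sets are checked on each line of fixed \<open>x\<close>, and
  measurability of \<open>P\<close> carries the conclusion to the plane. The density changes
  nothing, as it only adds null sets.\<close>

lemma AE_strip:
  assumes [measurable]: "Measurable.pred borel P"
    and P: "\<And>x. AE w in lborel. w \<noteq> 0 \<longrightarrow> \<bar>w\<bar> \<le> 1/2 \<longrightarrow> P (x, w)"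
  shows "AE z in strip q. P z"
proof -
  have "AE z in lborel \<Otimes>\<^sub>M lborel. snd z \<noteq> 0 \<longrightarrow> \<bar>snd z\<bar> \<le> 1/2 \<longrightarrow> P z"
  proof (rule lborel_pair.AE_pair_measure)
    have "Measurable.pred borel (\<lambda>z. snd z \<noteq> 0 \<longrightarrow> \<bar>snd z\<bar> \<le> 1/2 \<longrightarrow> P z)" by measurable
    then show "{x \<in> space (lborel \<Otimes>\<^sub>M lborel). snd x \<noteq> 0 \<longrightarrow> \<bar>snd x\<bar> \<le> 1/2 \<longrightarrow> P x} \<in> sets (lborel \<Otimes>\<^sub>M lborel)"
      unfolding pred_def lborel_prod by simp
  qed (use P in auto)
  then have "AE z in lborel. snd z \<noteq> 0 \<longrightarrow> \<bar>snd z\<bar> \<le> 1/2 \<longrightarrow> P z" unfolding lborel_prod .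
  then show ?thesis
    unfolding strip_def by (subst AE_density) (auto elim!: eventually_mono simp: indicator_def split: if_splits)
qed

lemma AE_strip_bounds: "AE z in strip q. \<bar>snd z\<bar> \<le> 1/2 \<and> snd z \<noteq> 0"
  by (rule AE_strip) auto

lemma AE_strip_arcs_differ:
  assumes "nondegenerate c C v" "0 < c"
  shows "AE z in strip q. arc_mean v (fst z) (snd z) \<noteq> coarc_mean v (fst z) (snd z)"
proof (rule AE_strip)
  have [measurable]: "(\<lambda>z. arc_mean v (fst z) (snd z)) \<in> borel_measurable borel"
    using continuous_on_arc_mean[OF nondegenerate_velocity[OF assms]] by (rule borel_measurable_continuous_onI)
  show "Measurable.pred borel (\<lambda>z. arc_mean v (fst z) (snd z) \<noteq> coarc_mean v (fst z) (snd z))"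
    unfolding coarc_mean_def by measurable
  fix x
  have "AE w in lborel. w \<notin> {w. w \<noteq> 0 \<and> arc_mean v x w = coarc_mean v x w}"
    using finite_equal_arcs[OF assms, of x]
    by (intro AE_not_in countable_imp_null_set_lborel countable_finite)
  then show "AE w in lborel. w \<noteq> 0 \<longrightarrow> \<bar>w\<bar> \<le> 1/2 \<longrightarrow> arc_mean v (fst (x, w)) (snd (x, w)) \<noteq> coarc_mean v (fst (x, w)) (snd (x, w))"
    by eventually_elim auto
qed

section \<open>The Gagliardo seminorm controls the mean square oscillation\<close>

lemma powr_tangent_le:
  fixes a y p :: real
  assumes "0 \<le> a" "0 \<le> y" "1 \<le> p"
  shows "a powr p + p * dpowr p a * (y - a) \<le> y powr p"
proof -
  have dp: "dpowr p z = z powr (p - 1)" if "0 < z" for z using that by (simp add: dpowr_def)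
  show ?thesis
  proof (cases a y rule: linorder_cases)
    case less
    from powr_mean_value[OF assms(1) this assms(3)]
    obtain z where "a < z" "y powr p - a powr p = (y - a) * (p * z powr (p - 1))" .
    then have z: "a < z" "y powr p - a powr p = (y - a) * (p * dpowr p z)" using assms dp by auto
    have "(y - a) * (p * dpowr p a) \<le> (y - a) * (p * dpowr p z)"
      using less assms z by (intro mult_left_mono dpowr_mono) auto
    then show ?thesis using z by (simp add: mult_ac)
  next
    case greater
    from powr_mean_value[OF assms(2) this assms(3)]
    obtain z where "y < z" "z < a" "a powr p - y powr p = (a - y) * (p * z powr (p - 1))" .
    then have z: "y < z" "z < a" "a powr p - y powr p = (a - y) * (p * dpowr p z)" using assms dp by auto
    have "(a - y) * (p * dpowr p z) \<le> (a - y) * (p * dpowr p a)"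
      using greater assms z by (intro mult_left_mono dpowr_mono) auto
    then show ?thesis using z by (simp add: algebra_simps)
  qed simp
qed

text \<open>Jensen's inequality on the unit interval: integrate the tangent line at the mean
  \<open>a\<close>, whose linear part has mean zero.\<close>

lemma integral_powr_le:
  fixes g :: "real \<Rightarrow> real"
  assumes g: "continuous_on {0..1} g" "\<And>t. 0 \<le> g t" and p: "1 \<le> p"
  shows "(integral {0..1} g) powr p \<le> integral {0..1} (\<lambda>t. g t powr p)"
proof -
  define a where "a = integral {0..1} g"
  have a: "0 \<le> a" unfolding a_def using g by (intro integral_nonneg integrable_continuous_real) auto
  have c: "continuous_on {0..1} (\<lambda>t. g t powr p)"
    using g p by (intro continuous_on_powr' continuous_on_const) auto
  have "a powr p = integral {0..1} (\<lambda>t. a powr p + p * dpowr p a * (g t - a))"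
    using g(1) by (subst integral_add) (auto intro!: integrable_continuous_real continuous_intros simp: integral_diff integrable_continuous_real a_def)
  also have "\<dots> \<le> integral {0..1} (\<lambda>t. g t powr p)"
  proof (rule integral_le)
    show "(\<lambda>t. a powr p + p * dpowr p a * (g t - a)) integrable_on {0..1}"
      using g by (intro integrable_continuous_real continuous_intros)
  qed (use powr_tangent_le[OF a _ p] g integrable_continuous_real[OF c] in auto)
  finally show ?thesis by (simp add: a_def)
qed

text \<open>Substituting \<open>h = t * w\<close> produces the factor \<open>t powr (q - 1)\<close>,
  at most 1 since \<open>q \<ge> 1\<close>, and shrinks the range of integration.\<close>

lemma nn_integral_dilation_le:
  fixes G :: "real \<Rightarrow> ennreal"
  assumes [measurable]: "G \<in> borel_measurable borel" and q: "1 \<le> q" and t: "0 < t" "t \<le> 1"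
  shows "(\<integral>\<^sup>+w\<in>{-1/2..1/2}. ennreal (\<bar>w\<bar> powr (-q)) * G (t * w) \<partial>lborel) \<le>
    (\<integral>\<^sup>+w\<in>{-1/2..1/2}. ennreal (\<bar>w\<bar> powr (-q)) * G w \<partial>lborel)"
proof -
  define f where "f h = ennreal (\<bar>h\<bar> powr (-q)) * G h * indicator {-(1/2)..1/2} h" for h
  have [measurable]: "f \<in> borel_measurable borel" unfolding f_def by measurable
  have "(\<integral>\<^sup>+w\<in>{-1/2..1/2}. ennreal (\<bar>w\<bar> powr (-q)) * G (t * w) \<partial>lborel) \<le>
      (\<integral>\<^sup>+w. ennreal t * f (0 + t * w) \<partial>lborel)"
  proof (rule nn_integral_mono)
    fix w :: real
    show "ennreal (\<bar>w\<bar> powr (-q)) * G (t * w) * indicator {-1/2..1/2} w \<le> ennreal t * f (0 + t * w)"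
    proof (cases "w \<in> {-1/2..1/2}")
      case True
      then have "\<bar>w\<bar> \<le> 1/2" by auto
      then have "\<bar>t * w\<bar> \<le> 1 * (1/2)" unfolding abs_mult using t by (intro mult_mono) auto
      then have tw: "t * w \<in> {-(1/2)..1/2}" by auto
      have "1 \<le> t powr (1 - q)" using t q powr_mono2'[of "1 - q" t 1] by simp
      then have "\<bar>w\<bar> powr (-q) \<le> t powr (1 - q) * \<bar>w\<bar> powr (-q)"
        by (simp add: mult_left_mono mult_le_cancel_right1)
      also have "\<dots> = t * \<bar>t * w\<bar> powr (-q)" using t by (simp add: abs_mult powr_mult powr_diff powr_minus field_simps)
      finally have "ennreal (\<bar>w\<bar> powr (-q)) \<le> ennreal t * ennreal (\<bar>t * w\<bar> powr (-q))"
        using t by (simp add: ennreal_mult[symmetric] ennreal_leI)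
      then show ?thesis using True tw by (auto simp: f_def mult.assoc[symmetric] intro!: mult_right_mono)
    qed auto
  qed
  also have "\<dots> = ennreal t * (\<integral>\<^sup>+w. f (0 + t * w) \<partial>lborel)" by (rule nn_integral_cmult) auto
  also have "\<dots> = (\<integral>\<^sup>+w. f w \<partial>lborel)" using nn_integral_real_affine[of f t 0] t by simp
  also have "\<dots> = (\<integral>\<^sup>+w\<in>{-1/2..1/2}. ennreal (\<bar>w\<bar> powr (-q)) * G w \<partial>lborel)" by (simp add: f_def)
  finally show ?thesis .
qed

text \<open>By Jensen the power of \<open>osc\<close> is at most the mean over \<open>t\<close> of
  the increments of \<open>v\<close> over \<open>t * w\<close>. After exchanging the integrals the
  dilation bound removes \<open>t\<close>, and the remaining average over \<open>t\<close> is
  trivial.\<close>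

lemma nn_integral_osc_powr_le:
  fixes v :: "real \<Rightarrow> 'a::euclidean_space"
  assumes v: "velocity v" and p: "1 \<le> p" and q: "1 \<le> 1 + s * (2 * p)"
  shows "(\<integral>\<^sup>+z. ennreal (osc v (fst z) (snd z) powr p) \<partial>strip (1 + s * (2 * p))) \<le> gagliardo_pow s (2 * p) v"
proof -
  define q where "q = 1 + s * (2 * p)"
  define G where "G x h = ennreal (norm (v (x + h) - v x) powr (2 * p))" for x h
  have cv: "continuous_on UNIV v" by (rule velocityD(1)[OF v])
  have [measurable]: "v \<in> borel_measurable borel" using cv by (rule borel_measurable_continuous_onI)
  have [measurable]: "(\<lambda>h. G x h) \<in> borel_measurable borel" for x unfolding G_def by measurable
  have [measurable]: "(\<lambda>z. osc v (fst z) (snd z)) \<in> borel_measurable borel"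
    using continuous_on_osc[OF v] by (rule borel_measurable_continuous_onI)
  have osc: "ennreal (osc v x w powr p) \<le> (\<integral>\<^sup>+t\<in>{0..1}. G x (t * w) \<partial>lborel)" for x w
  proof -
    have c: "continuous_on {0..1} (\<lambda>t. (norm (v (x + t * w) - v x))\<^sup>2)"
      using velocity_continuous_segment[OF v] by (intro continuous_intros)
    have c2: "continuous_on {0..1} (\<lambda>t. norm (v (x + t * w) - v x) powr (2 * p))"
      using velocity_continuous_segment[OF v] p by (intro continuous_on_powr' continuous_intros) auto
    have "osc v x w powr p \<le> integral {0..1} (\<lambda>t. ((norm (v (x + t * w) - v x))\<^sup>2) powr p)"
      unfolding osc_def by (rule integral_powr_le[OF c _ p]) auto
    also have "\<dots> = integral {0..1} (\<lambda>t. norm (v (x + t * w) - v x) powr (2 * p))"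
      by (intro integral_cong) (simp add: powr_powr flip: powr_numeral)
    finally have "ennreal (osc v x w powr p) \<le> ennreal (integral {0..1} (\<lambda>t. norm (v (x + t * w) - v x) powr (2 * p)))"
      by (rule ennreal_leI)
    also have "\<dots> = (\<integral>\<^sup>+t\<in>{0..1}. G x (t * w) \<partial>lborel)"
      unfolding G_def
      using nn_integral_has_integral_lebesgue[of "{0..1}" "\<lambda>t. norm (v (x + t * w) - v x) powr (2 * p)"]
        integrable_integral[OF integrable_continuous_real[OF c2]]
      by (simp add: nn_integral_completion ennreal_mult' ennreal_indicator mult.commute)
    finally show ?thesis .
  qed
  have "(\<integral>\<^sup>+w\<in>{-1/2..1/2}. ennreal (\<bar>w\<bar> powr (-q)) * ennreal (osc v x w powr p) \<partial>lborel) \<le>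
     (\<integral>\<^sup>+w\<in>{-1/2..1/2}. ennreal (\<bar>w\<bar> powr (-q)) * G x w \<partial>lborel)" for x
  proof -
    have "(\<integral>\<^sup>+w\<in>{-1/2..1/2}. ennreal (\<bar>w\<bar> powr (-q)) * ennreal (osc v x w powr p) \<partial>lborel) \<le>
       (\<integral>\<^sup>+w\<in>{-1/2..1/2}. ennreal (\<bar>w\<bar> powr (-q)) * (\<integral>\<^sup>+t\<in>{0..1}. G x (t * w) \<partial>lborel) \<partial>lborel)"
      using osc by (intro nn_integral_mono mult_right_mono mult_left_mono) auto
    also have "\<dots> = (\<integral>\<^sup>+w. \<integral>\<^sup>+t. ennreal (\<bar>w\<bar> powr (-q)) * (G x (t * w) * indicator {0..1} t) * indicator {-1/2..1/2} w \<partial>lborel \<partial>lborel)"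
      by (simp add: nn_integral_cmult nn_integral_multc)
    also have "\<dots> = (\<integral>\<^sup>+t. \<integral>\<^sup>+w. ennreal (\<bar>w\<bar> powr (-q)) * (G x (t * w) * indicator {0..1} t) * indicator {-1/2..1/2} w \<partial>lborel \<partial>lborel)"
      by (rule lborel_pair.Fubini') (unfold G_def, measurable)
    also have "\<dots> \<le> (\<integral>\<^sup>+t\<in>{0..1::real}. (\<integral>\<^sup>+w\<in>{-1/2..1/2}. ennreal (\<bar>w\<bar> powr (-q)) * G x w \<partial>lborel) \<partial>lborel)"
    proof (rule nn_integral_mono)
      fix t :: real
      have "(\<integral>\<^sup>+w. ennreal (\<bar>w\<bar> powr (-q)) * (G x (t * w) * indicator {0..1} t) * indicator {-1/2..1/2} w \<partial>lborel)
          = (\<integral>\<^sup>+w\<in>{-1/2..1/2}. ennreal (\<bar>w\<bar> powr (-q)) * G x (t * w) \<partial>lborel) * indicator {0..1} t"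
        by (subst nn_integral_multc[symmetric]) (auto intro!: nn_integral_cong simp: mult_ac)
      also have "\<dots> \<le> (\<integral>\<^sup>+w\<in>{-1/2..1/2}. ennreal (\<bar>w\<bar> powr (-q)) * G x w \<partial>lborel) * indicator {0..1} t"
      proof (cases "t = 0")
        case True
        \<comment> \<open>At \<open>t = 0\<close> there is no substitution, but the increment
          vanishes and so does its positive power.\<close>
        then show ?thesis using p by (simp add: G_def)
      next
        case False
        then show ?thesis using nn_integral_dilation_le[of "G x" q t] q
          by (auto simp: indicator_def q_def)
      qed
      finally show "(\<integral>\<^sup>+w. ennreal (\<bar>w\<bar> powr (-q)) * (G x (t * w) * indicator {0..1} t) * indicator {-1/2..1/2} w \<partial>lborel)
         \<le> (\<integral>\<^sup>+w\<in>{-1/2..1/2}. ennreal (\<bar>w\<bar> powr (-q)) * G x w \<partial>lborel) * indicator {0..1} t" .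
    qed
    also have "\<dots> = (\<integral>\<^sup>+w\<in>{-1/2..1/2}. ennreal (\<bar>w\<bar> powr (-q)) * G x w \<partial>lborel)"
      by (subst nn_integral_cmult_indicator) auto
    finally show ?thesis .
  qed
  note inner = this
  have "(\<integral>\<^sup>+z. ennreal (osc v (fst z) (snd z) powr p) \<partial>strip q) \<le>
      (\<integral>\<^sup>+x\<in>{0..1}. (\<integral>\<^sup>+w\<in>{-1/2..1/2}. ennreal (\<bar>w\<bar> powr (-q)) * G x w \<partial>lborel) \<partial>lborel)"
    by (subst nn_integral_strip, measurable, simp only: fst_conv snd_conv)
       (rule nn_integral_mono, rule mult_right_mono, rule inner, simp)
  also have "\<dots> = gagliardo_pow s (2 * p) v"
  proof -
    have "ennreal (\<bar>w\<bar> powr (-q)) * G x w = ennreal (norm (v (x + w) - v x) powr (2 * p) / \<bar>w\<bar> powr q)" for x w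
      unfolding G_def by (subst ennreal_mult[symmetric]) (auto simp: powr_minus divide_inverse mult.commute)
    then show ?thesis by (simp only: gagliardo_pow_def q_def)
  qed
  finally show ?thesis by (simp add: q_def)
qed

lemma nn_integral_far_part_finite:
  assumes "0 < c" "0 < C" "0 \<le> q"
  shows "(\<integral>\<^sup>+z. ennreal (far_part c C (snd z)) \<partial>strip q) < \<infinity>"
proof -
  define w0 where "w0 = c / (2 * C)"
  have w0: "0 < w0" using assms by (simp add: w0_def)
  note far = far_part_def
  have [measurable]: "far_part c C \<in> borel_measurable borel" unfolding far[abs_def] by measurable
  have "(\<integral>\<^sup>+z. ennreal (far_part c C (snd z)) \<partial>strip q) =
     (\<integral>\<^sup>+x\<in>{0..1::real}. (\<integral>\<^sup>+w\<in>{-1/2..1/2}. ennreal (\<bar>w\<bar> powr (-q)) * ennreal (far_part c C w) \<partial>lborel) \<partial>lborel)"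
    by (subst nn_integral_strip) auto
  also have "\<dots> \<le> (\<integral>\<^sup>+x\<in>{0..1::real}. (\<integral>\<^sup>+w\<in>{-1/2..1/2::real}. ennreal (w0 powr (-q)) \<partial>lborel) \<partial>lborel)"
  proof (intro nn_integral_mono mult_right_mono)
    fix w :: real
    show "ennreal (\<bar>w\<bar> powr (-q)) * ennreal (far_part c C w) \<le> ennreal (w0 powr (-q))"
      using w0 assms by (auto simp: far w0_def[symmetric] intro!: ennreal_leI powr_mono2')
  qed auto
  also have "\<dots> < \<infinity>" by (simp add: nn_integral_cmult_indicator)
  finally show ?thesis .
qed

section \<open>Differentiability of the energy as a function of the velocity\<close>

lemma powr_sum3_le:
  fixes a b d p :: real
  assumes "0 \<le> a" "0 \<le> b" "0 \<le> d" "1 \<le> p"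
  shows "(a + b + d) powr p \<le> 3 powr p * (a powr p + b powr p + d powr p)"
proof -
  define m where "m = max a (max b d)"
  have "(a + b + d) powr p \<le> (3 * m) powr p" using assms by (intro powr_mono2) (auto simp: m_def)
  also have "\<dots> = 3 powr p * m powr p" by (rule powr_mult)
  also have "m powr p \<le> a powr p + b powr p + d powr p"
    unfolding m_def max_def using assms by auto
  finally show ?thesis by simp
qed

lemma far_part_powr: "far_part c C w powr p = far_part c C w"
  by (simp add: far_part_def)

text \<open>Chords are averages of velocities, so a perturbation of size \<open>e\<close> in the sup
  norm moves each of them by at most \<open>e\<close>.\<close>

lemma nondegenerate_perturb:
  fixes v k :: "real \<Rightarrow> 'a::euclidean_space"
  assumes v: "nondegenerate c C v" and k: "velocity k" and K: "\<And>x. norm (k x) \<le> K" and t: "\<bar>t\<bar> * K \<le> e"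
  shows "nondegenerate (c - e) (C + e) (\<lambda>x. v x + t *\<^sub>R k x)"
  unfolding nondegenerate_def
proof (intro conjI allI impI)
  have vel: "velocity v" using v by (simp add: nondegenerate_def)
  show "velocity (\<lambda>x. v x + t *\<^sub>R k x)" by (rule velocity_add_scaled[OF vel k])
  have small: "norm (t *\<^sub>R y) \<le> e" if "norm y \<le> K" for y :: 'a
    using mult_left_mono[OF that, of "\<bar>t\<bar>"] t by simp
  fix x
  have "norm (v x) \<le> C" using v by (simp add: nondegenerate_def)
  then show "norm (v x + t *\<^sub>R k x) \<le> C + e"
    using small[OF K, of x] norm_triangle_ineq[of "v x" "t *\<^sub>R k x"] by linarith
  fix w :: real assume "\<bar>w\<bar> \<le> 1/2"
  then have "c \<le> norm (chord v x w)" using v by (simp add: nondegenerate_def)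
  moreover have "norm (t *\<^sub>R chord k x w) \<le> e" by (rule small[OF norm_chord_le[OF k K]])
  ultimately show "c - e \<le> norm (chord (\<lambda>x. v x + t *\<^sub>R k x) x w)"
    using norm_diff_ineq[of "chord v x w" "t *\<^sub>R chord k x w"] by (simp add: chord_add_scaled[OF vel k])
qed

lemma nondegenerate_mono:
  "nondegenerate c C v \<Longrightarrow> c' \<le> c \<Longrightarrow> C \<le> C' \<Longrightarrow> nondegenerate c' C' v"
  by (auto simp: nondegenerate_def intro: order.trans)

lemma nondegenerate_measurable:
  fixes v k :: "real \<Rightarrow> 'a::euclidean_space"
  assumes v: "nondegenerate c C v" and c: "0 < c" and k: "velocity k"
  shows "(\<lambda>z. energy_density \<alpha> p v (fst z) (snd z)) \<in> borel_measurable borel"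
    and "(\<lambda>z. energy_density_var \<alpha> p v k (fst z) (snd z)) \<in> borel_measurable borel"
proof -
  note vel = nondegenerate_velocity[OF v c]
  have [measurable]: "(\<lambda>z. chord v (fst z) (snd z)) \<in> borel_measurable borel"
    "(\<lambda>z. chord k (fst z) (snd z)) \<in> borel_measurable borel"
    "(\<lambda>z. arc_mean v (fst z) (snd z)) \<in> borel_measurable borel"
    "(\<lambda>z. arc_mean_var v k (fst z) (snd z)) \<in> borel_measurable borel"
    "v \<in> borel_measurable borel" "k \<in> borel_measurable borel"
    using continuous_on_chord[OF vel] continuous_on_chord[OF k] continuous_on_arc_mean[OF vel]
      continuous_on_arc_mean_var[OF vel k velocity_nonzero[OF v c]] velocityD(1)[OF vel] velocityD(1)[OF k]
    by (auto intro: borel_measurable_continuous_onI)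
  show "(\<lambda>z. energy_density \<alpha> p v (fst z) (snd z)) \<in> borel_measurable borel"
    unfolding energy_density_def gap_def near_gap_def far_gap_def coarc_mean_def speeds_def by measurable
  show "(\<lambda>z. energy_density_var \<alpha> p v k (fst z) (snd z)) \<in> borel_measurable borel"
    unfolding energy_density_var_def gap_def near_gap_def far_gap_def coarc_mean_def speeds_def
      gap_var_def near_gap_var_def far_gap_var_def coarc_mean_var_def chord_powr_var_def speeds_var_def
      sgn_div_norm dpowr_def by measurable
qed

text \<open>A dominated convergence theorem with a bounded but non-convergent part \<open>W\<close>
  in the majorant. Cutting \<open>F j\<close> at the fixed integrable function
  \<open>D * (1 / \<theta>) * Y\<close> leaves a part that converges in the usual way; the excess is
  bounded through \<open>Z\<close>, whose integrals vanish in the limit, and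
  \<open>\<theta> * W\<close>, whose integrals are small uniformly in \<open>j\<close>. The
  parameter \<theta> depends on \<epsilon> only and is fixed before \<open>j\<close>.\<close>

lemma integral_tendsto_zero_of_split_bound:
  fixes F Z W :: "nat \<Rightarrow> 'b \<Rightarrow> real" and Y :: "'b \<Rightarrow> real"
  assumes F [measurable]: "\<And>j. F j \<in> borel_measurable M" and F0: "\<And>j z. 0 \<le> F j z"
    and lim: "AE z in M. (\<lambda>j. F j z) \<longlonglongrightarrow> 0"
    and bound: "\<And>j \<theta>. 0 < \<theta> \<Longrightarrow> \<theta> \<le> 1 \<Longrightarrow> AE z in M. F j z \<le> D * (1 / \<theta> * (Y z + Z j z) + \<theta> * W j z)"
    and Y: "integrable M Y" "\<And>z. 0 \<le> Y z" and Z: "\<And>j. integrable M (Z j)" "\<And>j z. 0 \<le> Z j z"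
    and W: "\<And>j. integrable M (W j)" "\<And>j z. 0 \<le> W j z"
    and limZ: "(\<lambda>j. \<integral>z. Z j z \<partial>M) \<longlonglongrightarrow> 0" and WB: "\<And>j. (\<integral>z. W j z \<partial>M) \<le> B" and D: "0 \<le> D"
  shows "(\<lambda>j. \<integral>z. F j z \<partial>M) \<longlonglongrightarrow> 0"
proof (rule LIMSEQ_I)
  fix \<epsilon> :: real assume \<epsilon>: "0 < \<epsilon>"
  have B0: "0 \<le> B" using order.trans[OF integral_nonneg_AE WB, of 0] W(2) by auto
  \<comment> \<open>Chosen so that \<open>D * \<theta> * B \<le> \<epsilon> / 2\<close>; adding 1
    excludes a zero denominator, and the minimum keeps \<theta> in the range of the
    hypothesis.\<close>
  define \<theta> where "\<theta> = min 1 (\<epsilon> / (2 * (D * B + 1)))"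
  have DB: "0 \<le> D * B" using D B0 by simp
  have th: "0 < \<theta>" "\<theta> \<le> 1" using \<epsilon> DB by (auto simp: \<theta>_def)
  have Fint: "integrable M (F j)" for j
  proof (rule Bochner_Integration.integrable_bound)
    show "integrable M (\<lambda>z. D * (1 / 1 * (Y z + Z j z) + 1 * W j z))" using Y Z W by auto
    show "AE z in M. norm (F j z) \<le> norm (D * (1 / 1 * (Y z + Z j z) + 1 * W j z))"
      using bound[of 1 j] F0 by auto
  qed auto
  \<comment> \<open>The truncation: its majorant does not depend on \<open>j\<close>.\<close>
  define m where "m j z = min (F j z) (D * (1 / \<theta>) * Y z)" for j z
  have [measurable]: "Y \<in> borel_measurable M" using Y by auto
  have [measurable]: "m j \<in> borel_measurable M" for j unfolding m_def[abs_def] by measurable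
  have m_lim: "(\<lambda>j. \<integral>z. m j z \<partial>M) \<longlonglongrightarrow> (\<integral>z. 0 \<partial>M)"
  proof (rule integral_dominated_convergence)
    show "integrable M (\<lambda>z. D * (1 / \<theta>) * Y z)" using Y by auto
    show "AE z in M. (\<lambda>j. m j z) \<longlonglongrightarrow> 0"
      using lim
    proof eventually_elim
      case (elim z)
      have "(\<lambda>j. m j z) \<longlonglongrightarrow> min 0 (D * (1 / \<theta>) * Y z)"
        unfolding m_def by (intro tendsto_min elim tendsto_const)
      moreover have "min 0 (D * (1 / \<theta>) * Y z) = 0" using D th Y by (intro min_absorb1) auto
      ultimately show ?case by simp
    qed
    show "AE z in M. norm (m j z) \<le> D * (1 / \<theta>) * Y z" for j
      using F0 D th Y(2) by (auto simp: m_def min_def)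
  qed (auto simp: m_def)
  have m_int: "integrable M (m j)" for j
    by (rule Bochner_Integration.integrable_bound[OF Fint[of j]])
       (use F0 D th Y(2) in \<open>auto simp: m_def min_def\<close>)
  have le: "(\<integral>z. F j z \<partial>M) \<le> (\<integral>z. m j z \<partial>M) + D * (1 / \<theta>) * (\<integral>z. Z j z \<partial>M) + D * \<theta> * B" for j
  proof -
    have "(\<integral>z. F j z \<partial>M) \<le> (\<integral>z. m j z + D * (1 / \<theta>) * Z j z + D * \<theta> * W j z \<partial>M)"
    proof (rule integral_mono_AE)
      show "AE z in M. F j z \<le> m j z + D * (1 / \<theta>) * Z j z + D * \<theta> * W j z"
        using bound[OF th, of j]
      proof eventually_elim
        case (elim z)
        have "0 \<le> D * (1 / \<theta>) * Z j z" "0 \<le> D * \<theta> * W j z" using D th Z(2) W(2) by auto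
        moreover have "D * (1 / \<theta> * (Y z + Z j z) + \<theta> * W j z) =
            D * (1 / \<theta>) * Y z + D * (1 / \<theta>) * Z j z + D * \<theta> * W j z" by (simp add: algebra_simps add_divide_distrib)
        ultimately show ?case using elim unfolding m_def by linarith
      qed
    qed (use Fint m_int Z W in auto)
    also have "\<dots> = (\<integral>z. m j z \<partial>M) + D * (1 / \<theta>) * (\<integral>z. Z j z \<partial>M) + D * \<theta> * (\<integral>z. W j z \<partial>M)"
      using m_int Z W by simp
    also have "\<dots> \<le> (\<integral>z. m j z \<partial>M) + D * (1 / \<theta>) * (\<integral>z. Z j z \<partial>M) + D * \<theta> * B"
      using WB D th by (intro add_left_mono mult_left_mono) auto
    finally show ?thesis .
  qed
  have "(\<lambda>j. (\<integral>z. m j z \<partial>M) + D * (1 / \<theta>) * (\<integral>z. Z j z \<partial>M)) \<longlonglongrightarrow> 0"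
    using tendsto_add[OF m_lim tendsto_mult_left[OF limZ, of "D * (1 / \<theta>)"]] by simp
  then have "\<forall>\<^sub>F j in sequentially. (\<integral>z. m j z \<partial>M) + D * (1 / \<theta>) * (\<integral>z. Z j z \<partial>M) < \<epsilon> / 2"
    using \<epsilon> by (intro order_tendstoD(2)) auto
  then obtain N where N: "\<And>j. N \<le> j \<Longrightarrow> (\<integral>z. m j z \<partial>M) + D * (1 / \<theta>) * (\<integral>z. Z j z \<partial>M) < \<epsilon> / 2"
    by (auto simp: eventually_sequentially)
  have small: "D * \<theta> * B \<le> \<epsilon> / 2"
  proof -
    have "\<theta> * (D * B) \<le> \<epsilon> / (2 * (D * B + 1)) * (D * B + 1)"
      using th DB \<epsilon> by (intro mult_mono) (auto simp: \<theta>_def)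
    also have "\<dots> = \<epsilon> / 2" using DB by (simp add: field_simps)
    finally show ?thesis by (simp add: mult_ac)
  qed
  show "\<exists>N. \<forall>j\<ge>N. norm ((\<integral>z. F j z \<partial>M) - 0) < \<epsilon>"
  proof (intro exI allI impI)
    fix j assume "N \<le> j"
    have "(\<integral>z. F j z \<partial>M) < \<epsilon>" using le[of j] N[OF \<open>N \<le> j\<close>] small by linarith
    moreover have "0 \<le> (\<integral>z. F j z \<partial>M)" using F0 by (intro integral_nonneg_AE) auto
    ultimately show "norm ((\<integral>z. F j z \<partial>M) - 0) < \<epsilon>" by simp
  qed
qed

section \<open>Integrals of the density and of its variation\<close>

context
  fixes \<alpha> p q :: real
  assumes p: "1 \<le> p" and \<alpha>: "0 < \<alpha>" and q: "0 \<le> q"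
begin

text \<open>The integrability extracted from the function space; directions enter the estimates only
  through it, the value of its integral and a sup bound.\<close>

definition finite_osc :: "(real \<Rightarrow> 'a::euclidean_space) \<Rightarrow> bool" where
  "finite_osc v \<longleftrightarrow> velocity v \<and> integrable (strip q) (\<lambda>z. osc v (fst z) (snd z) powr p)"

definition energy :: "(real \<Rightarrow> 'a::euclidean_space) \<Rightarrow> real" where
  "energy v = (\<integral>z. energy_density \<alpha> p v (fst z) (snd z) \<partial>strip q)"

definition energy_var :: "(real \<Rightarrow> 'a::euclidean_space) \<Rightarrow> (real \<Rightarrow> 'a) \<Rightarrow> real" where
  "energy_var v k = (\<integral>z. energy_density_var \<alpha> p v k (fst z) (snd z) \<partial>strip q)"

lemma finite_oscD: "finite_osc v \<Longrightarrow> velocity v"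
  "finite_osc v \<Longrightarrow> integrable (strip q) (\<lambda>z. osc v (fst z) (snd z) powr p)"
  by (auto simp: finite_osc_def)

lemma integrable_far_part:
  assumes "0 < c" "0 < C"
  shows "integrable (strip q) (\<lambda>z. far_part c C (snd z))"
proof (rule integrableI_bounded)
  have "far_part c C \<in> borel_measurable borel" unfolding far_part_def[abs_def] by measurable
  then show "(\<lambda>z. far_part c C (snd z)) \<in> borel_measurable (strip q)" by simp
  show "(\<integral>\<^sup>+z. ennreal (norm (far_part c C (snd z))) \<partial>strip q) < \<infinity>"
    using nn_integral_far_part_finite[OF assms q] by (simp add: far_part_nonneg)
qed

lemma integrable_energy_density:
  assumes v: "nondegenerate c C v" and c: "0 < c" and fin: "finite_osc v"
  shows "integrable (strip q) (\<lambda>z. energy_density \<alpha> p v (fst z) (snd z))"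
proof (rule Bochner_Integration.integrable_bound)
  show "integrable (strip q) (\<lambda>z. (\<alpha> * c powr (-\<alpha> - 1) / (2 * c)) powr p * C\<^sup>2 * osc v (fst z) (snd z) powr p)"
    using finite_oscD(2)[OF fin] by simp
  show "(\<lambda>z. energy_density \<alpha> p v (fst z) (snd z)) \<in> borel_measurable (strip q)"
    using nondegenerate_measurable(1)[OF v c finite_oscD(1)[OF fin]] by simp
  show "AE z in strip q. norm (energy_density \<alpha> p v (fst z) (snd z)) \<le>
      norm ((\<alpha> * c powr (-\<alpha> - 1) / (2 * c)) powr p * C\<^sup>2 * osc v (fst z) (snd z) powr p)"
    using AE_strip_bounds
  proof eventually_elim
    case (elim z)
    then show ?case
      using energy_density_bounds[OF c \<alpha> v _ _ p, of "snd z" "fst z"] by simp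
  qed
qed

text \<open>The case \<open>\<theta> = 1\<close> of \<open>energy_density_var_le\<close>. The
  function \<open>Y\<close> depends on the curve and on \<open>K\<close> but not on the direction,
  which gives a bound for all directions at once.\<close>

lemma energy_density_var_dominated:
  fixes v :: "real \<Rightarrow> 'a::euclidean_space"
  assumes v: "nondegenerate c C v" and c: "0 < c" and fin: "finite_osc v" and K0: "0 \<le> K"
  obtains D Y where "0 \<le> D" "integrable (strip q) Y"
    "\<And>k. finite_osc k \<Longrightarrow> (\<And>x. norm (k x) \<le> K) \<Longrightarrow>
      AE z in strip q. \<bar>energy_density_var \<alpha> p v k (fst z) (snd z)\<bar> \<le> Y z + D * osc k (fst z) (snd z) powr p"
proof -
  obtain D where D: "0 \<le> D"
    "\<And>(v :: real \<Rightarrow> 'a) k \<theta> x w.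
      nondegenerate c C v \<Longrightarrow> velocity k \<Longrightarrow> (\<And>x. norm (k x) \<le> K) \<Longrightarrow>
      \<bar>w\<bar> \<le> 1/2 \<Longrightarrow> w \<noteq> 0 \<Longrightarrow> 0 < \<theta> \<Longrightarrow> \<theta> \<le> 1 \<Longrightarrow>
      \<bar>energy_density_var \<alpha> p v k x w\<bar> \<le>
        D * (1 / \<theta> * (osc v x w + far_part c C w) powr p + \<theta> * osc k x w powr p)"
    using energy_density_var_le[OF c \<alpha> p K0] by blast
  have C: "0 < C" using C_ge[OF v c] c by simp
  \<comment> \<open>The term \<open>0 powr p\<close> is zero; it fits a sum of two terms to the
    inequality for three.\<close>
  define Y where "Y z = D * (3 powr p * (osc v (fst z) (snd z) powr p + 0 powr p + far_part c C (snd z)))" for z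
  show thesis
  proof (rule that)
    show "0 \<le> D" by (rule D(1))
    show "integrable (strip q) Y"
      unfolding Y_def using finite_oscD(2)[OF fin] integrable_far_part[OF c C] by simp
    fix k :: "real \<Rightarrow> 'a" assume k: "finite_osc k" and K: "\<And>x. norm (k x) \<le> K"
    show "AE z in strip q. \<bar>energy_density_var \<alpha> p v k (fst z) (snd z)\<bar> \<le> Y z + D * osc k (fst z) (snd z) powr p"
      using AE_strip_bounds
    proof eventually_elim
      case (elim z)
      define x w where "x = fst z" and "w = snd z"
      have "\<bar>energy_density_var \<alpha> p v k x w\<bar> \<le> D * (1 / 1 * (osc v x w + far_part c C w) powr p + 1 * osc k x w powr p)"
        using D(2)[OF v finite_oscD(1)[OF k] K, of w 1 x] elim by (simp add: w_def)
      also have "\<dots> \<le> D * (3 powr p * (osc v x w powr p + 0 powr p + far_part c C w) + osc k x w powr p)"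
        using powr_sum3_le[of "osc v x w" 0 "far_part c C w" p] p D(1)
          osc_nonneg[OF finite_oscD(1)[OF fin], of x w] far_part_nonneg[of c C w]
        by (intro mult_left_mono add_right_mono) (auto simp: far_part_powr)
      finally show ?case unfolding x_def w_def Y_def by (simp add: distrib_left)
    qed
  qed
qed

lemma integrable_energy_density_var:
  fixes v k :: "real \<Rightarrow> 'a::euclidean_space"
  assumes v: "nondegenerate c C v" and c: "0 < c" and fin: "finite_osc v"
    and k: "finite_osc k" and K: "\<And>x. norm (k x) \<le> K"
  shows "integrable (strip q) (\<lambda>z. energy_density_var \<alpha> p v k (fst z) (snd z))"
proof -
  have K0: "0 \<le> K" using K[of 0] norm_ge_zero order.trans by blast
  obtain D Y where D: "0 \<le> D" and Y: "integrable (strip q) Y"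
    "\<And>k. finite_osc k \<Longrightarrow> (\<And>x. norm (k x) \<le> K) \<Longrightarrow>
      AE z in strip q. \<bar>energy_density_var \<alpha> p v k (fst z) (snd z)\<bar> \<le> Y z + D * osc k (fst z) (snd z) powr p"
    using energy_density_var_dominated[OF v c fin K0] by blast
  show ?thesis
  proof (rule Bochner_Integration.integrable_bound)
    show "integrable (strip q) (\<lambda>z. Y z + D * osc k (fst z) (snd z) powr p)"
      using Y(1) finite_oscD(2)[OF k] by simp
    show "(\<lambda>z. energy_density_var \<alpha> p v k (fst z) (snd z)) \<in> borel_measurable (strip q)"
      using nondegenerate_measurable(2)[OF v c finite_oscD(1)[OF k]] by simp
    show "AE z in strip q. norm (energy_density_var \<alpha> p v k (fst z) (snd z)) \<le> norm (Y z + D * osc k (fst z) (snd z) powr p)"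
      using Y(2)[OF k K] by eventually_elim simp
  qed
qed

text \<open>The bound is stated on a unit ball because it is not homogeneous in \<open>k\<close>;
  linearity converts it into an operator bound later.\<close>

lemma energy_var_bounded:
  fixes v :: "real \<Rightarrow> 'a::euclidean_space"
  assumes v: "nondegenerate c C v" and c: "0 < c" and fin: "finite_osc v" and K0: "0 \<le> K"
  obtains B where "\<And>k. finite_osc k \<Longrightarrow> (\<And>x. norm (k x) \<le> K) \<Longrightarrow>
      (\<integral>z. osc k (fst z) (snd z) powr p \<partial>strip q) \<le> 1 \<Longrightarrow> \<bar>energy_var v k\<bar> \<le> B"
proof -
  obtain D Y where D: "0 \<le> D" and Y: "integrable (strip q) Y"
    "\<And>k. finite_osc k \<Longrightarrow> (\<And>x. norm (k x) \<le> K) \<Longrightarrow>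
      AE z in strip q. \<bar>energy_density_var \<alpha> p v k (fst z) (snd z)\<bar> \<le> Y z + D * osc k (fst z) (snd z) powr p"
    using energy_density_var_dominated[OF v c fin K0] by blast
  show thesis
  proof (rule that)
    fix k :: "real \<Rightarrow> 'a"
    assume k: "finite_osc k" and K: "\<And>x. norm (k x) \<le> K" and osc: "(\<integral>z. osc k (fst z) (snd z) powr p \<partial>strip q) \<le> 1"
    have "\<bar>energy_var v k\<bar> \<le> (\<integral>z. \<bar>energy_density_var \<alpha> p v k (fst z) (snd z)\<bar> \<partial>strip q)"
      unfolding energy_var_def by (rule integral_abs_bound)
    also have "\<dots> \<le> (\<integral>z. Y z + D * osc k (fst z) (snd z) powr p \<partial>strip q)"
      using Y(1) finite_oscD(2)[OF k] integrable_energy_density_var[OF v c fin k K]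
      by (intro integral_mono_AE Y(2)[OF k K]) auto
    also have "\<dots> = (\<integral>z. Y z \<partial>strip q) + D * (\<integral>z. osc k (fst z) (snd z) powr p \<partial>strip q)"
      using Y(1) finite_oscD(2)[OF k] by simp
    also have "\<dots> \<le> (\<integral>z. Y z \<partial>strip q) + D * 1" using osc D by (intro add_left_mono mult_left_mono)
    finally show "\<bar>energy_var v k\<bar> \<le> (\<integral>z. Y z \<partial>strip q) + D * 1" .
  qed
qed

lemma arc_mean_var_add_scaled:
  assumes v: "nondegenerate c C v" and c: "0 < c" and k: "velocity k" and l: "velocity l"
  shows "arc_mean_var v (\<lambda>x. k x + t *\<^sub>R l x) x w = arc_mean_var v k x w + t * arc_mean_var v l x w"
proof -
  have i: "(\<lambda>s. sgn (v (x + s * w)) \<bullet> k (x + s * w)) integrable_on {0..1}"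
    "(\<lambda>s. t * (sgn (v (x + s * w)) \<bullet> l (x + s * w))) integrable_on {0..1}"
    by (intro integrable_continuous_real continuous_on_mult continuous_on_const continuous_on_inner
        cont_sgn_segment[OF v c] velocity_continuous_segment[OF k] velocity_continuous_segment[OF l])+
  show ?thesis
    unfolding arc_mean_var_def inner_add_right inner_scaleR_right
    by (simp only: Henstock_Kurzweil_Integration.integral_add[OF i] integral_mult_right)
qed

text \<open>Each layer of the variation is linear in the direction, and the branch in
  \<open>gap_var\<close> is decided by \<open>v\<close> alone. The bounds on \<open>k\<close> and
  \<open>l\<close> give the integrability that splits the integral.\<close>

lemma energy_var_add_scaled:
  fixes v k l :: "real \<Rightarrow> 'a::euclidean_space"
  assumes v: "nondegenerate c C v" and c: "0 < c" and fin: "finite_osc v"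
    and k: "finite_osc k" and K: "\<And>x. norm (k x) \<le> K" and l: "finite_osc l" and L: "\<And>x. norm (l x) \<le> L"
  shows "energy_var v (\<lambda>x. k x + t *\<^sub>R l x) = energy_var v k + t * energy_var v l"
proof -
  note vk = finite_oscD(1)[OF k] and vl = finite_oscD(1)[OF l]
  note arc = arc_mean_var_add_scaled[OF v c vk vl] and chord = chord_add_scaled[OF vk vl]
  have cp: "chord_powr_var \<alpha> v (\<lambda>x. k x + t *\<^sub>R l x) x w = chord_powr_var \<alpha> v k x w + t * chord_powr_var \<alpha> v l x w" for x w
    by (simp add: chord_powr_var_def chord inner_add_right algebra_simps)
  have co: "coarc_mean_var v (\<lambda>x. k x + t *\<^sub>R l x) x w = coarc_mean_var v k x w + t * coarc_mean_var v l x w" for x w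
    by (simp add: coarc_mean_var_def arc add_divide_distrib algebra_simps)
  have gap: "gap_var \<alpha> v (\<lambda>x. k x + t *\<^sub>R l x) x w = gap_var \<alpha> v k x w + t * gap_var \<alpha> v l x w" for x w
    by (simp add: gap_var_def near_gap_var_def far_gap_var_def arc co cp algebra_simps)
  have sp: "speeds_var v (\<lambda>x. k x + t *\<^sub>R l x) x w = speeds_var v k x w + t * speeds_var v l x w" for x w
    by (simp add: speeds_var_def inner_add_right algebra_simps)
  have "energy_density_var \<alpha> p v (\<lambda>x. k x + t *\<^sub>R l x) x w =
      energy_density_var \<alpha> p v k x w + t * energy_density_var \<alpha> p v l x w" for x w
    by (simp add: energy_density_var_def gap sp algebra_simps)
  then show ?thesis
    unfolding energy_var_def
    using integrable_energy_density_var[OF v c fin k K] integrable_energy_density_var[OF v c fin l L] by simp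
qed

lemma energy_has_derivative_along_line:
  fixes v k :: "real \<Rightarrow> 'a::euclidean_space"
  assumes v: "nondegenerate c C v" and c: "0 < c" and fin: "finite_osc v"
    and k: "finite_osc k" and K: "\<And>x. norm (k x) \<le> K"
    and fin_line: "\<And>t. finite_osc (\<lambda>x. v x + t *\<^sub>R k x)"
  shows "((\<lambda>t. energy (\<lambda>x. v x + t *\<^sub>R k x)) has_real_derivative energy_var v k) (at 0)"
proof -
  have K0: "0 \<le> K" using K[of 0] norm_ge_zero order.trans by blast
  note vel_k = finite_oscD(1)[OF k]
  define c' C' where "c' = c - c / 2" and "C' = C + c / 2"
  have c': "0 < c'" using c by (simp add: c'_def)
  \<comment> \<open>For \<open>\<bar>t\<bar> \<le> t0\<close> the perturbation is at most
    \<open>c / 2\<close>, so the whole segment stays nondegenerate; \<open>t0 \<le> 1\<close> is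
    demanded by the Lipschitz estimate.\<close>
  define t0 where "t0 = min 1 (c / (2 * (K + 1)))"
  have t0: "0 < t0" using c K0 by (simp add: t0_def)
  have nd: "nondegenerate c' C' (\<lambda>x. v x + t *\<^sub>R k x)" if "\<bar>t\<bar> \<le> t0" for t
    unfolding c'_def C'_def
  proof (rule nondegenerate_perturb[OF v vel_k K])
    have "\<bar>t\<bar> * K \<le> c / (2 * (K + 1)) * (K + 1)"
      using that K0 c by (intro mult_mono) (auto simp: t0_def)
    also have "\<dots> = c / 2" using K0 by (simp add: field_simps)
    finally show "\<bar>t\<bar> * K \<le> c / 2" .
  qed
  have v': "nondegenerate c' C' v" using nd[of 0] t0 by simp
  have C': "0 < C'" using C_ge[OF v' c'] c' by simp
  obtain D where D: "0 \<le> D"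
    "\<And>(v :: real \<Rightarrow> 'a) k t x w.
      (\<And>s. \<bar>s\<bar> \<le> \<bar>t\<bar> \<Longrightarrow> nondegenerate c' C' (\<lambda>x. v x + s *\<^sub>R k x)) \<Longrightarrow> velocity k \<Longrightarrow> (\<And>x. norm (k x) \<le> K) \<Longrightarrow>
      \<bar>t\<bar> \<le> 1 \<Longrightarrow> \<bar>w\<bar> \<le> 1/2 \<Longrightarrow> w \<noteq> 0 \<Longrightarrow>
      \<bar>energy_density \<alpha> p (\<lambda>x. v x + t *\<^sub>R k x) x w - energy_density \<alpha> p v x w\<bar> \<le>
        \<bar>t\<bar> * (D * (osc v x w + osc k x w + far_part c' C' w) powr p)"
    using energy_density_lipschitz[OF c' \<alpha> p K0] by blast
  define G where "G z = D * (3 powr p * (osc v (fst z) (snd z) powr p + osc k (fst z) (snd z) powr p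
      + far_part c' C' (snd z)))" for z
  have G: "integrable (strip q) G"
    unfolding G_def using finite_oscD(2)[OF fin] finite_oscD(2)[OF k] integrable_far_part[OF c' C'] by simp
  define e where "e t z = energy_density \<alpha> p (\<lambda>x. v x + t *\<^sub>R k x) (fst z) (snd z)" for t z
  have e_energy: "energy (\<lambda>x. v x + t *\<^sub>R k x) = integral\<^sup>L (strip q) (e t)" for t
    by (simp add: energy_def e_def[abs_def])
  have e_int: "integrable (strip q) (e t)" if "\<bar>t\<bar> \<le> t0" for t
    unfolding e_def by (rule integrable_energy_density[OF nd[OF that] c' fin_line])
  have e_meas: "e t \<in> borel_measurable (strip q)" if "\<bar>t\<bar> \<le> t0" for t
    using e_int[OF that] by auto
  \<comment> \<open>Within the open interval every sequence of increments is admissible from its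
    first term on; openness then gives the unrestricted derivative.\<close>
  have "((\<lambda>t. energy (\<lambda>x. v x + t *\<^sub>R k x)) has_real_derivative energy_var v k) (at 0 within {-t0<..<t0})"
    unfolding has_field_derivative_iff tendsto_at_iff_sequentially
  proof (intro allI impI)
    fix X :: "nat \<Rightarrow> real" assume X: "\<forall>i. X i \<in> {-t0<..<t0} - {0}" and X0: "X \<longlonglongrightarrow> 0"
    have Xt: "\<bar>X i\<bar> \<le> t0" "X i \<noteq> 0" for i using X[rule_format, of i] by auto
    have t00: "\<bar>0\<bar> \<le> t0" using t0 by simp
    have "(\<lambda>i. \<integral>z. (e (X i) z - e 0 z) / X i \<partial>strip q) \<longlonglongrightarrow>
        (\<integral>z. energy_density_var \<alpha> p v k (fst z) (snd z) \<partial>strip q)"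
    proof (rule integral_dominated_convergence)
      show "(\<lambda>z. energy_density_var \<alpha> p v k (fst z) (snd z)) \<in> borel_measurable (strip q)"
        using nondegenerate_measurable(2)[OF v c vel_k] by simp
      show "(\<lambda>z. (e (X i) z - e 0 z) / X i) \<in> borel_measurable (strip q)" for i
        using e_meas[OF Xt(1)] e_meas[OF t00] by simp
      show "integrable (strip q) G" by (rule G)
      show "AE z in strip q. (\<lambda>i. (e (X i) z - e 0 z) / X i) \<longlonglongrightarrow> energy_density_var \<alpha> p v k (fst z) (snd z)"
        using AE_strip_bounds AE_strip_arcs_differ[OF v c]
      proof eventually_elim
        case (elim z)
        have "\<forall>\<^sub>F t in nhds 0. nondegenerate c' C' (\<lambda>x. v x + t *\<^sub>R k x)"
          using eventually_nhds_in_open[of "{-t0<..<t0}" "0::real"] t0 nd by (auto elim!: eventually_mono)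
        then have "((\<lambda>t. e t z) has_real_derivative energy_density_var \<alpha> p v k (fst z) (snd z)) (at 0)"
          unfolding e_def using elim
          by (intro has_real_derivative_energy_density[OF v c \<alpha> vel_k K _ _ _ p _ c']) auto
        then have "((\<lambda>t. (e t z - e 0 z) / (t - 0)) \<longlongrightarrow> energy_density_var \<alpha> p v k (fst z) (snd z)) (at 0)"
          by (simp only: has_field_derivative_iff)
        then have "((\<lambda>t. (e t z - e 0 z) / (t - 0)) \<circ> X) \<longlonglongrightarrow> energy_density_var \<alpha> p v k (fst z) (snd z)"
          using X0 Xt unfolding tendsto_at_iff_sequentially by auto
        then show ?case by (simp add: o_def)
      qed
      show "AE z in strip q. norm ((e (X i) z - e 0 z) / X i) \<le> G z" for i
        using AE_strip_bounds
      proof eventually_elim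
        case (elim z)
        define x w where "x = fst z" and "w = snd z"
        have "\<bar>e (X i) z - e 0 z\<bar> \<le> \<bar>X i\<bar> * (D * (osc v x w + osc k x w + far_part c' C' w) powr p)"
          using D(2)[of "X i" v k w x] elim vel_k K nd Xt(1)[of i] by (simp add: e_def x_def w_def t0_def)
        then have "norm ((e (X i) z - e 0 z) / X i) \<le> D * (osc v x w + osc k x w + far_part c' C' w) powr p"
          using Xt(2)[of i] by (simp add: abs_divide pos_divide_le_eq mult.commute)
        also have "\<dots> \<le> G z"
          unfolding G_def x_def[symmetric] w_def[symmetric]
          using powr_sum3_le[of "osc v x w" "osc k x w" "far_part c' C' w" p] p D(1)
            osc_nonneg[OF finite_oscD(1)[OF fin], of x w] osc_nonneg[OF vel_k, of x w] far_part_nonneg[of c' C' w]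
          by (intro mult_left_mono) (auto simp: far_part_powr)
        finally show ?case .
      qed
    qed
    moreover have "(\<integral>z. (e (X i) z - e 0 z) / X i \<partial>strip q) =
        (energy (\<lambda>x. v x + X i *\<^sub>R k x) - energy (\<lambda>x. v x + 0 *\<^sub>R k x)) / (X i - 0)" for i
      unfolding e_energy using Bochner_Integration.integral_diff[OF e_int[OF Xt(1)] e_int[OF t00], of i] by simp
    ultimately show "((\<lambda>t. (energy (\<lambda>x. v x + t *\<^sub>R k x) - energy (\<lambda>x. v x + 0 *\<^sub>R k x)) / (t - 0)) \<circ> X)
        \<longlonglongrightarrow> energy_var v k"
      by (simp only: o_def energy_var_def)
  qed
  moreover have "at 0 within {-t0<..<t0} = at (0::real)" using t0 by (intro at_within_open) auto
  ultimately show ?thesis by simp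
qed

text \<open>The majorant for \<open>u j\<close> moves with \<open>j\<close>, so
  \<open>osc (u j)\<close> is replaced by the fixed \<open>osc v\<close> and the oscillation of
  \<open>u j - v\<close>. These play the parts of \<open>Y\<close> and \<open>Z\<close> in
  \<open>integral_tendsto_zero_of_split_bound\<close>, and the directions give
  \<open>W\<close>.\<close>

lemma energy_var_tendsto:
  fixes v :: "real \<Rightarrow> 'a::euclidean_space" and u k :: "nat \<Rightarrow> real \<Rightarrow> 'a"
  assumes c: "0 < c" and v: "nondegenerate c C v" and fin_v: "finite_osc v"
    and u: "\<And>j. nondegenerate c C (u j)" and fin_u: "\<And>j. finite_osc (u j)"
    and \<delta>: "\<delta> \<longlonglongrightarrow> 0" and uv: "\<And>j x. norm (u j x - v x) \<le> \<delta> j"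
    and fin_d: "\<And>j. finite_osc (\<lambda>x. u j x - v x)"
    and lim_d: "(\<lambda>j. \<integral>z. osc (\<lambda>x. u j x - v x) (fst z) (snd z) powr p \<partial>strip q) \<longlonglongrightarrow> 0"
    and k: "\<And>j. finite_osc (k j)" and K: "\<And>j x. norm (k j x) \<le> K"
    and B: "\<And>j. (\<integral>z. osc (k j) (fst z) (snd z) powr p \<partial>strip q) \<le> B"
  shows "(\<lambda>j. energy_var (u j) (k j) - energy_var v (k j)) \<longlonglongrightarrow> 0"
proof -
  have K0: "0 \<le> K" using K[of 0 0] norm_ge_zero order.trans by blast
  have C: "0 < C" using C_ge[OF v c] c by simp
  obtain D where D: "0 \<le> D"
    "\<And>(v :: real \<Rightarrow> 'a) k \<theta> x w.
      nondegenerate c C v \<Longrightarrow> velocity k \<Longrightarrow> (\<And>x. norm (k x) \<le> K) \<Longrightarrow>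
      \<bar>w\<bar> \<le> 1/2 \<Longrightarrow> w \<noteq> 0 \<Longrightarrow> 0 < \<theta> \<Longrightarrow> \<theta> \<le> 1 \<Longrightarrow>
      \<bar>energy_density_var \<alpha> p v k x w\<bar> \<le>
        D * (1 / \<theta> * (osc v x w + far_part c C w) powr p + \<theta> * osc k x w powr p)"
    using energy_density_var_le[OF c \<alpha> p K0] by blast
  define F where "F j z = \<bar>energy_density_var \<alpha> p (u j) (k j) (fst z) (snd z) -
      energy_density_var \<alpha> p v (k j) (fst z) (snd z)\<bar>" for j z
  \<comment> \<open>The factor 2 counts the two variations, \<open>3 powr p\<close> comes from the
    three-term inequality and \<open>2 powr p\<close> from the oscillation of a sum.
    \<open>E \<ge> 2\<close> also covers the doubled \<theta> term.\<close>
  define E where "E = 2 * 3 powr p * 2 powr p"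
  have E: "2 \<le> E"
  proof -
    have "1 * 1 \<le> 3 powr p * 2 powr p" using p by (intro mult_mono ge_one_powr_ge_zero) auto
    then show ?thesis by (simp add: E_def)
  qed
  have intF: "integrable (strip q) (\<lambda>z. energy_density_var \<alpha> p (u j) (k j) (fst z) (snd z) -
      energy_density_var \<alpha> p v (k j) (fst z) (snd z))" for j
    by (intro Bochner_Integration.integrable_diff integrable_energy_density_var[OF u c fin_u k K]
        integrable_energy_density_var[OF v c fin_v k K])
  have "(\<lambda>j. \<integral>z. F j z \<partial>strip q) \<longlonglongrightarrow> 0"
  proof (rule integral_tendsto_zero_of_split_bound[where D = "D * E" and B = B
        and Y = "\<lambda>z. osc v (fst z) (snd z) powr p + far_part c C (snd z)"
        and Z = "\<lambda>j z. osc (\<lambda>x. u j x - v x) (fst z) (snd z) powr p"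
        and W = "\<lambda>j z. osc (k j) (fst z) (snd z) powr p"])
    show "F j \<in> borel_measurable (strip q)" for j
      unfolding F_def using borel_measurable_integrable[OF intF[of j]] by measurable
    show "AE z in strip q. (\<lambda>j. F j z) \<longlonglongrightarrow> 0"
      using AE_strip_bounds AE_strip_arcs_differ[OF v c]
    proof eventually_elim
      case (elim z)
      have "(\<lambda>j. energy_density_var \<alpha> p (u j) (k j) (fst z) (snd z) -
          energy_density_var \<alpha> p v (k j) (fst z) (snd z)) \<longlonglongrightarrow> 0"
        using elim by (intro tendsto_energy_density_var[OF c \<alpha> p v u \<delta> uv finite_oscD(1)[OF k] K]) auto
      from tendsto_rabs[OF this] show ?case by (simp add: F_def)
    qed
    fix j and \<theta> :: real assume th: "0 < \<theta>" "\<theta> \<le> 1"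
    show "AE z in strip q. F j z \<le> D * E * (1 / \<theta> * (osc v (fst z) (snd z) powr p + far_part c C (snd z) +
        osc (\<lambda>x. u j x - v x) (fst z) (snd z) powr p) + \<theta> * osc (k j) (fst z) (snd z) powr p)"
      using AE_strip_bounds
    proof eventually_elim
      case (elim z)
      define x w where "x = fst z" and "w = snd z"
      define a where "a = osc v x w"
      define d where "d = osc (\<lambda>x. u j x - v x) x w"
      define f where "f = far_part c C w"
      define b where "b = osc (k j) x w powr p"
      have nn: "0 \<le> a" "0 \<le> d" "0 \<le> f" "0 \<le> b"
        using osc_nonneg[OF finite_oscD(1)[OF fin_v], of x w] osc_nonneg[OF finite_oscD(1)[OF fin_d], of j x w]
          far_part_nonneg[of c C w] by (auto simp: a_def d_def f_def b_def)
      have up: "osc (u j) x w \<le> 2 * a + 2 * d"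
        using osc_add_scaled_le[OF finite_oscD(1)[OF fin_v] finite_oscD(1)[OF fin_d], of 1 j x w]
        by (simp add: a_def d_def)
      have sum: "(2 * a + 2 * d + f) powr p \<le> E / 2 * (a powr p + f + d powr p)"
      proof -
        have "(2 * a + 2 * d + f) powr p \<le> 3 powr p * ((2 * a) powr p + (2 * d) powr p + f powr p)"
          using nn p by (intro powr_sum3_le) auto
        also have "\<dots> \<le> 3 powr p * (2 powr p * a powr p + 2 powr p * d powr p + 2 powr p * f)"
          using nn p mult_right_mono[OF ge_one_powr_ge_zero[of 2 p], of f]
          by (intro mult_left_mono add_mono) (auto simp: powr_mult f_def far_part_powr)
        finally show ?thesis by (simp add: E_def algebra_simps)
      qed
      have 1: "\<bar>energy_density_var \<alpha> p (u j) (k j) x w\<bar> \<le> D * (1 / \<theta> * (E / 2 * (a powr p + f + d powr p)) + \<theta> * b)"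
      proof -
        have "\<bar>energy_density_var \<alpha> p (u j) (k j) x w\<bar> \<le> D * (1 / \<theta> * (osc (u j) x w + f) powr p + \<theta> * b)"
          unfolding b_def f_def using D(2)[OF u finite_oscD(1)[OF k] K, of w \<theta> j j x] elim th by (simp add: w_def)
        also have "\<dots> \<le> D * (1 / \<theta> * (E / 2 * (a powr p + f + d powr p)) + \<theta> * b)"
        proof (intro mult_left_mono add_right_mono D(1))
          have "(osc (u j) x w + f) powr p \<le> (2 * a + 2 * d + f) powr p"
            using osc_nonneg[OF finite_oscD(1)[OF fin_u], of j x w] nn up p by (intro powr_mono2) auto
          also note sum
          finally show "(osc (u j) x w + f) powr p \<le> E / 2 * (a powr p + f + d powr p)" .
        qed (use th in auto)
        finally show ?thesis .
      qed
      have 2: "\<bar>energy_density_var \<alpha> p v (k j) x w\<bar> \<le> D * (1 / \<theta> * (E / 2 * (a powr p + f + d powr p)) + \<theta> * b)"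
      proof -
        have "\<bar>energy_density_var \<alpha> p v (k j) x w\<bar> \<le> D * (1 / \<theta> * (a + f) powr p + \<theta> * b)"
          unfolding b_def f_def a_def using D(2)[OF v finite_oscD(1)[OF k] K, of w \<theta> j x] elim th by (simp add: w_def)
        also have "\<dots> \<le> D * (1 / \<theta> * (E / 2 * (a powr p + f + d powr p)) + \<theta> * b)"
          by (intro mult_left_mono add_right_mono order.trans[OF _ sum] powr_mono2) (use nn D th p in auto)
        finally show ?thesis .
      qed
      have "F j z \<le> 2 * (D * (1 / \<theta> * (E / 2 * (a powr p + f + d powr p)) + \<theta> * b))"
        using 1 2 unfolding F_def x_def[symmetric] w_def[symmetric] by linarith
      also have "\<dots> = D * (E * (1 / \<theta> * (a powr p + f + d powr p)) + 2 * (\<theta> * b))" by (simp add: algebra_simps)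
      also have "\<dots> \<le> D * (E * (1 / \<theta> * (a powr p + f + d powr p)) + E * (\<theta> * b))"
        using D(1) E nn th by (intro mult_left_mono add_left_mono mult_right_mono) auto
      also have "\<dots> = D * E * (1 / \<theta> * (a powr p + f + d powr p) + \<theta> * b)" by (simp only: distrib_left mult.assoc)
      finally show ?case unfolding a_def d_def f_def b_def x_def w_def .
    qed
  qed (use D E finite_oscD(2)[OF fin_v] integrable_far_part[OF c C] finite_oscD(2)[OF fin_d] finite_oscD(2)[OF k]
      lim_d B far_part_nonneg in \<open>auto simp: F_def\<close>)
  then have "(\<lambda>j. \<bar>\<integral>z. energy_density_var \<alpha> p (u j) (k j) (fst z) (snd z) -
      energy_density_var \<alpha> p v (k j) (fst z) (snd z) \<partial>strip q\<bar>) \<longlonglongrightarrow> 0"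
    by (rule tendsto_sandwich[OF _ _ tendsto_const, rotated 2]) (auto simp: F_def intro!: integral_abs_bound always_eventually)
  then have "(\<lambda>j. \<integral>z. energy_density_var \<alpha> p (u j) (k j) (fst z) (snd z) -
      energy_density_var \<alpha> p v (k j) (fst z) (snd z) \<partial>strip q) \<longlonglongrightarrow> 0"
    by (simp only: tendsto_rabs_zero_iff)
  then show ?thesis
    unfolding energy_var_def
    by (subst Bochner_Integration.integral_diff[symmetric])
       (auto intro: integrable_energy_density_var[OF u c fin_u k K] integrable_energy_density_var[OF v c fin_v k K])
qed

end

section \<open>Weak derivatives of continuous functions\<close>

text \<open>A quadratic B-spline step from 0 at -1 to 1 at 1, whose derivative is the hat function:
  continuously differentiable, exactly as much as a test function must be.\<close>

definition spline_step :: "real \<Rightarrow> real" where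
  "spline_step y = ((max 0 (y + 1))\<^sup>2 - 2 * (max 0 y)\<^sup>2 + (max 0 (y - 1))\<^sup>2) / 2"

definition spline_hat :: "real \<Rightarrow> real" where
  "spline_hat y = max 0 (y + 1) - 2 * max 0 y + max 0 (y - 1)"

lemma has_real_derivative_max_squared:
  "((\<lambda>y::real. (max 0 y)\<^sup>2) has_real_derivative 2 * max 0 y) (at y)"
proof (cases y "0::real" rule: linorder_cases)
  case less
  have "((\<lambda>y::real. (max 0 y)\<^sup>2) has_real_derivative 0) (at y)"
    by (rule has_field_derivative_transform_within_open[of "\<lambda>_. 0" _ _ "{..<0}"]) (use less in auto)
  then show ?thesis using less by simp
next
  case equal
  have "((\<lambda>y::real. (max 0 y)\<^sup>2) has_real_derivative 0) (at 0)"
    by (rule has_real_derivative_from_quadratic_bound[where M = 1]) (auto simp: max_def)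
  then show ?thesis using equal by simp
next
  case greater
  have "((\<lambda>y::real. (max 0 y)\<^sup>2) has_real_derivative 2 * y) (at y)"
    by (rule has_field_derivative_transform_within_open[of "\<lambda>y. y\<^sup>2" _ _ "{0<..}"])
       (use greater in \<open>auto intro!: derivative_eq_intros\<close>)
  then show ?thesis using greater by simp
qed

lemma has_real_derivative_spline_step: "(spline_step has_real_derivative spline_hat y) (at y)"
proof -
  have shift: "((\<lambda>y::real. (max 0 (y + a))\<^sup>2) has_real_derivative 2 * max 0 (y + a)) (at y)" for a
    using DERIV_shift[of "\<lambda>y::real. (max 0 y)\<^sup>2" "2 * max 0 (y + a)" y a]
      has_real_derivative_max_squared[of "y + a"] by simp
  show ?thesis
    unfolding spline_step_def[abs_def] spline_hat_def
    using DERIV_cdivide[OF DERIV_add[OF DERIV_diff[OF shift[of 1] DERIV_cmult[OF shift[of 0], of 2]] shift[of "-1"]], of 2]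
    by (simp add: add_divide_distrib diff_divide_distrib)
qed

lemma continuous_on_spline_hat: "continuous_on S spline_hat"
  unfolding spline_hat_def[abs_def] by (intro continuous_intros)

lemma spline_hat_nonneg: "0 \<le> spline_hat y" and spline_hat_outside: "1 \<le> \<bar>y\<bar> \<Longrightarrow> spline_hat y = 0"
  by (auto simp: spline_hat_def max_def abs_if split: if_splits)

lemma spline_step_left: "y \<le> -1 \<Longrightarrow> spline_step y = 0"
  and spline_step_right: "1 \<le> y \<Longrightarrow> spline_step y = 1"
  by (auto simp: spline_step_def max_def power2_eq_square algebra_simps)

lemma spline_step_bounds: "0 \<le> spline_step y" "spline_step y \<le> 1"
proof -
  have mono: "spline_step a \<le> spline_step b" if "a \<le> b" for a b
    using that by (rule DERIV_nonneg_imp_nondecreasing) (use has_real_derivative_spline_step spline_hat_nonneg in blast)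
  show "0 \<le> spline_step y" using mono[of "min y (-1)" y] by (simp add: spline_step_left)
  show "spline_step y \<le> 1" using mono[of y "max y 1"] by (simp add: spline_step_right)
qed

text \<open>Rescaled hats form an approximate identity. The substitution moves \<open>n\<close> into
  the argument of \<open>f\<close>; as the hat vanishes outside \<open>{-1..1}\<close>, a bound of
  \<open>f\<close> on \<open>{a - 1..a + 1}\<close> dominates.\<close>

lemma integral_spline_hat_approx:
  fixes f :: "real \<Rightarrow> 'a::euclidean_space"
  assumes f: "continuous_on UNIV f"
  shows "(\<lambda>n. \<integral>x. (real (Suc n) * spline_hat (real (Suc n) * (x - a))) *\<^sub>R f x \<partial>lborel) \<longlonglongrightarrow> f a"
proof -
  have [measurable]: "f \<in> borel_measurable borel" "spline_hat \<in> borel_measurable borel"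
    using f continuous_on_spline_hat by (auto intro: borel_measurable_continuous_onI)
  have eq: "(\<integral>x. (real (Suc n) * spline_hat (real (Suc n) * (x - a))) *\<^sub>R f x \<partial>lborel) =
      (\<integral>y. spline_hat y *\<^sub>R f (a + 1 / real (Suc n) * y) \<partial>lborel)" for n
  proof -
    have "(\<integral>x. (real (Suc n) * spline_hat (real (Suc n) * (x - a))) *\<^sub>R f x \<partial>lborel) =
      \<bar>1 / real (Suc n)\<bar> *\<^sub>R (\<integral>y. (real (Suc n) * spline_hat (real (Suc n) * (a + 1 / real (Suc n) * y - a))) *\<^sub>R
        f (a + 1 / real (Suc n) * y) \<partial>lborel)"
      by (rule lborel_integral_real_affine) simp
    also have "\<dots> = (\<integral>y. \<bar>1 / real (Suc n)\<bar> *\<^sub>R ((real (Suc n) * spline_hat (real (Suc n) * (a + 1 / real (Suc n) * y - a))) *\<^sub>R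
        f (a + 1 / real (Suc n) * y)) \<partial>lborel)"
      by (simp only: integral_scaleR_right)
    also have "\<dots> = (\<integral>y. spline_hat y *\<^sub>R f (a + 1 / real (Suc n) * y) \<partial>lborel)"
      by (intro Bochner_Integration.integral_cong) (auto simp del: of_nat_Suc)
    finally show ?thesis .
  qed
  have hat_int: "has_bochner_integral lborel (\<lambda>y. indicator {-1..1} y *\<^sub>R spline_hat y) (spline_step 1 - spline_step (-1))"
    using has_real_derivative_spline_step continuous_on_spline_hat
    by (intro has_bochner_integral_FTC_Icc)
       (auto simp flip: has_real_derivative_iff_has_vector_derivative intro: has_field_derivative_at_within)
  have ind: "indicator {-1..1} y *\<^sub>R spline_hat y = spline_hat y" for y
    using spline_hat_outside[of y] by (cases "1 \<le> \<bar>y\<bar>") (auto simp: indicator_def)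
  have hat: "integrable lborel spline_hat" "integral\<^sup>L lborel spline_hat = 1"
    using hat_int unfolding ind by (auto simp: has_bochner_integral_iff spline_step_left spline_step_right)
  obtain B where B: "\<And>x. x \<in> {a - 1..a + 1} \<Longrightarrow> norm (f x) \<le> B"
  proof -
    have "bounded (f ` {a - 1..a + 1})"
      by (intro compact_imp_bounded compact_continuous_image continuous_on_subset[OF f]) auto
    then obtain B where "\<forall>x\<in>f ` {a - 1..a + 1}. norm x \<le> B" unfolding bounded_iff by blast
    then show ?thesis by (intro that[of B]) blast
  qed
  have "(\<lambda>n. \<integral>y. spline_hat y *\<^sub>R f (a + 1 / real (Suc n) * y) \<partial>lborel) \<longlonglongrightarrow> (\<integral>y. spline_hat y *\<^sub>R f a \<partial>lborel)"
  proof (rule integral_dominated_convergence)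
    show "integrable lborel (\<lambda>y. spline_hat y * B)" using hat by simp
    show "AE y in lborel. (\<lambda>n. spline_hat y *\<^sub>R f (a + 1 / real (Suc n) * y)) \<longlonglongrightarrow> spline_hat y *\<^sub>R f a"
    proof (rule AE_I2)
      fix y
      have "(\<lambda>n. a + 1 / real (Suc n) * y) \<longlonglongrightarrow> a + 0 * y"
        by (intro tendsto_intros LIMSEQ_Suc lim_1_over_n)
      then have "(\<lambda>n. f (a + 1 / real (Suc n) * y)) \<longlonglongrightarrow> f a"
        using f by (auto intro!: isCont_tendsto_compose[of a f] simp: continuous_on_eq_continuous_at)
      then show "(\<lambda>n. spline_hat y *\<^sub>R f (a + 1 / real (Suc n) * y)) \<longlonglongrightarrow> spline_hat y *\<^sub>R f a"
        by (intro tendsto_intros)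
    qed
    show "AE y in lborel. norm (spline_hat y *\<^sub>R f (a + 1 / real (Suc n) * y)) \<le> spline_hat y * B" for n
    proof (rule AE_I2)
      fix y
      show "norm (spline_hat y *\<^sub>R f (a + 1 / real (Suc n) * y)) \<le> spline_hat y * B"
      proof (cases "1 \<le> \<bar>y\<bar>")
        case False
        have "\<bar>1 / real (Suc n) * y\<bar> \<le> 1 * 1" unfolding abs_mult using False by (intro mult_mono) auto
        then have "a + 1 / real (Suc n) * y \<in> {a - 1..a + 1}"
          unfolding abs_le_iff atLeastAtMost_iff by linarith
        then have "norm (f (a + 1 / real (Suc n) * y)) \<le> B" by (rule B)
        then show ?thesis using spline_hat_nonneg[of y] by (simp add: mult_left_mono)
      qed (simp add: spline_hat_outside)
    qed
  qed auto
  also have "(\<integral>y. spline_hat y *\<^sub>R f a \<partial>lborel) = f a" using hat by simp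
  finally show ?thesis by (simp only: eq)
qed

lemma locally_integrable_measurable:
  assumes "locally_integrable g"
  shows "g \<in> borel_measurable borel"
proof (rule borel_measurable_LIMSEQ_metric)
  show "(\<lambda>x. indicator {- real n..real n} x *\<^sub>R g x) \<in> borel_measurable borel" for n
    using borel_measurable_integrable[OF assms[unfolded locally_integrable_def set_integrable_def, rule_format]]
    by simp
  fix x :: real
  obtain N :: nat where N: "\<bar>x\<bar> \<le> real N" using real_arch_simple by blast
  have "\<forall>\<^sub>F n in sequentially. indicator {- real n..real n} x *\<^sub>R g x = g x"
    using eventually_ge_at_top[of N]
  proof eventually_elim
    case (elim n)
    then have "\<bar>x\<bar> \<le> real n" using N by simp
    then show ?case by (auto simp: indicator_def abs_le_iff)
  qed
  then show "(\<lambda>n. indicator {- real n..real n} x *\<^sub>R g x) \<longlonglongrightarrow> g x" by (rule tendsto_eventually)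
qed

lemma locally_integrable_bounded_mult:
  fixes g :: "real \<Rightarrow> 'a::euclidean_space"
  assumes g: "locally_integrable g" and \<phi>[measurable]: "\<phi> \<in> borel_measurable borel"
    and supp: "\<And>x. r < \<bar>x\<bar> \<Longrightarrow> \<phi> x = 0" and bd: "\<And>x. \<bar>\<phi> x\<bar> \<le> B"
  shows "integrable lborel (\<lambda>x. \<phi> x *\<^sub>R g x)"
proof (rule Bochner_Integration.integrable_bound)
  have "set_integrable lborel {-r..r} g" using g by (simp add: locally_integrable_def)
  then show "integrable lborel (\<lambda>x. B *\<^sub>R (indicator {-r..r} x *\<^sub>R g x))"
    unfolding set_integrable_def by (intro integrable_scaleR_right)
  have [measurable]: "g \<in> borel_measurable borel" by (rule locally_integrable_measurable[OF g])
  show "(\<lambda>x. \<phi> x *\<^sub>R g x) \<in> borel_measurable lborel" by simp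
  show "AE x in lborel. norm (\<phi> x *\<^sub>R g x) \<le> norm (B *\<^sub>R (indicator {-r..r} x *\<^sub>R g x))"
  proof (rule AE_I2)
    fix x
    show "norm (\<phi> x *\<^sub>R g x) \<le> norm (B *\<^sub>R (indicator {-r..r} x *\<^sub>R g x))"
    proof (cases "r < \<bar>x\<bar>")
      case False
      then have "x \<in> {-r..r}" by auto
      moreover have "\<bar>\<phi> x\<bar> \<le> \<bar>B\<bar>" using bd[of x] by linarith
      ultimately show ?thesis by (simp add: mult_right_mono)
    qed (simp add: supp)
  qed
qed

text \<open>Test against the difference of two steepening steps, located at \<open>a\<close> and at
  \<open>b\<close>. It tends to the indicator of the interval, while its derivative is a difference
  of two approximate identities and picks out \<open>f a - f b\<close>.\<close>

lemma weak_derivative_integral: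
  fixes f g :: "real \<Rightarrow> 'a::euclidean_space"
  assumes fg: "has_weak_derivative f g" and f: "continuous_on UNIV f" and ab: "a \<le> b"
  shows "(LINT x:{a..b}|lborel. g x) = f b - f a"
proof (cases "a = b")
  case True
  have "(LINT x:{b..b}|lborel. g x) = (\<integral>x. 0 \<partial>(lborel::real measure))"
    unfolding set_lebesgue_integral_def
  proof (rule integral_cong_AE)
    show "(\<lambda>x. indicator {b..b} x *\<^sub>R g x) \<in> borel_measurable lborel"
      using locally_integrable_measurable[of g] fg by (auto simp: has_weak_derivative_def)
    show "AE x in lborel. indicator {b..b} x *\<^sub>R g x = 0"
      using AE_lborel_singleton[of b] by eventually_elim (auto simp: indicator_def)
  qed simp
  then show ?thesis using True by simp
next
  case False
  then have ab: "a < b" using ab by simp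
  have locg: "locally_integrable g" and locf: "locally_integrable f"
    using fg by (auto simp: has_weak_derivative_def)
  have [measurable]: "g \<in> borel_measurable borel" by (rule locally_integrable_measurable[OF locg])
  have [measurable]: "spline_step \<in> borel_measurable borel"
    using has_real_derivative_spline_step
    by (intro borel_measurable_continuous_onI DERIV_continuous_on) blast
  have [measurable]: "spline_hat \<in> borel_measurable borel"
    using continuous_on_spline_hat by (auto intro: borel_measurable_continuous_onI)
  define \<phi> where "\<phi> n x = spline_step (real (Suc n) * (x - a)) - spline_step (real (Suc n) * (x - b))" for n x
  define \<phi>' where "\<phi>' n x = real (Suc n) * spline_hat (real (Suc n) * (x - a)) - real (Suc n) * spline_hat (real (Suc n) * (x - b))" for n x
  \<comment> \<open>One radius for all \<open>n\<close>: scaling by \<open>n + 1\<close> only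
    narrows the transition zones around \<open>a\<close> and \<open>b\<close>.\<close>
  define r where "r = \<bar>a\<bar> + \<bar>b\<bar> + 1"
  have far_neg: "real (Suc n) * (x - y) \<le> -1" if "\<bar>y\<bar> \<le> \<bar>a\<bar> + \<bar>b\<bar>" "r < \<bar>x\<bar>" "x \<le> 0" for n x y
  proof -
    have "1 * 1 \<le> real (Suc n) * (y - x)" using that by (intro mult_mono) (auto simp: r_def)
    then show ?thesis unfolding right_diff_distrib by linarith
  qed
  have far_pos: "1 \<le> real (Suc n) * (x - y)" if "\<bar>y\<bar> \<le> \<bar>a\<bar> + \<bar>b\<bar>" "r < \<bar>x\<bar>" "0 \<le> x" for n x y
  proof -
    have "1 * 1 \<le> real (Suc n) * (x - y)" using that by (intro mult_mono) (auto simp: r_def)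
    then show ?thesis by simp
  qed
  have far: "1 \<le> \<bar>real (Suc n) * (x - y)\<bar>" if "\<bar>y\<bar> \<le> \<bar>a\<bar> + \<bar>b\<bar>" "r < \<bar>x\<bar>" for n x y
    using far_neg[OF that, of n] far_pos[OF that, of n] by linarith
  have supp: "\<phi> n x = 0" if "r < \<bar>x\<bar>" for n x
  proof (cases "x \<le> 0")
    case True
    have "real (Suc n) * (x - a) \<le> -1" "real (Suc n) * (x - b) \<le> -1"
      using far_neg that True by auto
    then show ?thesis by (simp only: \<phi>_def spline_step_left)
  next
    case False
    have "1 \<le> real (Suc n) * (x - a)" "1 \<le> real (Suc n) * (x - b)"
      using far_pos that False by auto
    then show ?thesis by (simp only: \<phi>_def spline_step_right)
  qed
  have bd: "\<bar>\<phi> n x\<bar> \<le> 1" for n x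
    using spline_step_bounds[of "real (Suc n) * (x - a)"] spline_step_bounds[of "real (Suc n) * (x - b)"]
    unfolding \<phi>_def by linarith
  have test: "test_fun (\<phi> n) (\<phi>' n)" for n
    unfolding test_fun_def
  proof (intro conjI allI)
    fix x
    have "((\<lambda>x. spline_step (real (Suc n) * (x - y))) has_real_derivative
        spline_hat (real (Suc n) * (x - y)) * real (Suc n)) (at x)" for y
      by (rule DERIV_chain2[OF has_real_derivative_spline_step]) (auto intro!: derivative_eq_intros)
    then show "(\<phi> n has_real_derivative \<phi>' n x) (at x)"
      unfolding \<phi>_def[abs_def] \<phi>'_def by (auto intro!: DERIV_diff simp: mult.commute)
    show "continuous_on UNIV (\<phi>' n)"
      unfolding \<phi>'_def[abs_def]
      by (intro continuous_intros continuous_on_compose2[OF continuous_on_spline_hat[of UNIV]]) auto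
    show "\<exists>r. \<forall>x. r < \<bar>x\<bar> \<longrightarrow> \<phi> n x = 0" using supp by blast
  qed
  have hat_int: "integrable lborel (\<lambda>x. (real (Suc n) * spline_hat (real (Suc n) * (x - y))) *\<^sub>R f x)"
    if "\<bar>y\<bar> \<le> \<bar>a\<bar> + \<bar>b\<bar>" for n y
  proof (rule locally_integrable_bounded_mult[OF locf])
    show "real (Suc n) * spline_hat (real (Suc n) * (x - y)) = 0" if "r < \<bar>x\<bar>" for x
      using far[OF \<open>\<bar>y\<bar> \<le> \<bar>a\<bar> + \<bar>b\<bar>\<close> that, of n] by (simp add: spline_hat_outside)
    have "\<bar>spline_hat z\<bar> \<le> 1" for z by (auto simp: spline_hat_def max_def)
    then show "\<bar>real (Suc n) * spline_hat (real (Suc n) * (x - y))\<bar> \<le> real (Suc n)" for x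
      unfolding abs_mult by (simp add: mult_left_le)
  qed auto
  have "(\<integral>x. \<phi>' n x *\<^sub>R f x \<partial>lborel) = (\<integral>x. (real (Suc n) * spline_hat (real (Suc n) * (x - a))) *\<^sub>R f x \<partial>lborel) -
      (\<integral>x. (real (Suc n) * spline_hat (real (Suc n) * (x - b))) *\<^sub>R f x \<partial>lborel)" for n
    unfolding \<phi>'_def scaleR_left_diff_distrib
    by (rule Bochner_Integration.integral_diff) (auto intro!: hat_int simp del: of_nat_Suc)
  then have lim1: "(\<lambda>n. \<integral>x. \<phi>' n x *\<^sub>R f x \<partial>lborel) \<longlonglongrightarrow> f a - f b"
    using tendsto_diff[OF integral_spline_hat_approx[OF f, of a] integral_spline_hat_approx[OF f, of b]]
    by presburger
  have lim2: "(\<lambda>n. \<integral>x. \<phi> n x *\<^sub>R g x \<partial>lborel) \<longlonglongrightarrow> (\<integral>x. indicator {a..b} x *\<^sub>R g x \<partial>lborel)"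
  proof (rule integral_dominated_convergence)
    have "set_integrable lborel {-r..r} g" using locg by (simp add: locally_integrable_def)
    then show "integrable lborel (\<lambda>x. norm (indicator {-r..r} x *\<^sub>R g x))"
      unfolding set_integrable_def by (rule integrable_norm)
    show "AE x in lborel. norm (\<phi> n x *\<^sub>R g x) \<le> norm (indicator {-r..r} x *\<^sub>R g x)" for n
    proof (rule AE_I2)
      fix x
      show "norm (\<phi> n x *\<^sub>R g x) \<le> norm (indicator {-r..r} x *\<^sub>R g x)"
      proof (cases "r < \<bar>x\<bar>")
        case False
        then have "x \<in> {-r..r}" by auto
        then show ?thesis using bd[of n x] by (simp add: mult_left_le_one_le)
      qed (simp add: supp)
    qed
    have step_pos: "(\<lambda>n. spline_step (real (Suc n) * y)) \<longlonglongrightarrow> 1" if pos: "0 < y" for y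
    proof (rule tendsto_eventually)
      obtain N where N: "1 < real N * y" using reals_Archimedean3[OF pos] by auto
      show "\<forall>\<^sub>F n in sequentially. spline_step (real (Suc n) * y) = 1"
        using eventually_ge_at_top[of N]
      proof eventually_elim
        case (elim n)
        have "real N * y \<le> real (Suc n) * y" using elim pos by (intro mult_right_mono) auto
        then show ?case using N by (intro spline_step_right) simp
      qed
    qed
    have step_neg: "(\<lambda>n. spline_step (real (Suc n) * y)) \<longlonglongrightarrow> 0" if neg: "y < 0" for y
    proof (rule tendsto_eventually)
      obtain N where N: "1 < real N * (-y)" using reals_Archimedean3[OF iffD2[OF neg_0_less_iff_less neg]] by blast
      show "\<forall>\<^sub>F n in sequentially. spline_step (real (Suc n) * y) = 0"
        using eventually_ge_at_top[of N]
      proof eventually_elim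
        case (elim n)
        have "real N * (-y) \<le> real (Suc n) * (-y)" using elim neg by (intro mult_right_mono) auto
        then show ?case using N by (intro spline_step_left) simp
      qed
    qed
    show "AE x in lborel. (\<lambda>n. \<phi> n x *\<^sub>R g x) \<longlonglongrightarrow> indicator {a..b} x *\<^sub>R g x"
      \<comment> \<open>At its centre the step has the value 1/2 for every \<open>n\<close>, so the
        endpoints are discarded.\<close>
      using AE_lborel_singleton[of a] AE_lborel_singleton[of b]
    proof eventually_elim
      case (elim x)
      have lim_step: "(\<lambda>n. spline_step (real (Suc n) * (x - y))) \<longlonglongrightarrow> (if y < x then 1 else 0)" if "x \<noteq> y" for y
        using step_pos[of "x - y"] step_neg[of "x - y"] that by auto
      have "(\<lambda>n. \<phi> n x *\<^sub>R g x) \<longlonglongrightarrow> ((if a < x then 1 else 0) - (if b < x then 1 else 0)) *\<^sub>R g x"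
        unfolding \<phi>_def using elim by (intro tendsto_scaleR tendsto_diff lim_step tendsto_const)
      moreover have "((if a < x then 1 else 0) - (if b < x then 1 else 0)) = (indicator {a..b} x :: real)"
        using elim ab by (auto simp: indicator_def)
      ultimately show ?case by simp
    qed
  qed (auto simp: \<phi>_def)
  have "(\<lambda>n. \<integral>x. \<phi>' n x *\<^sub>R f x \<partial>lborel) \<longlonglongrightarrow> - (\<integral>x. indicator {a..b} x *\<^sub>R g x \<partial>lborel)"
  proof -
    have "(\<integral>x. \<phi>' n x *\<^sub>R f x \<partial>lborel) = - (\<integral>x. \<phi> n x *\<^sub>R g x \<partial>lborel)" for n
      using fg test unfolding has_weak_derivative_def by blast
    then show ?thesis using tendsto_minus[OF lim2] by (simp only:)
  qed
  then have "- (\<integral>x. indicator {a..b} x *\<^sub>R g x \<partial>lborel) = f a - f b"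
    using lim1 by (rule LIMSEQ_unique)
  then show ?thesis unfolding set_lebesgue_integral_def by (simp add: minus_equation_iff)
qed

text \<open>On each window \<open>{- real n..real n}\<close> the difference is integrable. Its
  integral vanishes over intervals, hence over all Borel sets by induction on their generation, and
  uniqueness of densities applies.\<close>

lemma AE_eq_of_interval_integrals:
  fixes g h :: "real \<Rightarrow> 'a::euclidean_space"
  assumes g: "locally_integrable g" and h: "locally_integrable h"
    and eq: "\<And>a b. a \<le> b \<Longrightarrow> (LINT x:{a..b}|lborel. g x) = (LINT x:{a..b}|lborel. h x)"
  shows "AE x in lborel. g x = h x"
proof -
  have AE_n: "AE x in lborel. indicator {- real n..real n} x *\<^sub>R (g x - h x) = 0" for n
  proof (rule sigma_finite_measure.density_unique_banach[OF sigma_finite_lborel])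
    define k where "k = (\<lambda>x. indicator {- real n..real n} x *\<^sub>R (g x - h x))"
    have gi: "set_integrable lborel {a..b} g" "set_integrable lborel {a..b} h" for a b
      using g h by (auto simp: locally_integrable_def)
    have "set_integrable lborel {- real n..real n} (\<lambda>x. g x - h x)"
      by (rule set_integral_diff(1)[OF gi])
    then have k_int: "integrable lborel k" unfolding set_integrable_def k_def .
    then show "integrable lborel (\<lambda>x. indicator {- real n..real n} x *\<^sub>R (g x - h x))" by (simp add: k_def)
    have k_set: "set_integrable lborel A k" if "A \<in> sets borel" for A
      unfolding set_integrable_def using that by (intro integrable_mult_indicator k_int) auto
    fix A :: "real set" assume "A \<in> sets lborel"
    then have "A \<in> sets borel" by simp
    then have "set_lebesgue_integral lborel A k = 0"
    proof (induction A rule: borel_set_induct)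
      case empty
      then show ?case by (simp add: set_lebesgue_integral_def)
    next
      case (interval a b)
      \<comment> \<open>An interval cut by the window is again an interval, possibly an empty
        one.\<close>
      define a' b' where "a' = max a (- real n)" and "b' = min b (real n)"
      have "set_lebesgue_integral lborel {a..b} k = (LINT x:{a'..b'}|lborel. g x - h x)"
        unfolding set_lebesgue_integral_def k_def a'_def b'_def
        by (intro Bochner_Integration.integral_cong) (auto simp: indicator_def)
      also have "\<dots> = (LINT x:{a'..b'}|lborel. g x) - (LINT x:{a'..b'}|lborel. h x)"
        by (rule set_integral_diff(2)[OF gi])
      also have "\<dots> = 0" using eq[of a' b'] by (cases "a' \<le> b'") (auto simp: set_lebesgue_integral_def)
      finally show ?case .
    next
      case (compl A)
      have "set_lebesgue_integral lborel (-A) k = (\<integral>x. k x - indicator A x *\<^sub>R k x \<partial>lborel)"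
        unfolding set_lebesgue_integral_def
        by (intro Bochner_Integration.integral_cong) (auto simp: indicator_def)
      also have "\<dots> = integral\<^sup>L lborel k - set_lebesgue_integral lborel A k"
        using k_set[OF compl(1)] k_int unfolding set_lebesgue_integral_def set_integrable_def
        by (intro Bochner_Integration.integral_diff) auto
      also have "integral\<^sup>L lborel k = (LINT x:{- real n..real n}|lborel. g x - h x)"
        by (simp add: set_lebesgue_integral_def k_def)
      also have "\<dots> = (LINT x:{- real n..real n}|lborel. g x) - (LINT x:{- real n..real n}|lborel. h x)"
        by (rule set_integral_diff(2)[OF gi])
      finally show ?case using compl eq[of "- real n" "real n"] by simp
    next
      case (union A)
      have "set_lebesgue_integral lborel (\<Union>i. A i) k = (\<Sum>i. set_lebesgue_integral lborel (A i) k)"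
        using union by (intro lebesgue_integral_countable_add k_set) (auto simp: disjoint_family_on_def)
      then show ?case using union by simp
    qed
    then show "(LINT x:A|lborel. indicator {- real n..real n} x *\<^sub>R (g x - h x)) = (LINT x:A|lborel. 0)"
      by (simp add: k_def set_lebesgue_integral_def)
  qed auto
  then have "AE x in lborel. \<forall>n. indicator {- real n..real n} x *\<^sub>R (g x - h x) = 0"
    unfolding AE_all_countable using AE_n by blast
  then show ?thesis
  proof eventually_elim
    case (elim x)
    obtain n :: nat where "\<bar>x\<bar> \<le> real n" using real_arch_simple by blast
    then have "x \<in> {- real n..real n}" by auto
    then show ?case using elim[rule_format, of n] by simp
  qed
qed

section \<open>The Sobolev--Slobodeckij space embeds into \<open>C\<^sup>1\<close>\<close>

lemma Lp_pow_cong_AE: "AE x in lborel. g x = h x \<Longrightarrow> Lp_pow \<rho> g = Lp_pow \<rho> h"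
  unfolding Lp_pow_def by (rule nn_integral_cong_AE) (auto elim: eventually_mono)

lemma AE_eq_shift:
  fixes g h :: "real \<Rightarrow> 'a::euclidean_space"
  assumes [measurable]: "g \<in> borel_measurable borel" "h \<in> borel_measurable borel"
    and ae: "AE x in lborel. g x = h x"
  shows "AE w in lborel. g (u + w) = h (u + w)"
proof -
  have "AE w in lborel. norm (g (u + 1 * w) - h (u + 1 * w)) = 0"
    by (rule AE_borel_affine[of 1 "\<lambda>x. norm (g x - h x) = 0"]) (use ae in auto)
  then show ?thesis by simp
qed

lemma gagliardo_inner_cong_AE:
  fixes g h :: "real \<Rightarrow> 'a::euclidean_space"
  assumes "g \<in> borel_measurable borel" "h \<in> borel_measurable borel"
    and ae: "AE x in lborel. g x = h x" and u: "g u = h u"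
  shows "(\<integral>\<^sup>+w\<in>{-1/2..1/2}. ennreal (norm (g (u + w) - g u) powr \<rho> / \<bar>w\<bar> powr q) \<partial>lborel) =
    (\<integral>\<^sup>+w\<in>{-1/2..1/2}. ennreal (norm (h (u + w) - h u) powr \<rho> / \<bar>w\<bar> powr q) \<partial>lborel)"
  using AE_eq_shift[OF assms(1-3), of u] u
  by (intro nn_integral_cong_AE) (auto elim!: eventually_mono)

lemma gagliardo_pow_cong_AE:
  fixes g h :: "real \<Rightarrow> 'a::euclidean_space"
  assumes "g \<in> borel_measurable borel" "h \<in> borel_measurable borel" "AE x in lborel. g x = h x"
  shows "gagliardo_pow s \<rho> g = gagliardo_pow s \<rho> h"
  unfolding gagliardo_pow_def
proof (rule nn_integral_cong_AE)
  show "AE u in lborel. (\<integral>\<^sup>+w\<in>{-1/2..1/2}. ennreal (norm (g (u + w) - g u) powr \<rho> / \<bar>w\<bar> powr (1 + s * \<rho>)) \<partial>lborel) * indicator {0..1} u =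
     (\<integral>\<^sup>+w\<in>{-1/2..1/2}. ennreal (norm (h (u + w) - h u) powr \<rho> / \<bar>w\<bar> powr (1 + s * \<rho>)) \<partial>lborel) * indicator {0..1} u"
    using assms(3)
  proof eventually_elim
    case (elim u)
    show ?case by (subst gagliardo_inner_cong_AE[OF assms elim]) simp
  qed
qed

lemma set_integral_const_Icc:
  fixes y :: "'a::euclidean_space" and a b :: real
  assumes "a \<le> b"
  shows "(LINT x:{a..b}|lborel. y) = (b - a) *\<^sub>R y"
  using assms by (simp add: set_lebesgue_integral_def)

lemma norm_set_integral_le_nn_integral:
  fixes g :: "real \<Rightarrow> 'a::euclidean_space"
  assumes "set_integrable lborel A g"
  shows "ennreal (norm (LINT x:A|lborel. g x)) \<le> (\<integral>\<^sup>+x\<in>A. ennreal (norm (g x)) \<partial>lborel)"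
proof -
  have "ennreal (norm (LINT x:A|lborel. g x)) \<le> (\<integral>\<^sup>+x. ennreal (norm (indicator A x *\<^sub>R g x)) \<partial>lborel)"
    unfolding set_lebesgue_integral_def
    by (rule integral_norm_bound_ennreal) (use assms in \<open>simp add: set_integrable_def\<close>)
  also have "\<dots> = (\<integral>\<^sup>+x\<in>A. ennreal (norm (g x)) \<partial>lborel)"
    by (intro nn_integral_cong) (auto simp: indicator_def)
  finally show ?thesis .
qed

text \<open>Both averages are compared with the mean \<open>y\<close> over the long interval.
  Enlarging the half interval to the whole one is harmless since the integrand is nonnegative; the
  factor 2 is the ratio of the lengths.\<close>

lemma average_difference_le:
  fixes g :: "real \<Rightarrow> 'a::euclidean_space"
  assumes g: "locally_integrable g" and r: "0 < r"
  shows "ennreal (norm ((2 / r) *\<^sub>R (LINT t:{a..a + r / 2}|lborel. g t) - (1 / r) *\<^sub>R (LINT t:{a..a + r}|lborel. g t))) \<le>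
    ennreal (2 / r\<^sup>2) * (\<integral>\<^sup>+t\<in>{a..a + r}. (\<integral>\<^sup>+t'\<in>{a..a + r}. ennreal (norm (g t' - g t)) \<partial>lborel) \<partial>lborel)"
proof -
  have gi: "set_integrable lborel {a..b} g" for a b using g by (simp add: locally_integrable_def)
  have ci: "set_integrable lborel {a..b} (\<lambda>_. y)" for a b :: real and y :: 'a
    unfolding set_integrable_def by (rule borel_integrable_compact) auto
  have [measurable]: "g \<in> borel_measurable borel" by (rule locally_integrable_measurable[OF g])
  define y where "y = (1 / r) *\<^sub>R (LINT t:{a..a + r}|lborel. g t)"
  have inner: "ennreal (norm (g t - y)) \<le> ennreal (1 / r) * (\<integral>\<^sup>+t'\<in>{a..a + r}. ennreal (norm (g t' - g t)) \<partial>lborel)" for t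
  proof -
    have "(LINT t':{a..a + r}|lborel. g t' - g t) = r *\<^sub>R (y - g t)"
      using set_integral_diff(2)[OF gi ci, of a "a + r" "g t"] set_integral_const_Icc[of a "a + r" "g t"] r
      by (simp add: y_def algebra_simps)
    then have "norm (g t - y) = 1 / r * norm (LINT t':{a..a + r}|lborel. g t' - g t)"
      using r by (simp add: norm_minus_commute)
    also have "ennreal \<dots> \<le> ennreal (1 / r) * (\<integral>\<^sup>+t'\<in>{a..a + r}. ennreal (norm (g t' - g t)) \<partial>lborel)"
      using r norm_set_integral_le_nn_integral[OF set_integral_diff(1)[OF gi ci]]
      by (subst ennreal_mult) (auto intro!: mult_left_mono)
    finally show ?thesis .
  qed
  have "(LINT t:{a..a + r / 2}|lborel. g t - y) = (LINT t:{a..a + r / 2}|lborel. g t) - (r / 2) *\<^sub>R y"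
    using set_integral_diff(2)[OF gi ci, of a "a + r / 2" y] set_integral_const_Icc[of a "a + r / 2" y] r by simp
  then have "(2 / r) *\<^sub>R (LINT t:{a..a + r / 2}|lborel. g t) - y = (2 / r) *\<^sub>R (LINT t:{a..a + r / 2}|lborel. g t - y)"
    using r by (simp add: scaleR_diff_right)
  then have "norm ((2 / r) *\<^sub>R (LINT t:{a..a + r / 2}|lborel. g t) - y) = 2 / r * norm (LINT t:{a..a + r / 2}|lborel. g t - y)"
    using r by simp
  also have "ennreal \<dots> \<le> ennreal (2 / r) * (\<integral>\<^sup>+t\<in>{a..a + r / 2}. ennreal (norm (g t - y)) \<partial>lborel)"
    using r norm_set_integral_le_nn_integral[OF set_integral_diff(1)[OF gi ci]]
    by (subst ennreal_mult) (auto intro!: mult_left_mono)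
  also have "\<dots> \<le> ennreal (2 / r) * (\<integral>\<^sup>+t\<in>{a..a + r}. ennreal (1 / r) *
      (\<integral>\<^sup>+t'\<in>{a..a + r}. ennreal (norm (g t' - g t)) \<partial>lborel) \<partial>lborel)"
    using inner r by (intro mult_left_mono nn_integral_mono mult_mono) (auto simp: indicator_def)
  also have "\<dots> = ennreal (2 / r) * (ennreal (1 / r) * (\<integral>\<^sup>+t\<in>{a..a + r}.
      (\<integral>\<^sup>+t'\<in>{a..a + r}. ennreal (norm (g t' - g t)) \<partial>lborel) \<partial>lborel))"
    by (simp only: mult.assoc) (subst nn_integral_cmult, measurable)
  also have "\<dots> = ennreal (2 / r\<^sup>2) * (\<integral>\<^sup>+t\<in>{a..a + r}.
      (\<integral>\<^sup>+t'\<in>{a..a + r}. ennreal (norm (g t' - g t)) \<partial>lborel) \<partial>lborel)"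
    using r by (simp add: mult.assoc[symmetric] ennreal_mult[symmetric] power2_eq_square)
  finally show ?thesis by (simp add: y_def)
qed

lemma periodic_frac:
  fixes h :: "real \<Rightarrow> 'b"
  assumes per: "\<And>x. h (x + 1) = h x"
  shows "h x = h (frac x)"
proof -
  have nat: "h (y + real n) = h y" for y n
  proof (induction n)
    case (Suc n)
    then show ?case using per[of "y + real n"] by (simp add: add_ac)
  qed simp
  show ?thesis
  proof (cases "0 \<le> \<lfloor>x\<rfloor>")
    case True
    then have "x = frac x + real (nat \<lfloor>x\<rfloor>)" by (simp add: frac_def)
    then show ?thesis using nat by metis
  next
    case False
    then have "frac x = x + real (nat (- \<lfloor>x\<rfloor>))" by (simp add: frac_def)
    then show ?thesis using nat by metis
  qed
qed

lemma has_vector_derivative_quotient_limit: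
  assumes "(F has_vector_derivative d) (at x)"
  shows "((\<lambda>h. (1 / h) *\<^sub>R (F (x + h) - F x)) \<longlongrightarrow> d) (at 0)"
proof -
  have "((\<lambda>h. norm (F (x + h) - F x - h *\<^sub>R d) / norm h) \<longlongrightarrow> 0) (at 0)"
    using assms by (simp add: has_vector_derivative_def has_derivative_at)
  then have "((\<lambda>h. norm ((1 / h) *\<^sub>R (F (x + h) - F x) - d)) \<longlongrightarrow> 0) (at 0)"
  proof (rule Lim_transform_eventually)
    have "\<forall>\<^sub>F h in at (0::real). h \<noteq> 0" by (simp add: eventually_at_filter)
    then show "\<forall>\<^sub>F h in at 0. norm (F (x + h) - F x - h *\<^sub>R d) / norm h = norm ((1 / h) *\<^sub>R (F (x + h) - F x) - d)"
    proof eventually_elim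
      case (elim h)
      then have "(1 / h) *\<^sub>R (F (x + h) - F x) - d = (1 / h) *\<^sub>R (F (x + h) - F x - h *\<^sub>R d)"
        by (simp add: scaleR_diff_right)
      then show ?case by (simp add: divide_inverse)
    qed
  qed
  then show ?thesis by (simp only: tendsto_norm_zero_iff LIM_zero_iff)
qed

text \<open>Beyond \<eta> the ratio \<open>y / \<eta>\<close> exceeds 1, and multiplying by its
  power \<open>\<rho> - 1\<close> only increases \<open>y\<close>.\<close>

lemma le_add_powr:
  fixes y \<eta> \<rho> :: real
  assumes "0 \<le> y" "0 < \<eta>" "1 \<le> \<rho>"
  shows "y \<le> \<eta> + \<eta> powr (1 - \<rho>) * y powr \<rho>"
proof (cases "y \<le> \<eta>")
  case False
  then have y: "0 < y" using assms by simp
  have "1 \<le> (y / \<eta>) powr (\<rho> - 1)" using False assms by (intro ge_one_powr_ge_zero) auto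
  then have "y * 1 \<le> y * (y / \<eta>) powr (\<rho> - 1)" using y by (intro mult_left_mono) auto
  also have "\<dots> = \<eta> powr (1 - \<rho>) * y powr \<rho>"
    using y assms by (simp add: powr_divide powr_diff field_simps)
  finally show ?thesis using assms by simp
qed (use assms in \<open>simp add: add_increasing2\<close>)

section \<open>The fractional Morrey embedding\<close>

context
  fixes s \<rho> :: real and f g :: "real \<Rightarrow> 'a::euclidean_space"
  assumes \<rho>: "1 \<le> \<rho>" and s: "1 < s * \<rho>"
    and per: "\<And>x. f (x + 1) = f x" and contf: "continuous_on UNIV f"
    and fg: "has_weak_derivative f g" and G: "gagliardo_pow s \<rho> g < \<infinity>"
begin

private definition "q = 1 + s * \<rho>"

private definition "H t = (\<integral>\<^sup>+w\<in>{-1/2..1/2}. ennreal (norm (g (t + w) - g t) powr \<rho> / \<bar>w\<bar> powr q) \<partial>lborel)"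

private lemma locg: "locally_integrable g"
  using fg by (simp add: has_weak_derivative_def)

private lemma meas_g [measurable]: "g \<in> borel_measurable borel"
  by (rule locally_integrable_measurable[OF locg])

private lemma meas_H [measurable]: "H \<in> borel_measurable borel"
  unfolding H_def[abs_def] by measurable

private lemma increment: "a \<le> b \<Longrightarrow> (LINT x:{a..b}|lborel. g x) = f b - f a"
  by (rule weak_derivative_integral[OF fg contf])

text \<open>Only \<open>f\<close> is known to be periodic. The weak derivative inherits this through
  interval integrals, hence almost everywhere.\<close>

private lemma AE_periodic: "AE x in lborel. g (1 + x) = g x"
proof (rule AE_eq_of_interval_integrals[OF _ locg])
  have gi: "set_integrable lborel {a..b} g" for a b using locg by (simp add: locally_integrable_def)
  have ind: "indicator {a + 1..b + 1} (1 + x) = (indicator {a..b} x :: real)" for a b x :: real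
    by (auto simp: indicator_def)
  show "locally_integrable (\<lambda>x. g (1 + x))"
    unfolding locally_integrable_def
  proof (intro allI)
    fix a b :: real
    have "integrable lborel (\<lambda>x. indicator {a + 1..b + 1} (1 + 1 * x) *\<^sub>R g (1 + 1 * x))"
      using lborel_integrable_real_affine[OF gi[unfolded set_integrable_def, of "a + 1" "b + 1"], of 1 1] by simp
    then show "set_integrable lborel {a..b} (\<lambda>x. g (1 + x))"
      unfolding set_integrable_def by (simp add: ind)
  qed
  fix a b :: real assume ab: "a \<le> b"
  have "(LINT x:{a + 1..b + 1}|lborel. g x) = (\<integral>x. indicator {a + 1..b + 1} (1 + 1 * x) *\<^sub>R g (1 + 1 * x) \<partial>lborel)"
    unfolding set_lebesgue_integral_def
    using lborel_integral_real_affine[of 1 "\<lambda>x. indicator {a + 1..b + 1} x *\<^sub>R g x" 1] by simp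
  then have "(LINT x:{a..b}|lborel. g (1 + x)) = (LINT x:{a + 1..b + 1}|lborel. g x)"
    by (simp add: set_lebesgue_integral_def ind)
  then show "(LINT x:{a..b}|lborel. g (1 + x)) = (LINT x:{a..b}|lborel. g x)"
    using increment[of "a + 1" "b + 1"] increment[of a b] ab per by simp
qed

text \<open>Intervals starting in \<open>{0..1}\<close> may leave the first period, so two periods
  have to be covered.\<close>

private lemma nn_integral_H_le: "(\<integral>\<^sup>+t\<in>{0..2}. H t \<partial>lborel) \<le> 2 * gagliardo_pow s \<rho> g"
proof -
  have H1: "(\<integral>\<^sup>+t\<in>{0..1}. H t \<partial>lborel) = gagliardo_pow s \<rho> g"
    by (simp add: gagliardo_pow_def H_def q_def)
  have "(\<integral>\<^sup>+t\<in>{1..2}. H t \<partial>lborel) = (\<integral>\<^sup>+t. H (1 + 1 * t) * indicator {1..2} (1 + 1 * t) \<partial>lborel)"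
    using nn_integral_real_affine[of "\<lambda>t. H t * indicator {1..2} t" 1 1] by simp
  also have "\<dots> = (\<integral>\<^sup>+t\<in>{0..1}. H t \<partial>lborel)"
  proof (rule nn_integral_cong_AE)
    show "AE t in lborel. H (1 + 1 * t) * indicator {1..2} (1 + 1 * t) = H t * indicator {0..1} t"
      using AE_periodic
    proof eventually_elim
      case (elim t)
      have "H (1 + t) = (\<integral>\<^sup>+w\<in>{-1/2..1/2}. ennreal (norm (g (1 + (t + w)) - g (1 + t)) powr \<rho> / \<bar>w\<bar> powr q) \<partial>lborel)"
        by (simp add: H_def add.assoc)
      also have "\<dots> = H t"
        unfolding H_def using gagliardo_inner_cong_AE[of "\<lambda>x. g (1 + x)" g, OF _ _ AE_periodic elim] by simp
      finally show ?case by (auto simp: indicator_def)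
    qed
  qed
  finally have H2: "(\<integral>\<^sup>+t\<in>{1..2}. H t \<partial>lborel) = gagliardo_pow s \<rho> g" using H1 by simp
  have "(\<integral>\<^sup>+t\<in>{0..2}. H t \<partial>lborel) \<le> (\<integral>\<^sup>+t. H t * indicator {0..1} t + H t * indicator {1..2} t \<partial>lborel)"
    by (intro nn_integral_mono) (auto simp: indicator_def)
  also have "\<dots> = (\<integral>\<^sup>+t\<in>{0..1}. H t \<partial>lborel) + (\<integral>\<^sup>+t\<in>{1..2}. H t \<partial>lborel)"
    by (rule nn_integral_add) auto
  finally show ?thesis using H1 H2 by (simp add: mult_2)
qed

text \<open>For \<open>r > 0\<close> the mean of \<open>g\<close> over \<open>{x..x + r}\<close>,
  written with \<open>f\<close> so that it is continuous and periodic in \<open>x\<close>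
  everywhere.\<close>

definition slope :: "real \<Rightarrow> real \<Rightarrow> 'a" where
  "slope r x = (1 / r) *\<^sub>R (f (x + r) - f x)"

text \<open>\<open>le_add_powr\<close> replaces Hoelder's inequality; the choice of \<open>\<eta>\<close> balances its two terms.\<close>

lemma slope_halving_le:
  assumes x: "x \<in> {0..1}" and r: "0 < r" "r \<le> 1/2"
  shows "norm (slope (r / 2) x - slope r x) \<le> (2 + 4 * enn2real (gagliardo_pow s \<rho> g)) * r powr ((s * \<rho> - 1) / \<rho>)"
proof -
  define \<beta> where "\<beta> = (s * \<rho> - 1) / \<rho>"
  define \<eta> where "\<eta> = r powr \<beta>"
  define c where "c = \<eta> powr (1 - \<rho>) * r powr q"
  have pos: "0 < \<eta>" "0 < c" using r by (auto simp: \<eta>_def c_def)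
  define I where "I = {x..x + r}"
  have q0: "0 \<le> q" using s by (simp add: q_def)
  have point: "ennreal (norm (g t' - g t)) \<le> ennreal \<eta> + ennreal c * ennreal (norm (g t' - g t) powr \<rho> / \<bar>t' - t\<bar> powr q)"
    if "t \<in> I" "t' \<in> I" for t t'
  proof -
    define y where "y = norm (g t' - g t)"
    have "y powr \<rho> \<le> r powr q * (y powr \<rho> / \<bar>t' - t\<bar> powr q)"
    proof (cases "t' = t")
      case False
      have "\<bar>t' - t\<bar> powr q \<le> r powr q" using that q0 by (intro powr_mono2) (auto simp: I_def)
      then have "y powr \<rho> * 1 \<le> y powr \<rho> * (r powr q / \<bar>t' - t\<bar> powr q)"
        using False by (intro mult_left_mono) (auto simp: pos_le_divide_eq)
      then show ?thesis by (simp add: mult_ac)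
    qed (simp add: y_def)
    then have "\<eta> powr (1 - \<rho>) * y powr \<rho> \<le> c * (y powr \<rho> / \<bar>t' - t\<bar> powr q)"
      unfolding c_def mult.assoc by (intro mult_left_mono) auto
    then have "y \<le> \<eta> + c * (y powr \<rho> / \<bar>t' - t\<bar> powr q)"
      using le_add_powr[of y \<eta> \<rho>] pos \<rho> by (simp add: y_def)
    then have "ennreal y \<le> ennreal (\<eta> + c * (y powr \<rho> / \<bar>t' - t\<bar> powr q))" by (rule ennreal_leI)
    also have "\<dots> = ennreal \<eta> + ennreal c * ennreal (y powr \<rho> / \<bar>t' - t\<bar> powr q)"
      using pos by (subst ennreal_plus) (auto simp: ennreal_mult[symmetric])
    finally show ?thesis by (simp add: y_def)
  qed
  have inner: "(\<integral>\<^sup>+t'\<in>I. ennreal (norm (g t' - g t)) \<partial>lborel) \<le> ennreal \<eta> * ennreal r + ennreal c * H t" if t: "t \<in> I" for t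
  proof -
    have "(\<integral>\<^sup>+t'\<in>I. ennreal (norm (g t' - g t)) \<partial>lborel) \<le>
      (\<integral>\<^sup>+t'. ennreal \<eta> * indicator I t' + ennreal c * (ennreal (norm (g t' - g t) powr \<rho> / \<bar>t' - t\<bar> powr q) * indicator I t') \<partial>lborel)"
      using point[OF t] by (intro nn_integral_mono) (auto simp: indicator_def)
    also have "\<dots> = ennreal \<eta> * ennreal r + ennreal c * (\<integral>\<^sup>+t'\<in>I. ennreal (norm (g t' - g t) powr \<rho> / \<bar>t' - t\<bar> powr q) \<partial>lborel)"
      using r by (subst nn_integral_add) (auto simp: nn_integral_cmult I_def nn_integral_cmult_indicator)
    \<comment> \<open>Two points of \<open>I\<close> differ by at most \<open>r \<le> 1/2\<close>,
      so the offsets \<open>t' - t\<close> stay within the window of \<open>H\<close>.\<close>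
    also have "(\<integral>\<^sup>+t'\<in>I. ennreal (norm (g t' - g t) powr \<rho> / \<bar>t' - t\<bar> powr q) \<partial>lborel) \<le> H t"
    proof -
      have "(\<integral>\<^sup>+t'\<in>I. ennreal (norm (g t' - g t) powr \<rho> / \<bar>t' - t\<bar> powr q) \<partial>lborel) =
         (\<integral>\<^sup>+w. ennreal (norm (g (t + 1 * w) - g t) powr \<rho> / \<bar>t + 1 * w - t\<bar> powr q) * indicator I (t + 1 * w) \<partial>lborel)"
        using nn_integral_real_affine[of "\<lambda>t'. ennreal (norm (g t' - g t) powr \<rho> / \<bar>t' - t\<bar> powr q) * indicator I t'" 1 t]
        by (simp add: I_def)
      also have "\<dots> \<le> H t"
        unfolding H_def using t r by (intro nn_integral_mono) (auto simp: I_def indicator_def)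
      finally show ?thesis .
    qed
    finally show ?thesis by (simp add: add_left_mono mult_left_mono)
  qed
  have "(\<integral>\<^sup>+t\<in>I. (\<integral>\<^sup>+t'\<in>I. ennreal (norm (g t' - g t)) \<partial>lborel) \<partial>lborel) \<le>
      (\<integral>\<^sup>+t. ennreal \<eta> * ennreal r * indicator I t + ennreal c * (H t * indicator {0..2} t) \<partial>lborel)"
  proof (rule nn_integral_mono)
    fix t
    show "(\<integral>\<^sup>+t'\<in>I. ennreal (norm (g t' - g t)) \<partial>lborel) * indicator I t \<le>
        ennreal \<eta> * ennreal r * indicator I t + ennreal c * (H t * indicator {0..2} t)"
    proof (cases "t \<in> I")
      case True
      then have "t \<in> {0..2}" using x r by (auto simp: I_def)
      then show ?thesis using inner[OF True] True by simp
    qed simp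
  qed
  also have "\<dots> = ennreal \<eta> * ennreal r * ennreal r + ennreal c * (\<integral>\<^sup>+t\<in>{0..2}. H t \<partial>lborel)"
    using r by (subst nn_integral_add) (auto simp: nn_integral_cmult I_def nn_integral_cmult_indicator)
  also have "\<dots> \<le> ennreal \<eta> * ennreal r * ennreal r + ennreal c * (2 * gagliardo_pow s \<rho> g)"
    by (intro add_left_mono mult_left_mono nn_integral_H_le) auto
  also have "\<dots> = ennreal (\<eta> * r * r + c * (2 * enn2real (gagliardo_pow s \<rho> g)))"
  proof -
    have "gagliardo_pow s \<rho> g = ennreal (enn2real (gagliardo_pow s \<rho> g))" using G by (simp add: less_top)
    then have "2 * gagliardo_pow s \<rho> g = ennreal (2 * enn2real (gagliardo_pow s \<rho> g))"
      by (metis enn2real_nonneg ennreal_mult ennreal_numeral zero_le_numeral)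
    then show ?thesis using pos r by (simp add: ennreal_plus ennreal_mult)
  qed
  finally have II: "(\<integral>\<^sup>+t\<in>I. (\<integral>\<^sup>+t'\<in>I. ennreal (norm (g t' - g t)) \<partial>lborel) \<partial>lborel) \<le>
      ennreal (\<eta> * r * r + c * (2 * enn2real (gagliardo_pow s \<rho> g)))" .
  have slopes: "slope (r / 2) x - slope r x =
      (2 / r) *\<^sub>R (LINT t:{x..x + r / 2}|lborel. g t) - (1 / r) *\<^sub>R (LINT t:{x..x + r}|lborel. g t)"
    using r by (simp add: slope_def increment)
  have "ennreal (norm (slope (r / 2) x - slope r x)) \<le> ennreal (2 / r\<^sup>2) *
      (\<integral>\<^sup>+t\<in>I. (\<integral>\<^sup>+t'\<in>I. ennreal (norm (g t' - g t)) \<partial>lborel) \<partial>lborel)"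
    unfolding slopes I_def by (rule average_difference_le[OF locg r(1)])
  also have "\<dots> \<le> ennreal (2 / r\<^sup>2) * ennreal (\<eta> * r * r + c * (2 * enn2real (gagliardo_pow s \<rho> g)))"
    by (intro mult_left_mono II) auto
  also have "\<dots> = ennreal (2 / r\<^sup>2 * (\<eta> * r * r + c * (2 * enn2real (gagliardo_pow s \<rho> g))))"
    using pos r by (subst ennreal_mult) auto
  finally have "norm (slope (r / 2) x - slope r x) \<le> 2 / r\<^sup>2 * (\<eta> * r * r + c * (2 * enn2real (gagliardo_pow s \<rho> g)))"
    using pos r by (subst (asm) ennreal_le_iff) auto
  also have "\<dots> = 2 * \<eta> + 4 * enn2real (gagliardo_pow s \<rho> g) * (c / r\<^sup>2)"
    using r by (simp add: field_simps power2_eq_square)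
  also have "c / r\<^sup>2 = \<eta>"
  proof -
    \<comment> \<open>Since \<open>\<beta> * \<rho> = s * \<rho> - 1 = q - 2\<close>, the second
      term has the same order as \<eta>.\<close>
    have e: "\<beta> * (1 - \<rho>) + q - 2 = \<beta>" using \<rho> by (simp add: \<beta>_def q_def field_simps)
    have "c / r\<^sup>2 = r powr (\<beta> * (1 - \<rho>)) * r powr q / r powr 2"
      using r by (simp add: c_def \<eta>_def powr_powr)
    also have "\<dots> = r powr (\<beta> * (1 - \<rho>) + q - 2)" by (simp only: powr_add powr_diff)
    finally show ?thesis using e by (simp add: \<eta>_def)
  qed
  also have "2 * \<eta> + 4 * enn2real (gagliardo_pow s \<rho> g) * \<eta> = (2 + 4 * enn2real (gagliardo_pow s \<rho> g)) * r powr ((s * \<rho> - 1) / \<rho>)"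
    by (simp add: \<eta>_def \<beta>_def algebra_simps)
  finally show ?thesis .
qed

lemma slope_periodic: "slope r (x + 1) = slope r x"
  using per[of "x + r"] per[of x] by (simp add: slope_def add_ac)

text \<open>Convergence along dyadic steps does not by itself give differentiability. The limit is
  identified by integration: the integral of a slope over \<open>{a..b}\<close> is a difference of
  two quotients of a primitive \<open>F\<close> of \<open>f\<close> and tends to
  \<open>f b - f a\<close>. So \<open>f\<close> differs from a primitive of the continuous limit by
  a constant.\<close>

lemma slope_limit:
  obtains v where "continuous_on UNIV v" "\<And>x. v (x + 1) = v x" "\<And>x. (f has_vector_derivative v x) (at x)"
    "\<And>x. norm (v x - slope (1/2) x) \<le>
      (2 + 4 * enn2real (gagliardo_pow s \<rho> g)) * (\<Sum>n. ((1/2) powr ((s * \<rho> - 1) / \<rho>)) ^ Suc n)"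
proof -
  define \<kappa> where "\<kappa> = (1/2::real) powr ((s * \<rho> - 1) / \<rho>)"
  have exp_pos: "0 < (s * \<rho> - 1) / \<rho>" using s \<rho> by simp
  \<comment> \<open>Here \<open>s * \<rho> > 1\<close> acts: the exponent is positive and the series
    of halving errors is geometric.\<close>
  have lam: "0 < \<kappa>" "\<kappa> < 1"
    using powr_less_mono2[OF exp_pos, of "1/2" 1] by (auto simp: \<kappa>_def)
  define A where "A = 2 + 4 * enn2real (gagliardo_pow s \<rho> g)"
  \<comment> \<open>The sequence starts with step 1/2, the largest one for which the halving
    estimate is available.\<close>
  define d where "d n x = slope ((1/2) ^ Suc (Suc n)) x - slope ((1/2) ^ Suc n) x" for n x
  have summ: "summable (\<lambda>n. \<kappa> ^ Suc n)" using lam by (simp add: summable_Suc_iff summable_geometric)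
  have pow: "((1/2) ^ n) powr ((s * \<rho> - 1) / \<rho>) = \<kappa> ^ n" for n :: nat
    by (induction n) (simp, simp only: \<kappa>_def power_Suc powr_mult)
  have bound: "norm (d n x) \<le> A * \<kappa> ^ Suc n" for n x
  proof -
    have "slope r x = slope r (frac x)" for r
      by (rule periodic_frac) (rule slope_periodic)
    then have "d n x = d n (frac x)" unfolding d_def by (simp only:)
    also have "norm (d n (frac x)) \<le> A * ((1/2) ^ Suc n) powr ((s * \<rho> - 1) / \<rho>)"
    proof -
      have "(1/2::real) ^ Suc n \<le> (1/2) ^ 1" by (rule power_decreasing) auto
      then show ?thesis
        using slope_halving_le[of "frac x" "(1/2) ^ Suc n"] frac_lt_1[of x] by (simp add: d_def A_def less_imp_le)
    qed
    finally show ?thesis by (simp only: pow)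
  qed
  define v where "v x = slope (1/2) x + (\<Sum>n. d n x)" for x
  have partial: "(\<Sum>i<n. d i x) = slope ((1/2) ^ Suc n) x - slope (1/2) x" for n x
    using sum_lessThan_telescope[of "\<lambda>n. slope ((1/2) ^ Suc n) x" n] by (simp add: d_def)
  have "uniform_limit UNIV (\<lambda>n x. \<Sum>i<n. d i x) (\<lambda>x. \<Sum>n. d n x) sequentially"
    using bound summ by (intro Weierstrass_m_test[of _ _ "\<lambda>n. A * \<kappa> ^ Suc n"] summable_mult) auto
  then have "uniform_limit UNIV (\<lambda>n x. slope (1/2) x + (\<Sum>i<n. d i x)) (\<lambda>x. slope (1/2) x + (\<Sum>n. d n x)) sequentially"
    by (intro uniform_limit_intros)
  then have ul: "uniform_limit UNIV (\<lambda>n. slope ((1/2) ^ Suc n)) v sequentially"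
    by (simp add: partial v_def[abs_def])
  have cont_slope: "continuous_on S (slope r)" for r S
    unfolding slope_def[abs_def]
    by (intro continuous_intros continuous_on_compose2[OF contf] continuous_on_subset[OF contf]) auto
  have cont_v: "continuous_on UNIV v"
    by (rule uniform_limit_theorem[OF always_eventually ul]) (simp_all only: cont_slope simp_thms trivial_limit_sequentially not_False_eq_True)
  obtain F where F: "\<And>x. (F has_vector_derivative f x) (at x)"
    using continuous_imp_antiderivative[OF contf] by blast
  obtain V where V: "\<And>x. (V has_vector_derivative v x) (at x)"
    using continuous_imp_antiderivative[OF cont_v] by blast
  have increment_V: "V b - V a = f b - f a" if ab: "a \<le> b" for a b
  proof -
    obtain I J where I: "\<And>n. (slope ((1/2) ^ Suc n) has_integral I n) (cbox a b)"
      and J: "(v has_integral J) (cbox a b)" and IJ: "I \<longlonglongrightarrow> J"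
      by (rule uniform_limit_integral_cbox[where a = a and b = b, OF uniform_limit_on_subset[OF ul subset_UNIV]
            cont_slope trivial_limit_sequentially]) (rule that)
    have "(v has_integral V b - V a) {a..b}"
      using ab V by (intro fundamental_theorem_of_calculus) (auto intro: has_vector_derivative_at_within)
    then have JV: "J = V b - V a" using has_integral_unique[OF J] by simp
    have In: "I n = (1 / (1/2) ^ Suc n) *\<^sub>R (F (b + (1/2) ^ Suc n) - F b) - (1 / (1/2) ^ Suc n) *\<^sub>R (F (a + (1/2) ^ Suc n) - F a)" for n
    proof -
      define r :: real where "r = (1/2) ^ Suc n"
      have "((\<lambda>x. (1 / r) *\<^sub>R (f (x + r) - f x)) has_integral
          (1 / r) *\<^sub>R (F (b + r) - F b) - (1 / r) *\<^sub>R (F (a + r) - F a)) {a..b}"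
      proof (rule fundamental_theorem_of_calculus[OF ab])
        fix x
        have "((\<lambda>x. x + r) has_vector_derivative 1) (at x within {a..b})"
          unfolding has_real_derivative_iff_has_vector_derivative[symmetric] by (auto intro!: derivative_eq_intros)
        from vector_diff_chain_within[OF this has_vector_derivative_at_within[OF F]]
        have "((\<lambda>x. F (x + r)) has_vector_derivative f (x + r)) (at x within {a..b})" by (simp add: o_def)
        then show "((\<lambda>x. (1 / r) *\<^sub>R (F (x + r) - F x)) has_vector_derivative (1 / r) *\<^sub>R (f (x + r) - f x)) (at x within {a..b})"
          by (intro bounded_linear.has_vector_derivative[OF bounded_linear_scaleR_right] has_vector_derivative_diff
              has_vector_derivative_at_within[OF F])
      qed
      then show ?thesis
        using has_integral_unique[OF I[of n]] unfolding slope_def[abs_def] r_def by auto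
    qed
    have quot: "(\<lambda>n. (1 / (1/2) ^ Suc n) *\<^sub>R (F (x + (1/2) ^ Suc n) - F x)) \<longlonglongrightarrow> f x" for x
    proof -
      have "((\<lambda>h. (1 / h) *\<^sub>R (F (x + h) - F x)) \<longlongrightarrow> f x) (at 0)"
        using F[of x] unfolding has_vector_derivative_def has_derivative_at
        by (intro has_vector_derivative_quotient_limit F)
      moreover have "filterlim (\<lambda>n. (1/2::real) ^ Suc n) (at 0) sequentially"
        unfolding filterlim_at by (auto intro!: LIMSEQ_Suc[OF LIMSEQ_realpow_zero] simp del: power_Suc)
      ultimately show ?thesis by (rule filterlim_compose)
    qed
    have "I \<longlonglongrightarrow> f b - f a"
      using tendsto_diff[OF quot[of b] quot[of a]] unfolding In[symmetric] .
    then show ?thesis using IJ JV LIMSEQ_unique by blast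
  qed
  have deriv: "(f has_vector_derivative v x) (at x)" for x
  proof -
    have "f y = V y + (f 0 - V 0)" for y
      using increment_V[of 0 y] increment_V[of y 0] by (cases "0 \<le> y") (auto simp: algebra_simps)
    then have "f = (\<lambda>y. V y + (f 0 - V 0))" by (rule ext)
    moreover have "((\<lambda>y. V y + (f 0 - V 0)) has_vector_derivative v x + 0) (at x)"
      by (intro has_vector_derivative_add V has_vector_derivative_const)
    ultimately show ?thesis by simp
  qed
  show thesis
  proof (rule that[OF cont_v _ deriv])
    show "v (x + 1) = v x" for x by (simp add: v_def d_def slope_periodic)
    fix x
    have sd: "summable (\<lambda>n. A * \<kappa> ^ Suc n)" by (rule summable_mult[OF summ])
    have "norm (\<Sum>n. d n x) \<le> (\<Sum>n. A * \<kappa> ^ Suc n)"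
      using bound by (intro norm_suminf_le[OF _ sd]) auto
    also have "\<dots> = A * (\<Sum>n. \<kappa> ^ Suc n)" by (rule suminf_mult[OF summ])
    finally show "norm (v x - slope (1/2) x) \<le>
      (2 + 4 * enn2real (gagliardo_pow s \<rho> g)) * (\<Sum>n. ((1/2) powr ((s * \<rho> - 1) / \<rho>)) ^ Suc n)"
      by (simp add: v_def A_def \<kappa>_def)
  qed
qed

end

definition vel :: "(real \<Rightarrow> 'a::euclidean_space) \<Rightarrow> real \<Rightarrow> 'a" where
  "vel f x = vector_derivative f (at x)"

lemma velI: "(\<And>x. (f has_vector_derivative v x) (at x)) \<Longrightarrow> vel f = v"
  by (simp add: vel_def fun_eq_iff vector_derivative_at)

lemma continuous_locally_integrable:
  fixes v :: "real \<Rightarrow> 'a::euclidean_space"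
  shows "continuous_on UNIV v \<Longrightarrow> locally_integrable v"
  unfolding locally_integrable_def set_integrable_def
  by (intro allI borel_integrable_compact) (auto intro: continuous_on_subset)

lemma set_integral_eq_increment:
  fixes f v :: "real \<Rightarrow> 'a::euclidean_space"
  assumes "\<And>x. (f has_vector_derivative v x) (at x)" "continuous_on UNIV v" "a \<le> b"
  shows "(LINT x:{a..b}|lborel. v x) = f b - f a"
  unfolding set_lebesgue_integral_def
  using assms by (intro integral_FTC_Icc) (auto intro: has_vector_derivative_at_within continuous_on_subset)

lemma nn_integral_Icc_eq_integral:
  fixes h :: "real \<Rightarrow> real"
  assumes "continuous_on {a..b} h" "\<And>x. 0 \<le> h x" "h \<in> borel_measurable borel"
  shows "(\<integral>\<^sup>+x\<in>{a..b}. ennreal (h x) \<partial>lborel) = ennreal (integral {a..b} h)"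
  using nn_integral_has_integral_lebesgue[of "{a..b}" h "integral {a..b} h"]
    integrable_integral[OF integrable_continuous_real[OF assms(1)]] assms
  by (simp add: nn_integral_completion ennreal_mult' ennreal_indicator mult.commute)

text \<open>Integration by parts on a window whose ends lie outside the support of the test
  function.\<close>

lemma has_weak_derivative_of_derivative:
  fixes f v :: "real \<Rightarrow> 'a::euclidean_space"
  assumes f: "\<And>x. (f has_vector_derivative v x) (at x)" and v: "continuous_on UNIV v"
  shows "has_weak_derivative f v"
  unfolding has_weak_derivative_def
proof (intro conjI allI impI)
  have contf: "continuous_on UNIV f"
    using f by (auto intro!: continuous_at_imp_continuous_on has_vector_derivative_continuous)
  show locf: "locally_integrable f" and locv: "locally_integrable v"
    using contf v by (auto intro: continuous_locally_integrable)
  fix \<phi> \<phi>' assume test: "test_fun \<phi> \<phi>'"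
  then obtain r where r: "\<And>x. r < \<bar>x\<bar> \<Longrightarrow> \<phi> x = 0" and \<phi>: "\<And>x. (\<phi> has_real_derivative \<phi>' x) (at x)"
    and \<phi>': "continuous_on UNIV \<phi>'" unfolding test_fun_def by blast
  define R where "R = \<bar>r\<bar> + 1"
  have R: "0 < R" "r < R" by (auto simp: R_def)
  have cont\<phi>: "continuous_on UNIV \<phi>"
    using \<phi> by (auto intro!: continuous_at_imp_continuous_on DERIV_isCont)
  \<comment> \<open>The definition of a test function confines only \<phi>; its derivative vanishes
    as well because \<phi> is zero on an open set.\<close>
  have outside: "\<phi> x = 0" "\<phi>' x = 0" if "x \<notin> {-R..R}" for x
  proof -
    have x: "r < \<bar>x\<bar>" using that R by auto
    then show "\<phi> x = 0" by (rule r)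
    have "open {x. r < \<bar>x\<bar>}" by (intro open_Collect_less continuous_intros)
    then have "(\<phi> has_real_derivative 0) (at x)"
      by (rule has_field_derivative_transform_within_open[OF DERIV_const[of 0]]) (use x r in simp_all)
    then show "\<phi>' x = 0" using \<phi> DERIV_unique by blast
  qed
  have deriv: "((\<lambda>x. \<phi> x *\<^sub>R f x) has_vector_derivative \<phi> x *\<^sub>R v x + \<phi>' x *\<^sub>R f x) (at x)" for x
    using has_vector_derivative_scaleR[OF \<phi> f] .
  have i1: "set_integrable lborel {-R..R} (\<lambda>x. \<phi> x *\<^sub>R v x)"
    unfolding set_integrable_def
    by (rule borel_integrable_compact)
       (auto intro!: continuous_intros intro: continuous_on_subset[OF cont\<phi>] continuous_on_subset[OF v])
  have i2: "set_integrable lborel {-R..R} (\<lambda>x. \<phi>' x *\<^sub>R f x)"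
    unfolding set_integrable_def
    by (rule borel_integrable_compact)
       (auto intro!: continuous_intros intro: continuous_on_subset[OF \<phi>'] continuous_on_subset[OF contf])
  have "(LINT x:{-R..R}|lborel. \<phi> x *\<^sub>R v x + \<phi>' x *\<^sub>R f x) = \<phi> R *\<^sub>R f R - \<phi> (-R) *\<^sub>R f (-R)"
    using R cont\<phi> \<phi>' contf v by (intro set_integral_eq_increment[OF deriv]) (auto intro!: continuous_intros)
  also have "\<dots> = 0" using r[of R] r[of "-R"] R by auto
  finally have "(LINT x:{-R..R}|lborel. \<phi> x *\<^sub>R v x) + (LINT x:{-R..R}|lborel. \<phi>' x *\<^sub>R f x) = 0"
    by (simp add: set_integral_add(2)[OF i1 i2])
  moreover have "(LINT x:{-R..R}|lborel. \<phi> x *\<^sub>R v x) = (\<integral>x. \<phi> x *\<^sub>R v x \<partial>lborel)"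
    "(LINT x:{-R..R}|lborel. \<phi>' x *\<^sub>R f x) = (\<integral>x. \<phi>' x *\<^sub>R f x \<partial>lborel)"
    unfolding set_lebesgue_integral_def using outside
    by (intro Bochner_Integration.integral_cong; auto simp: indicator_def)+
  ultimately show "(\<integral>x. \<phi>' x *\<^sub>R f x \<partial>lborel) = - (\<integral>x. \<phi> x *\<^sub>R v x \<partial>lborel)"
    by (simp add: eq_neg_iff_add_eq_0 add.commute)
qed

section \<open>Linear structure, norm, and the sup bound for velocities\<close>

lemma nn_integral_pair_linear:
  fixes F G :: "real \<Rightarrow> real \<Rightarrow> ennreal"
  assumes [measurable]: "case_prod F \<in> borel_measurable (borel \<Otimes>\<^sub>M borel)" "case_prod G \<in> borel_measurable (borel \<Otimes>\<^sub>M borel)"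
  shows "(\<integral>\<^sup>+u. \<integral>\<^sup>+w. a * F u w + b * G u w \<partial>lborel \<partial>lborel) =
    a * (\<integral>\<^sup>+u. \<integral>\<^sup>+w. F u w \<partial>lborel \<partial>lborel) + b * (\<integral>\<^sup>+u. \<integral>\<^sup>+w. G u w \<partial>lborel \<partial>lborel)"
proof -
  have inner: "(\<integral>\<^sup>+w. a * F u w + b * G u w \<partial>lborel) = a * (\<integral>\<^sup>+w. F u w \<partial>lborel) + b * (\<integral>\<^sup>+w. G u w \<partial>lborel)" for u
    by (subst nn_integral_add) (auto simp: nn_integral_cmult)
  show ?thesis
    unfolding inner by (subst nn_integral_add) (auto simp: nn_integral_cmult)
qed

text \<open>A crude triangle inequality for the \<rho>-th power. It serves to show that the space is
  closed under linear combinations, for which the constant does not matter.\<close>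

lemma gagliardo_pow_add_scaled_le:
  fixes v k :: "real \<Rightarrow> 'a::euclidean_space"
  assumes v: "continuous_on UNIV v" and k: "continuous_on UNIV k" and \<rho>: "1 \<le> \<rho>"
  shows "gagliardo_pow s \<rho> (\<lambda>x. v x + t *\<^sub>R k x) \<le>
    ennreal (3 powr \<rho>) * gagliardo_pow s \<rho> v + ennreal (3 powr \<rho> * \<bar>t\<bar> powr \<rho>) * gagliardo_pow s \<rho> k"
proof -
  have [measurable]: "v \<in> borel_measurable borel" "k \<in> borel_measurable borel"
    using v k by (auto intro: borel_measurable_continuous_onI)
  define q where "q = 1 + s * \<rho>"
  define Q where "Q g u w = norm (g (u + w) - g u) powr \<rho> / \<bar>w\<bar> powr q" for g :: "real \<Rightarrow> 'a" and u w
  have [measurable]: "(\<lambda>z. Q v (fst z) (snd z)) \<in> borel_measurable (borel \<Otimes>\<^sub>M borel)"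
    "(\<lambda>z. Q k (fst z) (snd z)) \<in> borel_measurable (borel \<Otimes>\<^sub>M borel)"
    unfolding Q_def by measurable
  have point: "ennreal (Q (\<lambda>x. v x + t *\<^sub>R k x) u w) \<le>
      ennreal (3 powr \<rho>) * ennreal (Q v u w) + ennreal (3 powr \<rho> * \<bar>t\<bar> powr \<rho>) * ennreal (Q k u w)" for u w
  proof -
    define a b where "a = v (u + w) - v u" and "b = k (u + w) - k u"
    have "norm (a + t *\<^sub>R b) powr \<rho> \<le> (norm a + norm (t *\<^sub>R b) + 0) powr \<rho>"
      using \<rho> norm_triangle_ineq[of a "t *\<^sub>R b"] by (intro powr_mono2) auto
    also have "\<dots> \<le> 3 powr \<rho> * (norm a powr \<rho> + norm (t *\<^sub>R b) powr \<rho> + 0 powr \<rho>)"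
      using \<rho> by (intro powr_sum3_le) auto
    also have "\<dots> = 3 powr \<rho> * norm a powr \<rho> + 3 powr \<rho> * \<bar>t\<bar> powr \<rho> * norm b powr \<rho>"
      by (simp add: powr_mult algebra_simps)
    finally have "norm (a + t *\<^sub>R b) powr \<rho> / \<bar>w\<bar> powr q \<le>
        (3 powr \<rho> * norm a powr \<rho> + 3 powr \<rho> * \<bar>t\<bar> powr \<rho> * norm b powr \<rho>) / \<bar>w\<bar> powr q"
      by (intro divide_right_mono) auto
    moreover have "(v (u + w) + t *\<^sub>R k (u + w)) - (v u + t *\<^sub>R k u) = a + t *\<^sub>R b"
      by (simp add: a_def b_def algebra_simps)
    ultimately have "Q (\<lambda>x. v x + t *\<^sub>R k x) u w \<le> 3 powr \<rho> * Q v u w + 3 powr \<rho> * \<bar>t\<bar> powr \<rho> * Q k u w"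
      by (simp only: Q_def a_def[symmetric] b_def[symmetric] add_divide_distrib times_divide_eq_right)
    then have "ennreal (Q (\<lambda>x. v x + t *\<^sub>R k x) u w) \<le> ennreal (3 powr \<rho> * Q v u w + 3 powr \<rho> * \<bar>t\<bar> powr \<rho> * Q k u w)"
      by (rule ennreal_leI)
    also have "\<dots> = ennreal (3 powr \<rho>) * ennreal (Q v u w) + ennreal (3 powr \<rho> * \<bar>t\<bar> powr \<rho>) * ennreal (Q k u w)"
    proof -
      have "0 \<le> Q v u w" "0 \<le> Q k u w" by (simp_all add: Q_def)
      then show ?thesis by (simp add: ennreal_plus ennreal_mult')
    qed
    finally show ?thesis .
  qed
  have gag: "gagliardo_pow s \<rho> g = (\<integral>\<^sup>+u. \<integral>\<^sup>+w. ennreal (Q g u w) * indicator {-1/2..1/2} w * indicator {0..1} u \<partial>lborel \<partial>lborel)"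
    if "g \<in> borel_measurable borel" for g
    unfolding gagliardo_pow_def Q_def q_def using that by (subst nn_integral_multc) auto
  have "gagliardo_pow s \<rho> (\<lambda>x. v x + t *\<^sub>R k x) \<le>
     (\<integral>\<^sup>+u. \<integral>\<^sup>+w. ennreal (3 powr \<rho>) * (ennreal (Q v u w) * indicator {-1/2..1/2} w * indicator {0..1} u) +
        ennreal (3 powr \<rho> * \<bar>t\<bar> powr \<rho>) * (ennreal (Q k u w) * indicator {-1/2..1/2} w * indicator {0..1} u) \<partial>lborel \<partial>lborel)"
  proof (subst gag)
    show "(\<lambda>x. v x + t *\<^sub>R k x) \<in> borel_measurable borel" by measurable
    show "(\<integral>\<^sup>+u. \<integral>\<^sup>+w. ennreal (Q (\<lambda>x. v x + t *\<^sub>R k x) u w) * indicator {-1/2..1/2} w * indicator {0..1} u \<partial>lborel \<partial>lborel) \<le>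
     (\<integral>\<^sup>+u. \<integral>\<^sup>+w. ennreal (3 powr \<rho>) * (ennreal (Q v u w) * indicator {-1/2..1/2} w * indicator {0..1} u) +
        ennreal (3 powr \<rho> * \<bar>t\<bar> powr \<rho>) * (ennreal (Q k u w) * indicator {-1/2..1/2} w * indicator {0..1} u) \<partial>lborel \<partial>lborel)"
      using point by (intro nn_integral_mono) (auto simp: indicator_def)
  qed
  also have "\<dots> = ennreal (3 powr \<rho>) * gagliardo_pow s \<rho> v + ennreal (3 powr \<rho> * \<bar>t\<bar> powr \<rho>) * gagliardo_pow s \<rho> k"
  proof -
    have meas: "v \<in> borel_measurable borel" "k \<in> borel_measurable borel" by simp_all
    show ?thesis unfolding gag[OF meas(1)] gag[OF meas(2)] by (rule nn_integral_pair_linear) measurable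
  qed
  finally show ?thesis .
qed

context
  fixes s \<rho> :: real
  assumes \<rho>: "1 \<le> \<rho>" and s: "1 < s * \<rho>"
begin

text \<open>The weak derivative picked by the norm and the classical one have the same interval
  integrals and so agree almost everywhere; every norm can be evaluated on the continuous version.
  The last estimate records the embedding before scaling, with the slope of step 1/2 as
  reference.\<close>

lemma sobolev_velocity:
  fixes f :: "real \<Rightarrow> 'a::euclidean_space"
  assumes f: "f \<in> sobolev_slobodeckij s \<rho>"
  shows "velocity (vel f)" "\<And>x. (f has_vector_derivative vel f x) (at x)"
    "gagliardo_pow s \<rho> (vel f) < \<infinity>"
    "Lp_pow \<rho> (weak_derivative f) = Lp_pow \<rho> (vel f)"
    "gagliardo_pow s \<rho> (weak_derivative f) = gagliardo_pow s \<rho> (vel f)"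
    "\<And>x. norm (vel f x - 2 *\<^sub>R (f (x + 1/2) - f x)) \<le>
      (2 + 4 * enn2real (gagliardo_pow s \<rho> (vel f))) * (\<Sum>n. ((1/2) powr ((s * \<rho> - 1) / \<rho>)) ^ Suc n)"
proof -
  obtain g where contf: "continuous_on UNIV f" and per: "\<And>x. f (x + 1) = f x"
    and fg: "has_weak_derivative f g" and G: "gagliardo_pow s \<rho> g < \<infinity>"
    using f unfolding sobolev_slobodeckij_def by auto
  obtain v where cont: "continuous_on UNIV v" and vper: "\<And>x. v (x + 1) = v x" and v: "\<And>x. (f has_vector_derivative v x) (at x)"
    and bound: "\<And>x. norm (v x - slope f (1/2) x) \<le>
      (2 + 4 * enn2real (gagliardo_pow s \<rho> g)) * (\<Sum>n. ((1/2) powr ((s * \<rho> - 1) / \<rho>)) ^ Suc n)"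
    using slope_limit[OF \<rho> s per contf fg G] by blast
  have vel: "vel f = v" by (rule velI[OF v])
  have locv: "locally_integrable v" by (rule continuous_locally_integrable[OF cont])
  have ae: "AE x in lborel. h x = v x" if h: "has_weak_derivative f h" for h
  proof (rule AE_eq_of_interval_integrals[OF _ locv])
    show "locally_integrable h" using h by (simp add: has_weak_derivative_def)
    show "(LINT x:{a..b}|lborel. h x) = (LINT x:{a..b}|lborel. v x)" if "a \<le> b" for a b
      using weak_derivative_integral[OF h contf that] set_integral_eq_increment[OF v cont that] by simp
  qed
  have gag: "gagliardo_pow s \<rho> h = gagliardo_pow s \<rho> v" if h: "has_weak_derivative f h" for h
    using gagliardo_pow_cong_AE[OF _ _ ae[OF h]] locally_integrable_measurable[OF locv]
      locally_integrable_measurable[of h] h by (simp add: has_weak_derivative_def)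
  have wd: "has_weak_derivative f (weak_derivative f)"
    unfolding weak_derivative_def by (rule someI[of "has_weak_derivative f", OF fg])
  show "velocity (vel f)"
    unfolding vel velocity_def
  proof (intro conjI cont allI vper)
    have "integral {0..1} v = f (0 + 1) - f 0"
      using integral_segment_eq[OF v, of 1 0] by simp
    then show "integral {0..1} v = 0" by (simp only: per) simp
  qed
  show "(f has_vector_derivative vel f x) (at x)" for x unfolding vel by (rule v)
  show "gagliardo_pow s \<rho> (vel f) < \<infinity>" unfolding vel gag[OF fg, symmetric] by (rule G)
  show "Lp_pow \<rho> (weak_derivative f) = Lp_pow \<rho> (vel f)" unfolding vel by (rule Lp_pow_cong_AE[OF ae[OF wd]])
  show "gagliardo_pow s \<rho> (weak_derivative f) = gagliardo_pow s \<rho> (vel f)" unfolding vel by (rule gag[OF wd])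
  show "norm (vel f x - 2 *\<^sub>R (f (x + 1/2) - f x)) \<le>
      (2 + 4 * enn2real (gagliardo_pow s \<rho> (vel f))) * (\<Sum>n. ((1/2) powr ((s * \<rho> - 1) / \<rho>)) ^ Suc n)" for x
    using bound[of x] by (simp add: vel gag[OF fg] slope_def[OF \<rho> s per contf fg G])
qed

text \<open>The zero mean contained in \<open>velocity\<close> makes the primitive \<open>f\<close>
  periodic; continuity covers all local integrability.\<close>

lemma sobolevI:
  fixes f v :: "real \<Rightarrow> 'a::euclidean_space"
  assumes f: "\<And>x. (f has_vector_derivative v x) (at x)" and v: "velocity v" and G: "gagliardo_pow s \<rho> v < \<infinity>"
  shows "f \<in> sobolev_slobodeckij s \<rho>"
proof -
  note cont = velocityD(1)[OF v]
  have contf: "continuous_on UNIV f"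
    using f by (auto intro!: continuous_at_imp_continuous_on has_vector_derivative_continuous)
  have "f (x + 1) - f x = 0" for x
    using antiderivative_period_increment[OF f velocityD(2)[OF v]] velocityD(3)[OF v] by simp
  moreover have "Lp_loc \<rho> h" if h: "continuous_on UNIV h" for h :: "real \<Rightarrow> 'a"
    unfolding Lp_loc_def
  proof (intro conjI allI)
    show "h \<in> borel_measurable borel" using h by (rule borel_measurable_continuous_onI)
    have "continuous_on UNIV (\<lambda>x. norm (h x) powr \<rho>)"
      using h \<rho> by (intro continuous_on_powr' continuous_intros) auto
    then show "set_integrable lborel {a..b} (\<lambda>x. norm (h x) powr \<rho>)" for a b
      using continuous_locally_integrable by (auto simp: locally_integrable_def)
  qed
  ultimately show ?thesis
    unfolding sobolev_slobodeckij_def using contf cont G has_weak_derivative_of_derivative[OF f cont] by auto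
qed

lemma sobolev_add_scaled:
  fixes f h :: "real \<Rightarrow> 'a::euclidean_space"
  assumes f: "f \<in> sobolev_slobodeckij s \<rho>" and h: "h \<in> sobolev_slobodeckij s \<rho>"
  shows "(\<lambda>x. f x + t *\<^sub>R h x) \<in> sobolev_slobodeckij s \<rho>"
    "vel (\<lambda>x. f x + t *\<^sub>R h x) = (\<lambda>x. vel f x + t *\<^sub>R vel h x)"
proof -
  have d: "((\<lambda>x. f x + t *\<^sub>R h x) has_vector_derivative vel f x + t *\<^sub>R vel h x) (at x)" for x
    by (intro has_vector_derivative_add bounded_linear.has_vector_derivative[OF bounded_linear_scaleR_right]
        sobolev_velocity(2)[OF f] sobolev_velocity(2)[OF h])
  show "vel (\<lambda>x. f x + t *\<^sub>R h x) = (\<lambda>x. vel f x + t *\<^sub>R vel h x)" by (rule velI[OF d])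
  have "gagliardo_pow s \<rho> (\<lambda>x. vel f x + t *\<^sub>R vel h x) \<le>
     ennreal (3 powr \<rho>) * gagliardo_pow s \<rho> (vel f) + ennreal (3 powr \<rho> * \<bar>t\<bar> powr \<rho>) * gagliardo_pow s \<rho> (vel h)"
    by (rule gagliardo_pow_add_scaled_le[OF _ _ \<rho>]) (use velocityD(1) sobolev_velocity(1)[OF f] sobolev_velocity(1)[OF h] in auto)
  also have "\<dots> < \<infinity>"
    using sobolev_velocity(3)[OF f] sobolev_velocity(3)[OF h] by (simp add: ennreal_mult_less_top)
  finally show "(\<lambda>x. f x + t *\<^sub>R h x) \<in> sobolev_slobodeckij s \<rho>"
    by (rule sobolevI[OF d velocity_add_scaled[OF sobolev_velocity(1)[OF f] sobolev_velocity(1)[OF h]]])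
qed

lemma zero_in_sobolev: "(\<lambda>x. 0) \<in> sobolev_slobodeckij s \<rho>"
proof (rule sobolevI[where v = "\<lambda>_. 0"])
  show "velocity (\<lambda>_. 0)" by (simp add: velocity_def)
  show "gagliardo_pow s \<rho> (\<lambda>_. 0) < \<infinity>" using \<rho> by (simp add: gagliardo_pow_def)
qed auto

lemma sobolev_scaled:
  fixes h :: "real \<Rightarrow> 'a::euclidean_space"
  assumes h: "h \<in> sobolev_slobodeckij s \<rho>"
  shows "(\<lambda>x. t *\<^sub>R h x) \<in> sobolev_slobodeckij s \<rho>" "vel (\<lambda>x. t *\<^sub>R h x) = (\<lambda>x. t *\<^sub>R vel h x)"
proof -
  have "vel (\<lambda>_. 0 :: 'a) = (\<lambda>_. 0)" by (rule velI) auto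
  then show "(\<lambda>x. t *\<^sub>R h x) \<in> sobolev_slobodeckij s \<rho>" "vel (\<lambda>x. t *\<^sub>R h x) = (\<lambda>x. t *\<^sub>R vel h x)"
    using sobolev_add_scaled[OF zero_in_sobolev h, of t] by (simp_all add: vel_def)
qed

lemma sobolev_diff:
  fixes f h :: "real \<Rightarrow> 'a::euclidean_space"
  assumes f: "f \<in> sobolev_slobodeckij s \<rho>" and h: "h \<in> sobolev_slobodeckij s \<rho>"
  shows "(\<lambda>x. f x - h x) \<in> sobolev_slobodeckij s \<rho>" "vel (\<lambda>x. f x - h x) = (\<lambda>x. vel f x - vel h x)"
  using sobolev_add_scaled[OF f h, of "-1"] by auto

lemma Lp_pow_continuous:
  fixes h :: "real \<Rightarrow> 'a::euclidean_space"
  assumes "continuous_on UNIV h"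
  shows "Lp_pow \<rho> h = ennreal (integral {0..1} (\<lambda>x. norm (h x) powr \<rho>))"
  unfolding Lp_pow_def
proof (rule nn_integral_Icc_eq_integral)
  have [measurable]: "h \<in> borel_measurable borel" using assms by (rule borel_measurable_continuous_onI)
  show "(\<lambda>x. norm (h x) powr \<rho>) \<in> borel_measurable borel" by measurable
  show "continuous_on {0..1} (\<lambda>x. norm (h x) powr \<rho>)"
    using assms \<rho> by (intro continuous_on_powr' continuous_on_norm continuous_on_const continuous_on_subset[OF assms]) auto
qed auto

lemma sobolev_continuous: "f \<in> sobolev_slobodeckij s \<rho> \<Longrightarrow> continuous_on UNIV f"
  by (simp add: sobolev_slobodeckij_def)

definition norm_pow :: "(real \<Rightarrow> 'a::euclidean_space) \<Rightarrow> ennreal" where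
  "norm_pow f = Lp_pow \<rho> f + Lp_pow \<rho> (vel f) + gagliardo_pow s \<rho> (vel f)"

lemma norm_pow:
  assumes f: "f \<in> sobolev_slobodeckij s \<rho>"
  shows "norm_pow f < \<infinity>" "sobolev_slobodeckij_norm s \<rho> f = enn2real (norm_pow f) powr (1 / \<rho>)"
    "ennreal (sobolev_slobodeckij_norm s \<rho> f powr \<rho>) = norm_pow f"
proof -
  show fin: "norm_pow f < \<infinity>"
    unfolding norm_pow_def
    using Lp_pow_continuous[OF sobolev_continuous[OF f]] Lp_pow_continuous[OF velocityD(1)[OF sobolev_velocity(1)[OF f]]]
      sobolev_velocity(3)[OF f] by simp
  show N: "sobolev_slobodeckij_norm s \<rho> f = enn2real (norm_pow f) powr (1 / \<rho>)"
    by (simp add: sobolev_slobodeckij_norm_def norm_pow_def sobolev_velocity(4,5)[OF f])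
  show "ennreal (sobolev_slobodeckij_norm s \<rho> f powr \<rho>) = norm_pow f"
    unfolding N using fin \<rho> by (simp add: powr_powr less_top)
qed

lemma Lp_pow_scaled:
  fixes h :: "real \<Rightarrow> 'a::euclidean_space"
  assumes [measurable]: "h \<in> borel_measurable borel"
  shows "Lp_pow \<rho> (\<lambda>x. t *\<^sub>R h x) = ennreal (\<bar>t\<bar> powr \<rho>) * Lp_pow \<rho> h"
  unfolding Lp_pow_def
  by (subst nn_integral_cmult[symmetric]) (auto simp: powr_mult ennreal_mult mult.assoc)

lemma gagliardo_pow_scaled:
  fixes h :: "real \<Rightarrow> 'a::euclidean_space"
  assumes [measurable]: "h \<in> borel_measurable borel"
  shows "gagliardo_pow s \<rho> (\<lambda>x. t *\<^sub>R h x) = ennreal (\<bar>t\<bar> powr \<rho>) * gagliardo_pow s \<rho> h"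
proof -
  have "ennreal (norm (t *\<^sub>R h (u + w) - t *\<^sub>R h u) powr \<rho> / \<bar>w\<bar> powr (1 + s * \<rho>)) =
      ennreal (\<bar>t\<bar> powr \<rho>) * ennreal (norm (h (u + w) - h u) powr \<rho> / \<bar>w\<bar> powr (1 + s * \<rho>))" for u w
    by (simp add: powr_mult ennreal_mult[symmetric] flip: scaleR_diff_right)
  then show ?thesis
    unfolding gagliardo_pow_def by (simp add: nn_integral_cmult mult.assoc)
qed

lemma sobolev_norm_scaled:
  fixes f :: "real \<Rightarrow> 'a::euclidean_space"
  assumes f: "f \<in> sobolev_slobodeckij s \<rho>"
  shows "sobolev_slobodeckij_norm s \<rho> (\<lambda>x. t *\<^sub>R f x) = \<bar>t\<bar> * sobolev_slobodeckij_norm s \<rho> f"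
proof -
  have "norm_pow (\<lambda>x. t *\<^sub>R f x) = ennreal (\<bar>t\<bar> powr \<rho>) * norm_pow f"
    unfolding norm_pow_def sobolev_scaled(2)[OF f]
    using borel_measurable_continuous_onI[OF sobolev_continuous[OF f]]
      borel_measurable_continuous_onI[OF velocityD(1)[OF sobolev_velocity(1)[OF f]]]
    by (simp add: Lp_pow_scaled gagliardo_pow_scaled distrib_left)
  then have "sobolev_slobodeckij_norm s \<rho> (\<lambda>x. t *\<^sub>R f x) = (\<bar>t\<bar> powr \<rho> * enn2real (norm_pow f)) powr (1 / \<rho>)"
    by (simp add: norm_pow(2)[OF sobolev_scaled(1)[OF f]] enn2real_mult)
  also have "\<dots> = \<bar>t\<bar> * sobolev_slobodeckij_norm s \<rho> f"
    using \<rho> by (simp add: powr_mult powr_powr norm_pow(2)[OF f])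
  finally show ?thesis .
qed

lemma sobolev_norm_nonneg: "0 \<le> sobolev_slobodeckij_norm s \<rho> f"
  by (simp add: sobolev_slobodeckij_norm_def)

lemma gagliardo_pow_le_norm:
  assumes f: "f \<in> sobolev_slobodeckij s \<rho>"
  shows "gagliardo_pow s \<rho> (vel f) \<le> ennreal (sobolev_slobodeckij_norm s \<rho> f powr \<rho>)"
  unfolding norm_pow(3)[OF f] norm_pow_def by (simp add: add_increasing)

text \<open>The inequality \<open>y \<le> 1 + y powr \<rho>\<close> stands in for Hoelder. The bound
  is inhomogeneous, which does no harm as it is applied on the unit ball.\<close>

lemma norm_increment_le:
  fixes f :: "real \<Rightarrow> 'a::euclidean_space"
  assumes f: "f \<in> sobolev_slobodeckij s \<rho>"
  shows "norm (f (x + 1/2) - f x) \<le> 1 + enn2real (Lp_pow \<rho> (vel f))"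
proof -
  note vel = sobolev_velocity(1)[OF f] and cont = velocityD(1)[OF sobolev_velocity(1)[OF f]]
  obtain S where S: "\<And>x. (S has_vector_derivative norm (vel f x)) (at x)"
    using continuous_imp_antiderivative[OF continuous_on_norm[OF cont]] by blast
  have "f (x + 1/2) - f x = (1/2) *\<^sub>R integral {0..1} (\<lambda>t. vel f (x + t * (1/2)))"
    by (rule integral_segment_eq[OF sobolev_velocity(2)[OF f], symmetric])
  then have "norm (f (x + 1/2) - f x) \<le> (1/2) *\<^sub>R integral {0..1} (\<lambda>t. norm (vel f (x + t * (1/2))))"
    using integral_norm_bound_integral[of "\<lambda>t. vel f (x + t * (1/2))" "{0..1}" "\<lambda>t. norm (vel f (x + t * (1/2)))"]
      velocity_continuous_segment[OF vel, of "{0..1}" x "1/2"]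
    by (simp add: integrable_continuous_real continuous_on_norm)
  also have "\<dots> = S (x + 1/2) - S x" by (rule integral_segment_eq[OF S])
  also have "\<dots> \<le> S (x + 1) - S x"
  proof -
    have "S (x + 1/2) \<le> S (x + 1)"
      by (rule DERIV_nonneg_imp_nondecreasing)
         (use S in \<open>auto simp flip: has_real_derivative_iff_has_vector_derivative intro!: exI norm_ge_zero\<close>)
    then show ?thesis by simp
  qed
  also have "\<dots> = integral {0..1} (\<lambda>t. norm (vel f t))"
    by (rule antiderivative_period_increment[OF S]) (simp add: velocityD(2)[OF vel])
  also have "\<dots> \<le> integral {0..1} (\<lambda>t. 1 + norm (vel f t) powr \<rho>)"
  proof (rule integral_le)
    have c: "continuous_on {0..1} (\<lambda>x. norm (vel f x) powr \<rho>)"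
      using \<rho> by (intro continuous_on_powr' continuous_on_norm continuous_on_const velocityD(1)[OF vel]) auto
    then show "(\<lambda>t. 1 + norm (vel f t) powr \<rho>) integrable_on {0..1}"
      by (intro integrable_continuous_real continuous_on_add continuous_on_const)
    show "(\<lambda>t. norm (vel f t)) integrable_on {0..1}"
      by (intro integrable_continuous_real continuous_on_norm velocityD(1)[OF vel])
    show "norm (vel f t) \<le> 1 + norm (vel f t) powr \<rho>" for t
      using le_add_powr[of "norm (vel f t)" 1 \<rho>] \<rho> by simp
  qed
  also have "\<dots> = 1 + enn2real (Lp_pow \<rho> (vel f))"
  proof -
    have c: "continuous_on {0..1} (\<lambda>x. norm (vel f x) powr \<rho>)"
      using \<rho> by (intro continuous_on_powr' continuous_on_norm continuous_on_const velocityD(1)[OF vel]) auto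
    have "0 \<le> integral {0..1} (\<lambda>t. norm (vel f t) powr \<rho>)"
      by (intro integral_nonneg integrable_continuous_real c) auto
    then show ?thesis
      by (simp add: integral_add integrable_continuous_real c Lp_pow_continuous[OF cont])
  qed
  finally show ?thesis .
qed

text \<open>A constant on the unit ball is extended by scaling.\<close>

lemma norm_velocity_le_sobolev_norm:
  obtains K where "0 \<le> K"
    "\<And>(f :: real \<Rightarrow> 'a::euclidean_space) x. f \<in> sobolev_slobodeckij s \<rho> \<Longrightarrow> norm (vel f x) \<le> K * sobolev_slobodeckij_norm s \<rho> f"
proof -
  define S where "S = (\<Sum>n. ((1/2::real) powr ((s * \<rho> - 1) / \<rho>)) ^ Suc n)"
  \<comment> \<open>On the unit ball the slope of step 1/2 contributes \<open>2 * (1 + 1)\<close>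
    and the tail of the dyadic series \<open>(2 + 4 * 1) * \<bar>S\<bar>\<close>.\<close>
  define K where "K = 4 + 6 * \<bar>S\<bar>"
  have unit: "norm (vel f x) \<le> K"
    if f: "f \<in> sobolev_slobodeckij s \<rho>" and N: "sobolev_slobodeckij_norm s \<rho> f \<le> 1" for f :: "real \<Rightarrow> 'a" and x
  proof -
    have "norm_pow f = ennreal (sobolev_slobodeckij_norm s \<rho> f powr \<rho>)" by (rule norm_pow(3)[OF f, symmetric])
    also have "\<dots> \<le> ennreal 1"
      using N \<rho> sobolev_norm_nonneg[of f] by (intro ennreal_leI powr_le1) auto
    finally have np: "norm_pow f \<le> 1" by simp
    have L: "Lp_pow \<rho> (vel f) \<le> 1" and G: "gagliardo_pow s \<rho> (vel f) \<le> 1"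
      using np unfolding norm_pow_def
      by (meson add_increasing add_increasing2 order.trans order_refl zero_le)+
    have L': "enn2real (Lp_pow \<rho> (vel f)) \<le> 1" and G': "enn2real (gagliardo_pow s \<rho> (vel f)) \<le> 1"
      using enn2real_mono[OF L] enn2real_mono[OF G] by auto
    have "norm (vel f x) \<le> norm (2 *\<^sub>R (f (x + 1/2) - f x)) + norm (vel f x - 2 *\<^sub>R (f (x + 1/2) - f x))"
      by (metis add.commute diff_add_cancel norm_triangle_ineq)
    also have "\<dots> \<le> 2 * (1 + 1) + (2 + 4 * 1) * \<bar>S\<bar>"
    proof (rule add_mono)
      show "norm (2 *\<^sub>R (f (x + 1/2) - f x)) \<le> 2 * (1 + 1)"
        using norm_increment_le[OF f, of x] L' by simp
      have "norm (vel f x - 2 *\<^sub>R (f (x + 1/2) - f x)) \<le> (2 + 4 * enn2real (gagliardo_pow s \<rho> (vel f))) * S"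
        unfolding S_def by (rule sobolev_velocity(6)[OF f])
      also have "\<dots> \<le> (2 + 4 * enn2real (gagliardo_pow s \<rho> (vel f))) * \<bar>S\<bar>"
        by (intro mult_left_mono) auto
      also have "\<dots> \<le> (2 + 4 * 1) * \<bar>S\<bar>"
        using G' by (intro mult_right_mono) auto
      finally show "norm (vel f x - 2 *\<^sub>R (f (x + 1/2) - f x)) \<le> (2 + 4 * 1) * \<bar>S\<bar>" .
    qed
    finally show ?thesis by (simp add: K_def)
  qed
  show thesis
  proof (rule that)
    show "0 \<le> K" by (simp add: K_def)
    fix f :: "real \<Rightarrow> 'a" and x assume f: "f \<in> sobolev_slobodeckij s \<rho>"
    define N where "N = sobolev_slobodeckij_norm s \<rho> f"
    have scaled: "t * norm (vel f x) \<le> K" if "0 \<le> t" "t * N \<le> 1" for t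
      using unit[OF sobolev_scaled(1)[OF f], of t x] that by (simp add: sobolev_norm_scaled[OF f] N_def sobolev_scaled(2)[OF f])
    show "norm (vel f x) \<le> K * sobolev_slobodeckij_norm s \<rho> f"
    proof (cases "N = 0")
      case True
      \<comment> \<open>Definiteness of the norm is not presupposed: if it vanishes, arbitrarily
        large multiples of \<open>f\<close> lie in the unit ball and their velocities remain bounded
        by \<open>K\<close>.\<close>
      have "vel f x = 0"
      proof (rule ccontr)
        assume "vel f x \<noteq> 0"
        then show False
          using scaled[of "(K + 1) / norm (vel f x)"] True by (simp add: K_def)
      qed
      then show ?thesis using True by (simp add: N_def)
    next
      case False
      then have "0 < N" using sobolev_norm_nonneg[of f] by (simp add: N_def)
      then show ?thesis using scaled[of "1 / N"] by (simp add: N_def field_simps)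
    qed
  qed
qed

end

section \<open>Injective regular curves\<close>

lemma chord_periodic:
  assumes "velocity v"
  shows "chord v (x + 1) w = chord v x w"
proof -
  have "v (x + 1 + t * w) = v (x + t * w)" for t
    using velocityD(2)[OF assms, of "x + t * w"] by (simp add: add_ac)
  then show ?thesis by (simp add: chord_def)
qed

context
  fixes f v :: "real \<Rightarrow> 'a::euclidean_space"
  assumes f: "\<And>x. (f has_vector_derivative v x) (at x)" and v: "velocity v"
begin

lemma curve_periodic: "f (x + 1) = f x"
  using antiderivative_period_increment[OF f velocityD(2)[OF v], of x] velocityD(3)[OF v] by simp

lemma scaled_chord: "w *\<^sub>R chord v x w = f (x + w) - f x"
  unfolding chord_def by (rule integral_segment_eq[OF f])

text \<open>A vanishing chord contradicts regularity at \<open>w = 0\<close>; for other offsets it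
  makes two values of the curve coincide, and injectivity modulo 1 would force \<open>w\<close> to
  be a nonzero integer, too large. Continuity and compactness over one period turn this into a
  positive minimum.\<close>

lemma injective_regular_imp_nondegenerate:
  assumes ir: "injective_regular f"
  obtains c C where "0 < c" "nondegenerate c C v"
proof -
  have nz: "chord v x w \<noteq> 0" if w: "\<bar>w\<bar> \<le> 1/2" for x w
  proof (cases "w = 0")
    case True
    obtain d where d: "(f has_vector_derivative d) (at x)" "d \<noteq> 0"
      using ir by (auto simp: injective_regular_def)
    then have "v x = d" using vector_derivative_unique_at[OF f] by blast
    then show ?thesis using True d by (simp add: chord_def)
  next
    case False
    show ?thesis
    proof
      assume "chord v x w = 0"
      then have "f (x + w) = f x" using scaled_chord[of w x] by simp
      then have "f (frac (x + w)) = f (frac x)"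
        using periodic_frac[of f, OF curve_periodic] by metis
      moreover have "inj_on f {0..<1}" using ir by (simp add: injective_regular_def)
      ultimately have "frac (x + w) = frac x"
        by (auto simp: inj_on_def frac_lt_1)
      then have "w = of_int (\<lfloor>x + w\<rfloor> - \<lfloor>x\<rfloor>)" by (simp add: frac_def)
      then obtain k :: int where "w = of_int k" by blast
      then show False using w False by (cases "k = 0") auto
    qed
  qed
  have cont: "continuous_on ({0..1} \<times> {-1/2..1/2}) (\<lambda>z. norm (chord v (fst z) (snd z)))"
    using continuous_on_subset[OF continuous_on_chord[OF v]] by (intro continuous_on_norm) auto
  have "compact ({0..1::real} \<times> {-1/2..1/2::real})" by (intro compact_Times) auto
  from continuous_attains_inf[OF this _ cont]
  obtain z where z: "z \<in> {0..1} \<times> {-1/2..1/2}"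
    "\<And>y. y \<in> {0..1} \<times> {-1/2..1/2} \<Longrightarrow> norm (chord v (fst z) (snd z)) \<le> norm (chord v (fst y) (snd y))"
    by auto
  define c where "c = norm (chord v (fst z) (snd z))"
  have "\<bar>snd z\<bar> \<le> 1/2" using z(1) by (auto simp: abs_le_iff)
  then have c: "0 < c" using nz[of "snd z" "fst z"] by (simp add: c_def)
  have "bounded (v ` {0..1})"
    by (intro compact_imp_bounded compact_continuous_image velocityD(1)[OF v]) auto
  then obtain C where C: "\<forall>y\<in>v ` {0..1}. norm y \<le> C" unfolding bounded_iff by blast
  show thesis
  proof (rule that[OF c])
    show "nondegenerate c C v"
      unfolding nondegenerate_def
    proof (intro conjI v allI impI)
      fix x
      have "v x = v (frac x)" by (rule periodic_frac) (rule velocityD(2)[OF v])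
      then show "norm (v x) \<le> C" using C frac_lt_1[of x] by (simp add: less_imp_le)
      fix w :: real assume w: "\<bar>w\<bar> \<le> 1/2"
      have frac: "chord v x w = chord v (frac x) w"
        by (rule periodic_frac[of "\<lambda>x. chord v x w"]) (rule chord_periodic[OF v])
      show "c \<le> norm (chord v x w)"
      proof -
        have "(frac x, w) \<in> {0..1} \<times> {-1/2..1/2}"
          using w frac_lt_1[of x] by (simp add: abs_le_iff less_imp_le) linarith
        from z(2)[OF this] show ?thesis by (simp add: c_def frac)
      qed
    qed
  qed
qed

text \<open>Two parameters of one period that are more than 1/2 apart come within 1/2 of each other
  after shifting one of them by a period.\<close>

lemma nondegenerate_imp_injective_regular:
  assumes nd: "nondegenerate c C v" and c: "0 < c"
  shows "injective_regular f"
  unfolding injective_regular_def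
proof (intro conjI allI)
  show "\<exists>d. (f has_vector_derivative d) (at x) \<and> d \<noteq> 0" for x
    using f[of x] velocity_nonzero[OF nd c] by blast
  have ne: "f (x + w) \<noteq> f x" if "\<bar>w\<bar> \<le> 1/2" "w \<noteq> 0" for x w
  proof
    assume "f (x + w) = f x"
    then have "chord v x w = 0" using scaled_chord[of w x] that by simp
    then show False using norm_chord_ge[OF nd c that(1), of x] c by simp
  qed
  show "inj_on f {0..<1}"
  proof (rule inj_onI, rule ccontr)
    fix x y :: real assume xy: "x \<in> {0..<1}" "y \<in> {0..<1}" "f x = f y" "x \<noteq> y"
    consider "\<bar>y - x\<bar> \<le> 1/2" | "1/2 < y - x" | "1/2 < x - y" by linarith
    then show False
    proof cases
      case 1
      then show False using ne[of "y - x" x] xy by simp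
    next
      case 2
      then show False using ne[of "y - x - 1" "x + 1"] curve_periodic[of x] xy by auto
    next
      case 3
      then show False using ne[of "x - y - 1" "y + 1"] curve_periodic[of y] xy by auto
    qed
  qed
qed

end

section \<open>The energy in chord-arc coordinates\<close>

lemma nn_integral_split_Icc:
  fixes h :: "real \<Rightarrow> ennreal"
  assumes [measurable]: "h \<in> borel_measurable borel" and "a \<le> b" "b \<le> c"
  shows "(\<integral>\<^sup>+y\<in>{a..c}. h y \<partial>lborel) = (\<integral>\<^sup>+y\<in>{a..b}. h y \<partial>lborel) + (\<integral>\<^sup>+y\<in>{b..c}. h y \<partial>lborel)"
proof -
  have "(\<integral>\<^sup>+y\<in>{a..c}. h y \<partial>lborel) = (\<integral>\<^sup>+y. h y * indicator {a..b} y + h y * indicator {b..c} y \<partial>lborel)"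
  proof (rule nn_integral_cong_AE)
    show "AE y in lborel. h y * indicator {a..c} y = h y * indicator {a..b} y + h y * indicator {b..c} y"
      using AE_lborel_singleton[of b] by eventually_elim (use assms in \<open>auto simp: indicator_def\<close>)
  qed
  then show ?thesis by (simp add: nn_integral_add)
qed

lemma nn_integral_shift_Icc:
  fixes h :: "real \<Rightarrow> ennreal"
  assumes [measurable]: "h \<in> borel_measurable borel"
  shows "(\<integral>\<^sup>+y\<in>{t + a..t + b}. h y \<partial>lborel) = (\<integral>\<^sup>+y\<in>{a..b}. h (t + y) \<partial>lborel)"
proof -
  have "(\<integral>\<^sup>+y\<in>{t + a..t + b}. h y \<partial>lborel) = (\<integral>\<^sup>+y. h (t + 1 * y) * indicator {t + a..t + b} (t + 1 * y) \<partial>lborel)"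
    using nn_integral_real_affine[of "\<lambda>y. h y * indicator {t + a..t + b} y" 1 t] by simp
  also have "\<dots> = (\<integral>\<^sup>+y\<in>{a..b}. h (t + y) \<partial>lborel)"
    by (intro nn_integral_cong) (auto simp: indicator_def)
  finally show ?thesis .
qed

text \<open>The window around \<open>x\<close> starts at a point of \<open>{0..1}\<close> if
  \<open>x \<ge> 1/2\<close>; otherwise it does so after a shift by one period.\<close>

lemma nn_integral_periodic:
  fixes h :: "real \<Rightarrow> ennreal"
  assumes [measurable]: "h \<in> borel_measurable borel" and per: "\<And>y. h (1 + y) = h y"
    and x: "x \<in> {0..1}"
  shows "(\<integral>\<^sup>+y\<in>{0..1}. h y \<partial>lborel) = (\<integral>\<^sup>+w\<in>{-1/2..1/2}. h (x + w) \<partial>lborel)"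
proof -
  have period: "(\<integral>\<^sup>+y\<in>{a..a + 1}. h y \<partial>lborel) = (\<integral>\<^sup>+y\<in>{0..1}. h y \<partial>lborel)" if a: "0 \<le> a" "a \<le> 1" for a
  proof -
    have "(\<integral>\<^sup>+y\<in>{a..a + 1}. h y \<partial>lborel) = (\<integral>\<^sup>+y\<in>{a..1}. h y \<partial>lborel) + (\<integral>\<^sup>+y\<in>{1..a + 1}. h y \<partial>lborel)"
      using a by (intro nn_integral_split_Icc) auto
    also have "(\<integral>\<^sup>+y\<in>{1..a + 1}. h y \<partial>lborel) = (\<integral>\<^sup>+y\<in>{0..a}. h y \<partial>lborel)"
      using nn_integral_shift_Icc[of h 1 0 a] by (simp add: per add.commute[of a])
    also have "(\<integral>\<^sup>+y\<in>{a..1}. h y \<partial>lborel) + (\<integral>\<^sup>+y\<in>{0..a}. h y \<partial>lborel) = (\<integral>\<^sup>+y\<in>{0..1}. h y \<partial>lborel)"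
      using a nn_integral_split_Icc[of h 0 a 1] by (simp add: add.commute)
    finally show ?thesis .
  qed
  have "(\<integral>\<^sup>+w\<in>{-1/2..1/2}. h (x + w) \<partial>lborel) = (\<integral>\<^sup>+y\<in>{x - 1/2..x + 1/2}. h y \<partial>lborel)"
    using nn_integral_shift_Icc[of h x "-1/2" "1/2"] by simp
  also have "\<dots> = (\<integral>\<^sup>+y\<in>{0..1}. h y \<partial>lborel)"
  proof (cases "1/2 \<le> x")
    case True
    have "x - 1/2 + 1 = x + 1/2" by simp
    then show ?thesis using period[of "x - 1/2"] x True by (simp only:) simp
  next
    case False
    have "(\<integral>\<^sup>+y\<in>{x - 1/2..x + 1/2}. h y \<partial>lborel) = (\<integral>\<^sup>+y\<in>{1 + (x - 1/2)..1 + (x + 1/2)}. h y \<partial>lborel)"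
      using nn_integral_shift_Icc[of h 1 "x - 1/2" "x + 1/2"] by (simp add: per)
    also have "\<dots> = (\<integral>\<^sup>+y\<in>{0..1}. h y \<partial>lborel)" using period[of "x + 1/2"] x False by (simp add: add_ac)
    finally show ?thesis .
  qed
  finally show ?thesis by simp
qed

text \<open>For fixed \<open>x\<close> the substitution \<open>y = x + w\<close> and periodicity
  lead to the strip. Chord and distance both carry the factor \<open>\<bar>w\<bar>\<close>, which
  leaves the base of the power as \<open>\<bar>w\<bar> powr (-\<alpha>)\<close>.\<close>

lemma ohara_energy_eq_strip:
  fixes f v :: "real \<Rightarrow> 'a::euclidean_space"
  assumes f: "\<And>x. (f has_vector_derivative v x) (at x)" and nd: "nondegenerate c C v" and c: "0 < c"
    and \<alpha>: "0 < \<alpha>" and p: "1 \<le> p"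
  shows "ohara_energy \<alpha> p f = (\<integral>\<^sup>+z. ennreal (energy_density \<alpha> p v (fst z) (snd z)) \<partial>strip (\<alpha> * p))"
proof -
  note vel = nondegenerate_velocity[OF nd c]
  have contf: "continuous_on UNIV f"
    using f by (auto intro!: continuous_at_imp_continuous_on has_vector_derivative_continuous)
  have speed: "speed f x = norm (v x)" for x
    by (simp add: speed_def vector_derivative_at[OF f])
  have contv: "continuous_on UNIV v" by (rule velocityD(1)[OF vel])
  obtain S where S: "\<And>x. (S has_vector_derivative norm (v x)) (at x)"
    using continuous_imp_antiderivative[OF continuous_on_norm[OF contv]] by blast
  define L where "L = arc_mean v 0 1"
  have Sw: "w * arc_mean v x w = S (x + w) - S x" for x w
    unfolding arc_mean_def using integral_segment_eq[OF S, of w x] by simp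
  have S1: "S (x + 1) = S x + L" for x
    using antiderivative_period_increment[OF S, of x] velocityD(2)[OF vel] by (simp add: L_def arc_mean_def)
  have arc: "arc_length f a b = S b - S a" if "a \<le> b" for a b
    unfolding arc_length_def speed
    by (rule set_integral_eq_increment[OF S continuous_on_norm[OF contv] that])
  have dist: "intrinsic_dist f x y = min (S (x + frac (y - x)) - S x) (S (x + 1) - S (x + frac (y - x)))" for x y
    using frac_lt_1[of "y - x"] by (simp add: intrinsic_dist_def Let_def arc)
  define h where "h x y = ennreal ((1 / norm (f x - f y) powr \<alpha> - 1 / intrinsic_dist f x y powr \<alpha>) powr p
                 * speed f x * speed f y)" for x y
  have [measurable]: "S \<in> borel_measurable borel" "f \<in> borel_measurable borel" "v \<in> borel_measurable borel"
    using contf contv S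
    by (auto intro!: borel_measurable_continuous_onI continuous_at_imp_continuous_on has_vector_derivative_continuous)
  have meas: "h x \<in> borel_measurable borel" for x
  proof -
    have [measurable]: "(\<lambda>y. S (x + frac (y - x))) \<in> borel_measurable borel"
    proof -
      have "(\<lambda>y. x + frac (y - x)) \<in> borel_measurable borel"
        unfolding frac_def by (intro borel_measurable_add borel_measurable_diff borel_measurable_const
            measurable_compose[OF _ borel_measurable_real_floor]) simp_all
      from measurable_compose[OF this, of S borel] show ?thesis by simp
    qed
    show ?thesis unfolding h_def dist speed by measurable
  qed
  have per: "h x (1 + y) = h x y" for x y
  proof -
    have fr: "frac (1 + y - x) = frac (y - x)"
      using frac_1_eq[of "y - x"] by (simp add: algebra_simps)
    have "f (1 + y) = f y" "v (1 + y) = v y"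
      using curve_periodic[OF f vel, of y] velocityD(2)[OF vel, of y] by (simp_all add: add.commute)
    then show ?thesis unfolding h_def dist speed fr by (simp only:)
  qed
  have point: "h x (x + w) = ennreal (\<bar>w\<bar> powr (- (\<alpha> * p))) * ennreal (energy_density \<alpha> p v x w)"
    if w: "\<bar>w\<bar> \<le> 1/2" "w \<noteq> 0" for x w
  proof -
    define a where "a = norm (chord v x w)"
    define l where "l = min (arc_mean v x w) (coarc_mean v x w)"
    have pos: "0 < a" "0 < l"
      using norm_chord_ge[OF nd c w(1), of x] arc_mean_bounds(1)[OF nd c, of x w] coarc_mean_ge[OF nd c w, of x] c
      by (auto simp: a_def l_def)
    have "norm (f x - f (x + w)) = norm (f (x + w) - f x)" by (rule norm_minus_commute)
    also have "\<dots> = norm (w *\<^sub>R chord v x w)" by (simp only: scaled_chord[OF f vel])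
    finally have chord: "norm (f x - f (x + w)) = \<bar>w\<bar> * a" by (simp add: a_def)
    have coarc: "\<bar>w\<bar> * coarc_mean v x w = L - \<bar>w\<bar> * arc_mean v x w"
      using w by (simp add: coarc_mean_def L_def right_diff_distrib)
    have d: "intrinsic_dist f x (x + w) = \<bar>w\<bar> * l"
    proof (cases "0 < w")
      case True
      then have "frac w = w" using w by (simp add: frac_eq)
      then have "intrinsic_dist f x (x + w) = min (w * arc_mean v x w) (L - w * arc_mean v x w)"
        by (simp add: dist Sw S1)
      also have "\<dots> = \<bar>w\<bar> * l"
        using True coarc by (simp add: l_def min_mult_distrib_left)
      finally show ?thesis .
    next
      case False
      \<comment> \<open>For negative \<open>w\<close> the representative is
        \<open>x + w + 1\<close>, so the two arcs exchange their roles in the minimum.\<close>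
      then have "frac w = w + 1" using w by (subst frac_unique_iff) auto
      then have "intrinsic_dist f x (x + w) = min (L - (- w) * arc_mean v x w) ((- w) * arc_mean v x w)"
        using S1[of "x + w"] by (simp add: dist S1 Sw add.assoc[symmetric])
      also have "\<dots> = \<bar>w\<bar> * l"
        using False w coarc by (simp add: l_def min_mult_distrib_left min.commute)
      finally show ?thesis .
    qed
    \<comment> \<open>The negative power turns the minimum of the lengths into a maximum, which
      after subtraction is the minimum of the two gaps.\<close>
    have lpow: "l powr (-\<alpha>) = max (arc_mean v x w powr (-\<alpha>)) (coarc_mean v x w powr (-\<alpha>))"
      using arc_mean_bounds(1)[OF nd c, of x w] coarc_mean_ge[OF nd c w, of x] c \<alpha>
        powr_mono2'[of "-\<alpha>" "arc_mean v x w" "coarc_mean v x w"]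
        powr_mono2'[of "-\<alpha>" "coarc_mean v x w" "arc_mean v x w"]
      by (auto simp: l_def min_def max_def)
    have gap: "gap \<alpha> v x w = a powr (-\<alpha>) - l powr (-\<alpha>)"
      unfolding lpow by (auto simp: gap_def near_gap_def far_gap_def a_def)
    have "1 / norm (f x - f (x + w)) powr \<alpha> - 1 / intrinsic_dist f x (x + w) powr \<alpha> = \<bar>w\<bar> powr (-\<alpha>) * gap \<alpha> v x w"
      unfolding chord d gap powr_mult by (simp add: powr_minus divide_inverse right_diff_distrib)
    moreover have "(\<bar>w\<bar> powr (-\<alpha>) * gap \<alpha> v x w) powr p = \<bar>w\<bar> powr (- (\<alpha> * p)) * gap \<alpha> v x w powr p"
      by (simp add: powr_mult powr_powr)
    ultimately have "h x (x + w) = ennreal (\<bar>w\<bar> powr (- (\<alpha> * p)) * energy_density \<alpha> p v x w)"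
      by (simp add: h_def energy_density_def speeds_def speed mult.assoc)
    then show ?thesis
      using energy_density_bounds(1)[OF c \<alpha> nd w p] by (simp add: ennreal_mult)
  qed
  have "ohara_energy \<alpha> p f = (\<integral>\<^sup>+x\<in>{0..1}. (\<integral>\<^sup>+y\<in>{0..1}. h x y \<partial>lborel) \<partial>lborel)"
    by (simp add: ohara_energy_def h_def)
  also have "\<dots> = (\<integral>\<^sup>+x\<in>{0..1}. (\<integral>\<^sup>+w\<in>{-1/2..1/2}.
      ennreal (\<bar>w\<bar> powr (- (\<alpha> * p))) * ennreal (energy_density \<alpha> p v x w) \<partial>lborel) \<partial>lborel)"
  proof (rule nn_integral_cong)
    fix x :: real
    have "(\<integral>\<^sup>+y\<in>{0..1}. h x y \<partial>lborel) = (\<integral>\<^sup>+w\<in>{-1/2..1/2}.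
      ennreal (\<bar>w\<bar> powr (- (\<alpha> * p))) * ennreal (energy_density \<alpha> p v x w) \<partial>lborel)" if x: "x \<in> {0..1}"
    proof -
      have "(\<integral>\<^sup>+y\<in>{0..1}. h x y \<partial>lborel) = (\<integral>\<^sup>+w\<in>{-1/2..1/2}. h x (x + w) \<partial>lborel)"
        by (rule nn_integral_periodic[OF meas per x])
      also have "\<dots> = (\<integral>\<^sup>+w\<in>{-1/2..1/2}.
        ennreal (\<bar>w\<bar> powr (- (\<alpha> * p))) * ennreal (energy_density \<alpha> p v x w) \<partial>lborel)"
      proof (rule nn_integral_cong_AE)
        show "AE w in lborel. h x (x + w) * indicator {-1/2..1/2} w =
          ennreal (\<bar>w\<bar> powr (- (\<alpha> * p))) * ennreal (energy_density \<alpha> p v x w) * indicator {-1/2..1/2} w"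
          using AE_lborel_singleton[of 0]
        proof eventually_elim
          case (elim w)
          then show ?case using point[of w x] by (cases "w \<in> {-1/2..1/2}") (auto simp: abs_le_iff)
        qed
      qed
      finally show ?thesis .
    qed
    then show "(\<integral>\<^sup>+y\<in>{0..1}. h x y \<partial>lborel) * indicator {0..1} x = (\<integral>\<^sup>+w\<in>{-1/2..1/2}.
      ennreal (\<bar>w\<bar> powr (- (\<alpha> * p))) * ennreal (energy_density \<alpha> p v x w) \<partial>lborel) * indicator {0..1} x"
      by (cases "x \<in> {0..1}") auto
  qed
  also have "\<dots> = (\<integral>\<^sup>+z. ennreal (energy_density \<alpha> p v (fst z) (snd z)) \<partial>strip (\<alpha> * p))"
    using nondegenerate_measurable(1)[OF nd c vel] by (subst nn_integral_strip) auto
  finally show ?thesis .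
qed

section \<open>Continuous differentiability on the Sobolev--Slobodeckij space\<close>

context
  fixes \<alpha> p s \<rho> :: real
  assumes p: "1 \<le> p" and \<alpha>: "0 < \<alpha>" and \<alpha>p: "2 < \<alpha> * p"
    and s_eq: "s = (\<alpha> * p - 1) / (2 * p)" and \<rho>_eq: "\<rho> = 2 * p"
begin

private abbreviation (input) "W \<equiv> sobolev_slobodeckij s \<rho>"
private abbreviation (input) "W_ir \<equiv> sobolev_slobodeckij_ir s \<rho>"
private abbreviation (input) "N \<equiv> sobolev_slobodeckij_norm s \<rho>"
private abbreviation (input) "E \<equiv> energy \<alpha> p (\<alpha> * p)"
private abbreviation (input) "D f h \<equiv> energy_var \<alpha> p (\<alpha> * p) (vel f) (vel h)"

private lemma \<rho>1: "1 \<le> \<rho>" and s\<rho>: "1 < s * \<rho>" and exponent: "1 + s * (2 * p) = \<alpha> * p" and q: "0 \<le> \<alpha> * p"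
  using p \<alpha>p by (simp_all add: s_eq \<rho>_eq)

private lemmas W_velocity = sobolev_velocity(1)[OF \<rho>1 s\<rho>]
private lemmas W_derivative = sobolev_velocity(2)[OF \<rho>1 s\<rho>]
private lemmas W_add_scaled = sobolev_add_scaled[OF \<rho>1 s\<rho>]
private lemmas W_scaled = sobolev_scaled[OF \<rho>1 s\<rho>]
private lemmas W_diff = sobolev_diff[OF \<rho>1 s\<rho>]
private lemmas N_scaled = sobolev_norm_scaled[OF \<rho>1 s\<rho>]
private lemmas N_nonneg = sobolev_norm_nonneg[OF \<rho>1 s\<rho>]

text \<open>The only link between the space and the integral estimates: the unit ball goes into
  velocities with oscillation integral at most 1.\<close>

lemma osc_integral_le_norm:
  fixes f :: "real \<Rightarrow> 'a::euclidean_space"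
  assumes f: "f \<in> W"
  shows "finite_osc p (\<alpha> * p) (vel f)"
    and "(\<integral>z. osc (vel f) (fst z) (snd z) powr p \<partial>strip (\<alpha> * p)) \<le> N f powr \<rho>"
proof -
  have q1: "1 \<le> 1 + s * (2 * p)" unfolding exponent using \<alpha>p by simp
  have "(\<integral>\<^sup>+z. ennreal (osc (vel f) (fst z) (snd z) powr p) \<partial>strip (\<alpha> * p)) \<le> gagliardo_pow s \<rho> (vel f)"
    using nn_integral_osc_powr_le[OF W_velocity[OF f] p q1] unfolding exponent \<rho>_eq .
  also have "\<dots> \<le> ennreal (N f powr \<rho>)" by (rule gagliardo_pow_le_norm[OF \<rho>1 s\<rho> f])
  finally have le: "(\<integral>\<^sup>+z. ennreal (osc (vel f) (fst z) (snd z) powr p) \<partial>strip (\<alpha> * p)) \<le> ennreal (N f powr \<rho>)" .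
  have [measurable]: "(\<lambda>z. osc (vel f) (fst z) (snd z)) \<in> borel_measurable borel"
    using continuous_on_osc[OF W_velocity[OF f]] by (rule borel_measurable_continuous_onI)
  have int: "integrable (strip (\<alpha> * p)) (\<lambda>z. osc (vel f) (fst z) (snd z) powr p)"
    using order.strict_trans1[OF le] by (intro integrableI_bounded) auto
  then show "finite_osc p (\<alpha> * p) (vel f)"
    by (simp add: finite_osc_def[OF p \<alpha> q] W_velocity[OF f])
  have "ennreal (\<integral>z. osc (vel f) (fst z) (snd z) powr p \<partial>strip (\<alpha> * p)) \<le> ennreal (N f powr \<rho>)"
    using le nn_integral_eq_integral[OF int] by simp
  then show "(\<integral>z. osc (vel f) (fst z) (snd z) powr p \<partial>strip (\<alpha> * p)) \<le> N f powr \<rho>"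
    by (simp add: ennreal_le_iff)
qed

lemma ir_iff_nondegenerate:
  fixes f :: "real \<Rightarrow> 'a::euclidean_space"
  shows "f \<in> W_ir \<longleftrightarrow> f \<in> W \<and> (\<exists>c C. 0 < c \<and> nondegenerate c C (vel f))"
proof (intro iffI conjI)
  assume f: "f \<in> W_ir"
  then show fW: "f \<in> W" by (simp add: sobolev_slobodeckij_ir_def)
  show "\<exists>c C. 0 < c \<and> nondegenerate c C (vel f)"
    using injective_regular_imp_nondegenerate[OF W_derivative[OF fW] W_velocity[OF fW]] f
    unfolding sobolev_slobodeckij_ir_def by blast
next
  assume f: "f \<in> W \<and> (\<exists>c C. 0 < c \<and> nondegenerate c C (vel f))"
  then obtain c C where "0 < c" "nondegenerate c C (vel f)" by blast
  then show "f \<in> W_ir"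
    using nondegenerate_imp_injective_regular[OF W_derivative W_velocity] f
    by (auto simp: sobolev_slobodeckij_ir_def)
qed

lemma ohara_energy_eq_energy:
  fixes f :: "real \<Rightarrow> 'a::euclidean_space"
  assumes f: "f \<in> W_ir"
  shows "ohara_energy \<alpha> p f = ennreal (E (vel f))" "0 \<le> E (vel f)"
proof -
  obtain c C where fW: "f \<in> W" and c: "0 < c" and nd: "nondegenerate c C (vel f)"
    using f ir_iff_nondegenerate by blast
  have nn: "AE z in strip (\<alpha> * p). 0 \<le> energy_density \<alpha> p (vel f) (fst z) (snd z)"
    using AE_strip_bounds by eventually_elim (use energy_density_bounds(1)[OF c \<alpha> nd _ _ p] in auto)
  show "ohara_energy \<alpha> p f = ennreal (E (vel f))"
    unfolding ohara_energy_eq_strip[OF W_derivative[OF fW] nd c \<alpha> p] energy_def[OF p \<alpha> q]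
    by (rule nn_integral_eq_integral[OF integrable_energy_density[OF p \<alpha> q nd c osc_integral_le_norm(1)[OF fW]] nn])
  show "0 \<le> E (vel f)" unfolding energy_def[OF p \<alpha> q] by (rule integral_nonneg_AE[OF nn])
qed

text \<open>Half of \<open>c\<close> is given up to obtain common bounds on a ball, so that the
  constants of the pointwise estimates do not depend on the curve.\<close>

lemma ir_ball:
  fixes f :: "real \<Rightarrow> 'a::euclidean_space"
  assumes f: "f \<in> W_ir"
  obtains c C \<delta> where "0 < c" "0 < \<delta>" "nondegenerate c C (vel f)"
    "\<And>g. g \<in> W \<Longrightarrow> N (\<lambda>x. g x - f x) < \<delta> \<Longrightarrow> nondegenerate c C (vel g)"
proof -
  obtain c C where fW: "f \<in> W" and c: "0 < c" and nd: "nondegenerate c C (vel f)"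
    using f ir_iff_nondegenerate by blast
  obtain K where K: "0 \<le> K" "\<And>(h :: real \<Rightarrow> 'a) x. h \<in> W \<Longrightarrow> norm (vel h x) \<le> K * N h"
    using norm_velocity_le_sobolev_norm[OF \<rho>1 s\<rho>] by blast
  define \<delta> where "\<delta> = c / (2 * (K + 1))"
  show thesis
  proof (rule that)
    show "0 < c - c / 2" "0 < \<delta>" using c K(1) by (simp_all add: \<delta>_def)
    show "nondegenerate (c - c / 2) (C + c / 2) (vel f)" by (rule nondegenerate_mono[OF nd]) (use c in auto)
    fix g assume g: "g \<in> W" and lt: "N (\<lambda>x. g x - f x) < \<delta>"
    note d = W_diff[OF g fW]
    have "K * N (\<lambda>x. g x - f x) \<le> (K + 1) * \<delta>"
      using lt K(1) N_nonneg by (intro mult_mono) auto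
    also have "\<dots> = c / 2" using K(1) by (simp add: \<delta>_def field_simps)
    finally have "\<bar>1\<bar> * (K * N (\<lambda>x. g x - f x)) \<le> c / 2" by simp
    from nondegenerate_perturb[OF nd W_velocity[OF d(1)] K(2)[OF d(1)] this]
    show "nondegenerate (c - c / 2) (C + c / 2) (vel g)" by (simp add: d(2))
  qed
qed

lemma ir_open: "open_in_normed W N (W_ir :: (real \<Rightarrow> 'a::euclidean_space) set)"
  unfolding open_in_normed_def
proof (intro conjI ballI)
  show "W_ir \<subseteq> W" by (auto simp: sobolev_slobodeckij_ir_def)
  fix f :: "real \<Rightarrow> 'a" assume "f \<in> W_ir"
  then obtain c C \<delta> where "0 < c" "0 < \<delta>"
    and "\<And>g. g \<in> W \<Longrightarrow> N (\<lambda>x. g x - f x) < \<delta> \<Longrightarrow> nondegenerate c C (vel g)"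
    by (rule ir_ball) blast
  then show "\<exists>\<delta>>0. \<forall>g\<in>W. N (\<lambda>x. g x - f x) < \<delta> \<longrightarrow> g \<in> W_ir"
    using ir_iff_nondegenerate by blast
qed

lemma D_add_scaled:
  fixes f h k :: "real \<Rightarrow> 'a::euclidean_space"
  assumes f: "f \<in> W_ir" and h: "h \<in> W" and k: "k \<in> W"
  shows "D f (\<lambda>x. h x + t *\<^sub>R k x) = D f h + t * D f k"
proof -
  obtain c C where fW: "f \<in> W" and c: "0 < c" and nd: "nondegenerate c C (vel f)"
    using f ir_iff_nondegenerate by blast
  obtain K where K: "0 \<le> K" "\<And>(h :: real \<Rightarrow> 'a) x. h \<in> W \<Longrightarrow> norm (vel h x) \<le> K * N h"
    using norm_velocity_le_sobolev_norm[OF \<rho>1 s\<rho>] by blast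
  show ?thesis
    unfolding W_add_scaled(2)[OF h k]
    by (rule energy_var_add_scaled[OF p \<alpha> q nd c osc_integral_le_norm(1)[OF fW] osc_integral_le_norm(1)[OF h] K(2)[OF h]
          osc_integral_le_norm(1)[OF k] K(2)[OF k]])
qed

lemma D_scaled:
  fixes f h :: "real \<Rightarrow> 'a::euclidean_space"
  assumes f: "f \<in> W_ir" and h: "h \<in> W"
  shows "D f (\<lambda>x. t *\<^sub>R h x) = t * D f h"
proof -
  note z = zero_in_sobolev[OF \<rho>1 s\<rho>]
  \<comment> \<open>Additivity at the zero direction forces the value 0, which reduces homogeneity
    to the previous lemma.\<close>
  have "D f (\<lambda>x. 0) = D f (\<lambda>x. 0) + 1 * D f (\<lambda>x. 0)" using D_add_scaled[OF f z z, of 1] by simp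
  then show ?thesis using D_add_scaled[OF f z h, of t] by simp
qed

text \<open>The functional is applied to multiples of \<open>h\<close>. If \<open>N h = 0\<close>,
  arbitrarily large multiples are allowed and \<open>L h\<close> must vanish, so no definiteness of
  the norm is used.\<close>

lemma bound_from_unit_ball:
  fixes h :: "real \<Rightarrow> 'a::euclidean_space" and L :: "(real \<Rightarrow> 'a) \<Rightarrow> real"
  assumes hom: "\<And>t h. h \<in> W \<Longrightarrow> L (\<lambda>x. t *\<^sub>R h x) = t * L h"
    and unit: "\<And>h. h \<in> W \<Longrightarrow> N h \<le> 1 \<Longrightarrow> \<bar>L h\<bar> \<le> B" and h: "h \<in> W"
  shows "\<bar>L h\<bar> \<le> B * N h"
proof -
  have scaled: "t * \<bar>L h\<bar> \<le> B" if "0 \<le> t" "t * N h \<le> 1" for t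
    using unit[OF W_scaled(1)[OF h], of t] that by (simp add: N_scaled[OF h] hom[OF h] abs_mult)
  have B: "0 \<le> B" using scaled[of 0] by simp
  show ?thesis
  proof (cases "N h = 0")
    case True
    have "L h = 0"
    proof (rule ccontr)
      assume "L h \<noteq> 0"
      then show False using scaled[of "(B + 1) / \<bar>L h\<bar>"] True B by simp
    qed
    then show ?thesis using True by simp
  next
    case False
    then have "0 < N h" using N_nonneg[of h] by simp
    then show ?thesis using scaled[of "1 / N h"] by (simp add: field_simps)
  qed
qed

lemma D_bounded_linear:
  fixes f :: "real \<Rightarrow> 'a::euclidean_space"
  assumes f: "f \<in> W_ir"
  shows "bounded_linear_functional_on W N (D f)"
  unfolding bounded_linear_functional_on_def
proof (intro conjI ballI allI)
  show "D f (\<lambda>x. h x + k x) = D f h + D f k" if "h \<in> W" "k \<in> W" for h k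
    using D_add_scaled[OF f that, of 1] by simp
  show "D f (\<lambda>x. t *\<^sub>R h x) = t * D f h" if "h \<in> W" for t h
    by (rule D_scaled[OF f that])
  obtain c C where fW: "f \<in> W" and c: "0 < c" and nd: "nondegenerate c C (vel f)"
    using f ir_iff_nondegenerate by blast
  obtain K where K: "0 \<le> K" "\<And>(h :: real \<Rightarrow> 'a) x. h \<in> W \<Longrightarrow> norm (vel h x) \<le> K * N h"
    using norm_velocity_le_sobolev_norm[OF \<rho>1 s\<rho>] by blast
  obtain B where B: "\<And>k. finite_osc p (\<alpha> * p) k \<Longrightarrow> (\<And>x. norm (k x) \<le> K) \<Longrightarrow>
      (\<integral>z. osc k (fst z) (snd z) powr p \<partial>strip (\<alpha> * p)) \<le> 1 \<Longrightarrow> \<bar>energy_var \<alpha> p (\<alpha> * p) (vel f) k\<bar> \<le> B"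
    using energy_var_bounded[OF p \<alpha> q nd c osc_integral_le_norm(1)[OF fW] K(1)] by blast
  have "\<bar>D f h\<bar> \<le> B * N h" if h: "h \<in> W" for h :: "real \<Rightarrow> 'a"
  proof (rule bound_from_unit_ball[OF D_scaled[OF f] _ h])
    fix h :: "real \<Rightarrow> 'a" assume h: "h \<in> W" and N1: "N h \<le> 1"
    show "\<bar>D f h\<bar> \<le> B"
    proof (rule B[OF osc_integral_le_norm(1)[OF h]])
      show "norm (vel h x) \<le> K" for x
        using order.trans[OF K(2)[OF h, of x] mult_left_mono[OF N1 K(1)]] by simp
      have "N h powr \<rho> \<le> 1" using N1 N_nonneg[of h] \<rho>1 by (intro powr_le1) auto
      then show "(\<integral>z. osc (vel h) (fst z) (snd z) powr p \<partial>strip (\<alpha> * p)) \<le> 1"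
        using osc_integral_le_norm(2)[OF h] by simp
    qed
  qed
  then show "\<exists>B. \<forall>h\<in>W. \<bar>D f h\<bar> \<le> B * N h" by blast
qed

text \<open>On the unit ball the claim is proved by contradiction: a failing \<epsilon> yields
  curves converging to \<open>f\<close> and directions of norm at most 1 that violate
  \<open>energy_var_tendsto\<close>. Homogeneity extends the estimate to all directions.\<close>

lemma D_continuous:
  fixes f :: "real \<Rightarrow> 'a::euclidean_space"
  assumes f: "f \<in> W_ir" and \<epsilon>: "0 < \<epsilon>"
  shows "\<exists>\<delta>>0. \<forall>g\<in>W_ir. N (\<lambda>x. g x - f x) < \<delta> \<longrightarrow> (\<forall>h\<in>W. \<bar>D g h - D f h\<bar> \<le> \<epsilon> * N h)"
proof -
  obtain c C \<delta>0 where c: "0 < c" and \<delta>0: "0 < \<delta>0" and nd: "nondegenerate c C (vel f)"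
    and ball: "\<And>g. g \<in> W \<Longrightarrow> N (\<lambda>x. g x - f x) < \<delta>0 \<Longrightarrow> nondegenerate c C (vel g)"
    by (rule ir_ball[OF f]) blast
  have ir_W: "g \<in> W" if "g \<in> W_ir" for g :: "real \<Rightarrow> 'a" using that by (simp add: sobolev_slobodeckij_ir_def)
  note fW = ir_W[OF f]
  obtain K where K: "0 \<le> K" "\<And>(h :: real \<Rightarrow> 'a) x. h \<in> W \<Longrightarrow> norm (vel h x) \<le> K * N h"
    using norm_velocity_le_sobolev_norm[OF \<rho>1 s\<rho>] by blast
  have unit: "\<exists>\<delta>>0. \<forall>g\<in>W_ir. N (\<lambda>x. g x - f x) < \<delta> \<longrightarrow> (\<forall>h\<in>W. N h \<le> 1 \<longrightarrow> \<bar>D g h - D f h\<bar> \<le> \<epsilon>)"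
  proof (rule ccontr)
    assume contra: "\<not> ?thesis"
    \<comment> \<open>The radius \<delta>0 keeps all curves of the sequence within common bounds,
      and \<open>1 / real (Suc j)\<close> makes them converge.\<close>
    define P where "P j g h \<longleftrightarrow> g \<in> W_ir \<and> h \<in> W \<and> N (\<lambda>x. g x - f x) < min \<delta>0 (1 / real (Suc j)) \<and>
        N h \<le> 1 \<and> \<epsilon> < \<bar>D g h - D f h\<bar>" for j and g h :: "real \<Rightarrow> 'a"
    have "\<forall>j. \<exists>gh. P j (fst gh) (snd gh)"
    proof
      fix j
      have "0 < min \<delta>0 (1 / real (Suc j))" using \<delta>0 by simp
      then obtain g h where "P j g h" using contra unfolding P_def not_le[symmetric] by blast
      then show "\<exists>gh. P j (fst gh) (snd gh)" by (intro exI[of _ "(g, h)"]) simp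
    qed
    then obtain gh where P: "\<And>j. P j (fst (gh j)) (snd (gh j))" using choice[of "\<lambda>j gh. P j (fst gh) (snd gh)"] by blast
    define g h where "g j = fst (gh j)" and "h j = snd (gh j)" for j
    have gh: "g j \<in> W_ir" "h j \<in> W" "N (\<lambda>x. g j x - f x) < min \<delta>0 (1 / real (Suc j))"
      "N (h j) \<le> 1" "\<epsilon> < \<bar>D (g j) (h j) - D f (h j)\<bar>" for j
      using P[of j] by (simp_all add: P_def g_def h_def)
    note gW = ir_W[OF gh(1)]
    have small: "N (\<lambda>x. g j x - f x) \<le> 1 / real (Suc j)" for j using gh(3)[of j] by simp
    have inv: "(\<lambda>j. 1 / real (Suc j)) \<longlonglongrightarrow> 0" by (rule LIMSEQ_Suc[OF lim_1_over_n])
    note d = W_diff[OF gW fW]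
    have "(\<lambda>j. energy_var \<alpha> p (\<alpha> * p) (vel (g j)) (vel (h j)) - energy_var \<alpha> p (\<alpha> * p) (vel f) (vel (h j))) \<longlonglongrightarrow> 0"
    proof (rule energy_var_tendsto[OF p \<alpha> q c nd osc_integral_le_norm(1)[OF fW] ball[OF gW] osc_integral_le_norm(1)[OF gW],
          where \<delta> = "\<lambda>j. K * (1 / real (Suc j))" and K = K and B = 1])
      show "N (\<lambda>x. g j x - f x) < \<delta>0" for j using gh(3)[of j] by simp
      show "(\<lambda>j. K * (1 / real (Suc j))) \<longlonglongrightarrow> 0" using tendsto_mult_left[OF inv, of K] by simp
      show "norm (vel (g j) x - vel f x) \<le> K * (1 / real (Suc j))" for j x
        using order.trans[OF K(2)[OF d(1)] mult_left_mono[OF small K(1)], of j x] by (simp add: d(2))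
      show "finite_osc p (\<alpha> * p) (\<lambda>x. vel (g j) x - vel f x)" for j
        using osc_integral_le_norm(1)[OF d(1)[of j]] by (simp add: d(2))
      show "(\<lambda>j. \<integral>z. osc (\<lambda>x. vel (g j) x - vel f x) (fst z) (snd z) powr p \<partial>strip (\<alpha> * p)) \<longlonglongrightarrow> 0"
      proof (rule tendsto_sandwich[OF _ _ tendsto_const])
        show "\<forall>\<^sub>F j in sequentially. 0 \<le> (\<integral>z. osc (\<lambda>x. vel (g j) x - vel f x) (fst z) (snd z) powr p \<partial>strip (\<alpha> * p))"
          by (intro always_eventually allI integral_nonneg_AE) auto
        show "\<forall>\<^sub>F j in sequentially. (\<integral>z. osc (\<lambda>x. vel (g j) x - vel f x) (fst z) (snd z) powr p \<partial>strip (\<alpha> * p)) \<le>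
            (1 / real (Suc j)) powr \<rho>"
        proof (intro always_eventually allI)
          fix j
          have "(\<integral>z. osc (\<lambda>x. vel (g j) x - vel f x) (fst z) (snd z) powr p \<partial>strip (\<alpha> * p)) \<le> N (\<lambda>x. g j x - f x) powr \<rho>"
            using osc_integral_le_norm(2)[OF d(1)[of j]] by (simp add: d(2))
          also have "\<dots> \<le> (1 / real (Suc j)) powr \<rho>"
            using small[of j] N_nonneg \<rho>1 by (intro powr_mono2) auto
          finally show "(\<integral>z. osc (\<lambda>x. vel (g j) x - vel f x) (fst z) (snd z) powr p \<partial>strip (\<alpha> * p)) \<le> (1 / real (Suc j)) powr \<rho>" .
        qed
        show "(\<lambda>j. (1 / real (Suc j)) powr \<rho>) \<longlonglongrightarrow> 0"
          using \<rho>1 by (intro tendsto_zero_powrI[OF inv tendsto_const]) auto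
      qed
      show "finite_osc p (\<alpha> * p) (vel (h j))" for j by (rule osc_integral_le_norm(1)[OF gh(2)])
      show "norm (vel (h j) x) \<le> K" for j x
        using order.trans[OF K(2)[OF gh(2)] mult_left_mono[OF gh(4) K(1)], of j x] by simp
      have "N (h j) powr \<rho> \<le> 1" for j using gh(4)[of j] N_nonneg[of "h j"] \<rho>1 by (intro powr_le1) auto
      then show "(\<integral>z. osc (vel (h j)) (fst z) (snd z) powr p \<partial>strip (\<alpha> * p)) \<le> 1" for j
        using osc_integral_le_norm(2)[OF gh(2)] by (meson order.trans)
    qed
    from order_tendstoD(2)[OF tendsto_rabs[OF this], of \<epsilon>]
    have "\<forall>\<^sub>F j in sequentially. \<bar>D (g j) (h j) - D f (h j)\<bar> < \<epsilon>" using \<epsilon> by simp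
    then obtain j where "\<bar>D (g j) (h j) - D f (h j)\<bar> < \<epsilon>" by (auto simp: eventually_sequentially)
    then show False using gh(5)[of j] by simp
  qed
  then obtain \<delta> where \<delta>: "0 < \<delta>"
    "\<And>g h. g \<in> W_ir \<Longrightarrow> N (\<lambda>x. g x - f x) < \<delta> \<Longrightarrow> h \<in> W \<Longrightarrow> N h \<le> 1 \<Longrightarrow> \<bar>D g h - D f h\<bar> \<le> \<epsilon>"
    by blast
  have "\<bar>D g h - D f h\<bar> \<le> \<epsilon> * N h" if g: "g \<in> W_ir" "N (\<lambda>x. g x - f x) < \<delta>" and h: "h \<in> W" for g h
    by (rule bound_from_unit_ball[of "\<lambda>h. D g h - D f h", OF _ \<delta>(2)[OF g] h])
       (simp_all add: D_scaled[OF g(1)] D_scaled[OF f] right_diff_distrib)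
  then show ?thesis using \<delta>(1) by blast
qed

text \<open>The mean value theorem on the segment from \<open>f\<close> to \<open>f + h\<close>
  replaces the increment by the derivative at an intermediate curve. That the segment stays among
  the injective regular curves follows from the ball around \<open>f\<close>, not from membership of
  its endpoint; this is the role of \<delta>2, while \<delta>1 compares the derivatives.\<close>

lemma energy_has_frechet_derivative:
  "has_frechet_derivative_on W N (W_ir :: (real \<Rightarrow> 'a::euclidean_space) set)
     (\<lambda>\<gamma>. enn2real (ohara_energy \<alpha> p \<gamma>)) D"
  unfolding has_frechet_derivative_on_def
proof (intro ballI conjI allI impI)
  fix f :: "real \<Rightarrow> 'a" assume f: "f \<in> W_ir"
  show "bounded_linear_functional_on W N (D f)" by (rule D_bounded_linear[OF f])
  fix \<epsilon> :: real assume \<epsilon>: "0 < \<epsilon>"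
  obtain \<delta>1 where \<delta>1: "0 < \<delta>1"
    "\<And>g h. g \<in> W_ir \<Longrightarrow> N (\<lambda>x. g x - f x) < \<delta>1 \<Longrightarrow> h \<in> W \<Longrightarrow> \<bar>D g h - D f h\<bar> \<le> \<epsilon> * N h"
    using D_continuous[OF f \<epsilon>] by blast
  obtain c C \<delta>2 where c: "0 < c" and \<delta>2: "0 < \<delta>2"
    and ball: "\<And>g. g \<in> W \<Longrightarrow> N (\<lambda>x. g x - f x) < \<delta>2 \<Longrightarrow> nondegenerate c C (vel g)"
    by (rule ir_ball[OF f]) blast
  have fW: "f \<in> W" using f by (simp add: sobolev_slobodeckij_ir_def)
  obtain K where K: "0 \<le> K" "\<And>(h :: real \<Rightarrow> 'a) x. h \<in> W \<Longrightarrow> norm (vel h x) \<le> K * N h"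
    using norm_velocity_le_sobolev_norm[OF \<rho>1 s\<rho>] by blast
  show "\<exists>\<delta>>0. \<forall>h\<in>W. N h < \<delta> \<longrightarrow> (\<lambda>x. f x + h x) \<in> W_ir \<longrightarrow>
      \<bar>enn2real (ohara_energy \<alpha> p (\<lambda>x. f x + h x)) - enn2real (ohara_energy \<alpha> p f) - D f h\<bar> \<le> \<epsilon> * N h"
  proof (intro exI conjI ballI impI)
    show "0 < min \<delta>1 \<delta>2" using \<delta>1 \<delta>2 by simp
    fix h assume h: "h \<in> W" and Nh: "N h < min \<delta>1 \<delta>2" and fh: "(\<lambda>x. f x + h x) \<in> W_ir"
    note line = W_add_scaled[OF fW h]
    define \<phi> where "\<phi> t = E (\<lambda>x. vel f x + t *\<^sub>R vel h x)" for t
    have close: "N (\<lambda>x. (f x + t *\<^sub>R h x) - f x) < min \<delta>1 \<delta>2" if "0 \<le> t" "t \<le> 1" for t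
    proof -
      have "t * N h \<le> 1 * N h" using that N_nonneg by (intro mult_right_mono) auto
      then show ?thesis using Nh that by (simp add: N_scaled[OF h])
    qed
    have nd: "nondegenerate c C (vel (\<lambda>x. f x + t *\<^sub>R h x))" if "0 \<le> t" "t \<le> 1" for t
      using close[OF that] by (intro ball line(1)) simp
    have ir: "(\<lambda>x. f x + t *\<^sub>R h x) \<in> W_ir" if "0 \<le> t" "t \<le> 1" for t
      using nd[OF that] c line(1) ir_iff_nondegenerate by blast
    have deriv: "(\<phi> has_real_derivative D (\<lambda>x. f x + t *\<^sub>R h x) h) (at t)" if t: "0 \<le> t" "t \<le> 1" for t
      unfolding \<phi>_def
    proof (rule has_real_derivative_shift_line)
      have nd': "nondegenerate c C (\<lambda>x. vel f x + t *\<^sub>R vel h x)" using nd[OF t] by (simp add: line(2))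
      have fin: "finite_osc p (\<alpha> * p) (\<lambda>x. vel f x + r *\<^sub>R vel h x)" for r
        using osc_integral_le_norm(1)[OF line(1)[of r]] by (simp add: line(2))
      have fin': "finite_osc p (\<alpha> * p) (\<lambda>x. (vel f x + t *\<^sub>R vel h x) + r *\<^sub>R vel h x)" for r
        using fin[of "t + r"] by (simp add: algebra_simps)
      show "((\<lambda>r. E (\<lambda>x. vel f x + t *\<^sub>R vel h x + r *\<^sub>R vel h x)) has_real_derivative D (\<lambda>x. f x + t *\<^sub>R h x) h) (at 0)"
        unfolding line(2)
        by (rule energy_has_derivative_along_line[OF p \<alpha> q nd' c fin osc_integral_le_norm(1)[OF h] K(2)[OF h] fin'])
    qed
    obtain z where z: "0 < z" "z < 1" "\<phi> 1 - \<phi> 0 = (1 - 0) * D (\<lambda>x. f x + z *\<^sub>R h x) h"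
      using MVT2[of 0 1 \<phi> "\<lambda>t. D (\<lambda>x. f x + t *\<^sub>R h x) h"] deriv by auto
    have "enn2real (ohara_energy \<alpha> p (\<lambda>x. f x + h x)) = \<phi> 1" "enn2real (ohara_energy \<alpha> p f) = \<phi> 0"
      using ohara_energy_eq_energy[OF fh] ohara_energy_eq_energy[OF f] line(2)[of 1] by (simp_all add: \<phi>_def)
    then have "\<bar>enn2real (ohara_energy \<alpha> p (\<lambda>x. f x + h x)) - enn2real (ohara_energy \<alpha> p f) - D f h\<bar> =
        \<bar>D (\<lambda>x. f x + z *\<^sub>R h x) h - D f h\<bar>" using z(3) by simp
    also have "\<dots> \<le> \<epsilon> * N h"
      using z close[of z] by (intro \<delta>1(2) ir h) auto
    finally show "\<bar>enn2real (ohara_energy \<alpha> p (\<lambda>x. f x + h x)) - enn2real (ohara_energy \<alpha> p f) - D f h\<bar> \<le> \<epsilon> * N h" .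
  qed
qed

lemma ohara_energy_continuously_differentiable:
  "continuously_frechet_differentiable_on W N (W_ir :: (real \<Rightarrow> 'a::euclidean_space) set)
     (\<lambda>\<gamma>. enn2real (ohara_energy \<alpha> p \<gamma>))"
  unfolding continuously_frechet_differentiable_on_def
  using ir_open energy_has_frechet_derivative D_continuous by blast

lemma ohara_energy_finite:
  fixes f :: "real \<Rightarrow> 'a::euclidean_space"
  shows "f \<in> W_ir \<Longrightarrow> ohara_energy \<alpha> p f < \<infinity>"
  by (subst ohara_energy_eq_energy(1)) simp_all

end

text \<open>Finiteness is asserted on its own because \<open>enn2real\<close> sends infinity to 0,
  so differentiability of the real-valued functional would not exclude infinite energy.\<close>

theorem theorem5p1:
  fixes \<alpha> p s \<rho> :: real
    and W W_ir :: "(real \<Rightarrow> real ^ 'n) set"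
  assumes "p \<ge> 1" and "\<alpha> > 0" and "2 < \<alpha> * p" and "\<alpha> * p < 2 * p + 1"
  defines "s \<equiv> (\<alpha> * p - 1) / (2 * p)" and "\<rho> \<equiv> 2 * p"
  defines "W \<equiv> sobolev_slobodeckij s \<rho>" and "W_ir \<equiv> sobolev_slobodeckij_ir s \<rho>"
  shows "(\<forall>\<gamma>\<in>W_ir. ohara_energy \<alpha> p \<gamma> < \<infinity>) \<and>
    continuously_frechet_differentiable_on W (sobolev_slobodeckij_norm s \<rho>) W_ir
      (\<lambda>\<gamma>. enn2real (ohara_energy \<alpha> p \<gamma>))"
  unfolding W_def W_ir_def
  using ohara_energy_finite[OF assms(1-3) s_def[THEN meta_eq_to_obj_eq] \<rho>_def[THEN meta_eq_to_obj_eq]]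
    ohara_energy_continuously_differentiable[OF assms(1-3) s_def[THEN meta_eq_to_obj_eq] \<rho>_def[THEN meta_eq_to_obj_eq]]
  by blast

end
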